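(* Suppose that $c$ satisfies conditions (C1), (C2), (C3) stated in the context. Then the Nemytskii operator $C:U\times\mathcal{F}\to V$, $C(u;f)(x)=c(x,J^ku(x);J^lf(x))$, is well defined and maps bounded subsets of $U\times\mathcal{F}$ into bounded subsets of $V$. Moreover, let $f_0\in\mathcal{F}$ and $u_{f_0}\in U$ be fixed. Then there exist constants $r,s>0$ and a modulus of continuity $\omega_C:[0,\infty)\to[0,\infty)$ with $\omega_C(0)=0$ such that $$\|C(u;f)-C(v;f)\|_V\le\omega_C(\|u-v\|_U)\qquad\text{for all }u,v\in B_r(u_{f_0}),\ f\in B_s(f_0).$$ More specifically, there exist constants $w_0,w_1>0$ such that (for suitable $R,R_f>0$) $$\omega_C(t)=w_0\Bigl(\omega_{R,R_f}(w_1t)+\sum_{\alpha\in A_{\mathrm{glob}}(k,2m)}t^{\gamma_\alpha}\Bigr),$$ with $\omega_{R,R_f}$ and $\gamma_\alpha$ as in (C2).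
   Context: $\mathcal{O}\subset\mathbb{R}^d$ is a bounded domain with $C^1$ boundary. $U\subset H^{2m}(\mathcal{O})$ is a closed subspace (with the $H^{2m}$ norm), $V=L^2(\mathcal{O})$, and the parameter space $\mathcal{F}$ is a closed subspace of $H^l(\mathcal{O})$. The differential operators considered are $\mathcal{L}_f(u)=\mathbb{L}u-C(u;f)$ with $\mathbb{L}:U\to V$ a symmetric $U$-coercive differential operator of order $2m$; $u_f\in U$ denotes the solution corresponding to the parameter $f$. $J^ku=(\partial^\alpha u)_{|\alpha|\le k}$ (values in $\mathbb{R}^M$, $k<2m$) and $J^lf=(\partial^\alpha f)_{|\alpha|\le l}$ (values in $\mathbb{R}^{M_f}$). $B_r(\cdot)$ denotes an open ball. For jet depth $j\ge0$ and Sobolev regularity $s$, $$A_{\mathrm{loc}}(j,s)=\{\alpha:|\alpha|\le j,\ s-|\alpha|>d/2\},\qquad A_{\mathrm{glob}}(j,s)=\{\alpha:|\alpha|\le j,\ s-|\alpha|\le d/2\}.$$ For $\xi\in\mathbb{R}^M$, $\zeta\in\mathbb{R}^{M_f}$ put $\xi_{\mathrm{loc}}=(\xi_\alpha)_{\alpha\in A_{\mathrm{loc}}(k,2m)}$, $\zeta_{\mathrm{loc}}=(\zeta_\alpha)_{\alpha\in A_{\mathrm{loc}}(l,l)}$. A modulus of continuity is a function $\omega$ with values in $[0,\infty)$ and $\omega(0)=0$, used to measure quantitatively the uniform continuity of functions. $c:\mathcal{O}\times\mathbb{R}^M\times\mathbb{R}^{M_f}\to\mathbb{R}$ is a Carathéodory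 function. Conditions: (C1) For every $R,R_f>0$ there exist $a_{R,R_f}\in L^2(\mathcal{O})$, $b_{R,R_f}\ge0$ and exponents $q_\alpha\ge1$, $p_\alpha\ge1$ such that $$|c(x,\xi;\zeta)|\le a_{R,R_f}(x)+b_{R,R_f}\Bigl(\sum_{\alpha\in A_{\mathrm{glob}}(k,2m)}|\xi_\alpha|^{q_\alpha}+\sum_{\alpha\in A_{\mathrm{glob}}(l,l)}|\zeta_\alpha|^{p_\alpha}\Bigr)$$ for a.e. $x\in\mathcal{O}$, all $\xi\in\mathbb{R}^M$ with $|\xi_{\mathrm{loc}}|\le R$ and all $\zeta\in\mathbb{R}^{M_f}$ with $|\zeta_{\mathrm{loc}}|\le R_f$. Furthermore $q_\alpha\le\frac{d}{d-2(2m-|\alpha|)}$ and $p_\alpha\le\frac{d}{d-2(l-|\alpha|)}$. (C2) For every $R,R_f>0$ there exist a non-decreasing function $\omega_{R,R_f}:[0,\infty)\to[0,\infty)$ with $\omega_{R,R_f}(0)=0$ and $t\mapsto\omega_{R,R_f}(\sqrt t)^2$ concave, a constant $L_{R,R_f}<\infty$ and exponents $\gamma_\alpha\in(0,1]$, $\delta_\alpha\in(0,1]$ such that $$\begin{aligned}|c(x,\xi_1;\zeta_1)-c(x,\xi_2;\zeta_2)|\le{}&L_{R,R_f}\,\omega_{R,R_f}\bigl(|\xi_{1,\mathrm{loc}}-\xi_{2,\mathrm{loc}}|+|\zeta_{1,\mathrm{loc}}-\zeta_{2,\mathrm{loc}}|\bigr)\\&+L_{R,R_f}\sum_{\alpha\in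 A_{\mathrm{glob}}(k,2m)}\bigl(|\xi_{1,\alpha}|^{q_\alpha-\gamma_\alpha}+|\xi_{2,\alpha}|^{q_\alpha-\gamma_\alpha}\bigr)|\xi_{1,\alpha}-\xi_{2,\alpha}|^{\gamma_\alpha}\\&+L_{R,R_f}\sum_{\alpha\in A_{\mathrm{glob}}(l,l)}\bigl(|\zeta_{1,\alpha}|^{p_\alpha-\delta_\alpha}+|\zeta_{2,\alpha}|^{p_\alpha-\delta_\alpha}\bigr)|\zeta_{1,\alpha}-\zeta_{2,\alpha}|^{\delta_\alpha}\end{aligned}$$ for a.e. $x\in\mathcal{O}$ and all $\xi_i,\zeta_i$ subject to the local bounds $R,R_f$. (C3) For a given $f_0\in\mathcal{F}$ and corresponding solution $u_{f_0}\in U$ there exist $r,s>0$, an invertible bounded linear operator $A\in L(\mathcal{F},V)$ with $\|A^{-1}\|<\infty$, and $\theta\in(0,1)$ such that $\|C(u;f_1)-C(u;f_2)-A(f_1-f_2)\|_V\le\frac{\theta}{\|A^{-1}\|}\|f_1-f_2\|_{\mathcal{F}}$ for all $u\in B_r(u_{f_0})$ and $f_1,f_2\in B_s(f_0)$. *)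

theory Defs
  imports "HOL-Analysis.Analysis"
begin

text \<open>The space dimension is \<open>d = CARD('n)\<close>.  A point of \<open>\<real>\<^sup>M\<close>, where \<open>M\<close> is the number of
  multi-indices of order at most \<open>j\<close>, is a family indexed by all multi-indices that vanishes beyond
  order \<open>j\<close>.  On \<open>jet_space j\<close> the product topology of the function type is the Euclidean one.\<close>

type_synonym 'n mindex = "'n \<Rightarrow> nat"
type_synonym 'n jet = "'n mindex \<Rightarrow> real"

definition mindex_order :: "'n::finite mindex \<Rightarrow> nat" where
  "mindex_order \<alpha> = (\<Sum>i\<in>UNIV. \<alpha> i)"

definition jet_space :: "nat \<Rightarrow> 'n::finite jet set" where
  "jet_space j = {\<xi>. \<forall>\<alpha>. j < mindex_order \<alpha> \<longrightarrow> \<xi> \<alpha> = 0}"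

definition A_loc :: "nat \<Rightarrow> nat \<Rightarrow> 'n::finite mindex set" where
  "A_loc j s = {\<alpha>. mindex_order \<alpha> \<le> j \<and> real s - real (mindex_order \<alpha>) > real CARD('n) / 2}"

definition A_glob :: "nat \<Rightarrow> nat \<Rightarrow> 'n::finite mindex set" where
  "A_glob j s = {\<alpha>. mindex_order \<alpha> \<le> j \<and> real s - real (mindex_order \<alpha>) \<le> real CARD('n) / 2}"

text \<open>All sums over multi-indices below are over finite sets.\<close>

lemma finite_mindex_order_le: "finite {\<alpha> :: 'n::finite mindex. mindex_order \<alpha> \<le> j}"
proof (rule finite_subset)
  show "{\<alpha> :: 'n mindex. mindex_order \<alpha> \<le> j} \<subseteq> (UNIV \<rightarrow>\<^sub>E {..j})"
  proof
    fix \<alpha> :: "'n mindex"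
    assume "\<alpha> \<in> {\<alpha>. mindex_order \<alpha> \<le> j}"
    moreover have "\<alpha> i \<le> mindex_order \<alpha>" for i
      unfolding mindex_order_def by (rule member_le_sum) auto
    ultimately show "\<alpha> \<in> (UNIV \<rightarrow>\<^sub>E {..j})"
      by (auto simp: PiE_UNIV_domain intro: order_trans)
  qed
  show "finite ((UNIV :: 'n set) \<rightarrow>\<^sub>E {..j})"
    by (rule finite_PiE) auto
qed

lemma finite_A_loc: "finite (A_loc j s)" and finite_A_glob: "finite (A_glob j s)"
  unfolding A_loc_def A_glob_def by (rule finite_subset[OF _ finite_mindex_order_le[of j]]; auto)+

definition pderivative :: "'n::finite \<Rightarrow> (real^'n \<Rightarrow> real) \<Rightarrow> real^'n \<Rightarrow> real" where
  "pderivative i \<phi> x = frechet_derivative \<phi> (at x) (axis i 1)"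

fun pderivatives :: "'n::finite list \<Rightarrow> (real^'n \<Rightarrow> real) \<Rightarrow> real^'n \<Rightarrow> real" where
  "pderivatives [] \<phi> = \<phi>"
| "pderivatives (i # js) \<phi> = pderivative i (pderivatives js \<phi>)"

definition C1_function :: "(real^'n::finite \<Rightarrow> real) \<Rightarrow> bool" where
  "C1_function \<phi> \<longleftrightarrow> (\<forall>x. \<phi> differentiable (at x)) \<and> (\<forall>i. continuous_on UNIV (pderivative i \<phi>))"

definition test_functions :: "(real^'n::finite) set \<Rightarrow> (real^'n \<Rightarrow> real) set" where
  "test_functions \<Omega> = {\<phi>. (\<forall>js x. pderivatives js \<phi> differentiable (at x))
      \<and> compact (closure {x. \<phi> x \<noteq> 0}) \<and> closure {x. \<phi> x \<noteq> 0} \<subseteq> \<Omega>}"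

text \<open>Near each boundary point, after choosing a coordinate direction \<open>i\<close> and an orientation
  \<open>\<sigma>\<close>, the set lies strictly above the graph of a $C^1$ function \<open>\<gamma>\<close> of the remaining
  coordinates.\<close>

definition C1_boundary :: "(real^'n::finite) set \<Rightarrow> bool" where
  "C1_boundary \<Omega> \<longleftrightarrow> (\<forall>x0\<in>frontier \<Omega>. \<exists>\<rho>>0. \<exists>i. \<exists>\<sigma>\<in>{-1, 1}. \<exists>\<gamma>.
      C1_function \<gamma> \<and> (\<forall>x y. (\<forall>j. j \<noteq> i \<longrightarrow> x $ j = y $ j) \<longrightarrow> \<gamma> x = \<gamma> y)
      \<and> \<Omega> \<inter> ball x0 \<rho> = {x \<in> ball x0 \<rho>. \<sigma> * x $ i > \<gamma> x})"

definition C1_domain :: "(real^'n::finite) set \<Rightarrow> bool" where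
  "C1_domain \<Omega> \<longleftrightarrow> open \<Omega> \<and> connected \<Omega> \<and> \<Omega> \<noteq> {} \<and> bounded \<Omega> \<and> C1_boundary \<Omega>"

text \<open>Elements of \<open>L\<^sup>2(\<Omega>)\<close> and \<open>H\<^sup>s(\<Omega>)\<close> are represented by functions; functions that agree
  almost everywhere on \<open>\<Omega>\<close> represent the same element, so the norms below are seminorms on
  representatives.\<close>

definition L2 :: "(real^'n::finite) set \<Rightarrow> (real^'n \<Rightarrow> real) set" where
  "L2 \<Omega> = {u. u \<in> borel_measurable (lebesgue_on \<Omega>) \<and> integrable (lebesgue_on \<Omega>) (\<lambda>x. (u x)\<^sup>2)}"

definition L2_norm :: "(real^'n::finite) set \<Rightarrow> (real^'n \<Rightarrow> real) \<Rightarrow> real" where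
  "L2_norm \<Omega> u = sqrt (\<integral>x. (u x)\<^sup>2 \<partial>lebesgue_on \<Omega>)"

definition locally_integrable :: "(real^'n::finite) set \<Rightarrow> (real^'n \<Rightarrow> real) \<Rightarrow> bool" where
  "locally_integrable \<Omega> u \<longleftrightarrow> (\<forall>K. compact K \<and> K \<subseteq> \<Omega> \<longrightarrow> integrable (lebesgue_on K) u)"

text \<open>The lists \<open>js\<close> with \<open>count_list js = \<alpha>\<close> are the possible orders in which the partial
  derivatives making up \<open>\<partial>\<^sup>\<alpha>\<close> can be taken; on test functions they all give the same result.\<close>

definition weak_derivative ::
    "(real^'n::finite) set \<Rightarrow> 'n mindex \<Rightarrow> (real^'n \<Rightarrow> real) \<Rightarrow> (real^'n \<Rightarrow> real) \<Rightarrow> bool" where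
  "weak_derivative \<Omega> \<alpha> u g \<longleftrightarrow> locally_integrable \<Omega> u \<and> locally_integrable \<Omega> g
     \<and> (\<forall>\<phi>\<in>test_functions \<Omega>. \<forall>js. count_list js = \<alpha> \<longrightarrow>
          (\<integral>x. u x * pderivatives js \<phi> x \<partial>lebesgue_on \<Omega>)
            = (- 1) ^ mindex_order \<alpha> * (\<integral>x. g x * \<phi> x \<partial>lebesgue_on \<Omega>))"

definition wderiv :: "(real^'n::finite) set \<Rightarrow> 'n mindex \<Rightarrow> (real^'n \<Rightarrow> real) \<Rightarrow> real^'n \<Rightarrow> real" where
  "wderiv \<Omega> \<alpha> u = (SOME g. weak_derivative \<Omega> \<alpha> u g)"

definition Sobolev :: "(real^'n::finite) set \<Rightarrow> nat \<Rightarrow> (real^'n \<Rightarrow> real) set" where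
  "Sobolev \<Omega> s = {u \<in> L2 \<Omega>. \<forall>\<alpha>. mindex_order \<alpha> \<le> s \<longrightarrow> (\<exists>g\<in>L2 \<Omega>. weak_derivative \<Omega> \<alpha> u g)}"

definition Sobolev_norm :: "(real^'n::finite) set \<Rightarrow> nat \<Rightarrow> (real^'n \<Rightarrow> real) \<Rightarrow> real" where
  "Sobolev_norm \<Omega> s u = sqrt (\<Sum>\<alpha> | mindex_order \<alpha> \<le> s. (L2_norm \<Omega> (wderiv \<Omega> \<alpha> u))\<^sup>2)"

text \<open>Closedness is in the seminorm, so \<open>W\<close> contains all representatives of its elements.\<close>

definition closed_Sobolev_subspace ::
    "(real^'n::finite) set \<Rightarrow> nat \<Rightarrow> (real^'n \<Rightarrow> real) set \<Rightarrow> bool" where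
  "closed_Sobolev_subspace \<Omega> s W \<longleftrightarrow> W \<subseteq> Sobolev \<Omega> s
     \<and> (\<lambda>x. 0) \<in> W
     \<and> (\<forall>u\<in>W. \<forall>v\<in>W. (\<lambda>x. u x + v x) \<in> W)
     \<and> (\<forall>a. \<forall>u\<in>W. (\<lambda>x. a * u x) \<in> W)
     \<and> (\<forall>w u. (\<forall>n. w n \<in> W) \<and> u \<in> Sobolev \<Omega> s
          \<and> (\<lambda>n. Sobolev_norm \<Omega> s (\<lambda>x. w n x - u x)) \<longlonglongrightarrow> 0 \<longrightarrow> u \<in> W)"

text \<open>\<open>T\<close> maps the space \<open>X\<close> with seminorm \<open>N\<close> to the space \<open>Y\<close> with seminorm \<open>N'\<close> and induces a
  bounded linear operator between the associated normed spaces.\<close>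

definition bounded_linear_between ::
    "('a \<Rightarrow> real) set \<Rightarrow> (('a \<Rightarrow> real) \<Rightarrow> real) \<Rightarrow> ('a \<Rightarrow> real) set \<Rightarrow> (('a \<Rightarrow> real) \<Rightarrow> real)
      \<Rightarrow> (('a \<Rightarrow> real) \<Rightarrow> 'a \<Rightarrow> real) \<Rightarrow> bool" where
  "bounded_linear_between X N Y N' T \<longleftrightarrow>
     (\<forall>f\<in>X. T f \<in> Y)
     \<and> (\<forall>f\<in>X. \<forall>g\<in>X. N' (\<lambda>x. T (\<lambda>y. f y + g y) x - (T f x + T g x)) = 0)
     \<and> (\<forall>a. \<forall>f\<in>X. N' (\<lambda>x. T (\<lambda>y. a * f y) x - a * T f x) = 0)
     \<and> (\<exists>K. \<forall>f\<in>X. N' (T f) \<le> K * N f)"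

definition operator_norm ::
    "('a \<Rightarrow> real) set \<Rightarrow> (('a \<Rightarrow> real) \<Rightarrow> real) \<Rightarrow> (('a \<Rightarrow> real) \<Rightarrow> real)
      \<Rightarrow> (('a \<Rightarrow> real) \<Rightarrow> 'a \<Rightarrow> real) \<Rightarrow> real" where
  "operator_norm X N N' T = (SUP f\<in>X. N' (T f) / N f)"

definition inverse_operators ::
    "('a \<Rightarrow> real) set \<Rightarrow> (('a \<Rightarrow> real) \<Rightarrow> real) \<Rightarrow> ('a \<Rightarrow> real) set \<Rightarrow> (('a \<Rightarrow> real) \<Rightarrow> real)
      \<Rightarrow> (('a \<Rightarrow> real) \<Rightarrow> 'a \<Rightarrow> real) \<Rightarrow> (('a \<Rightarrow> real) \<Rightarrow> 'a \<Rightarrow> real) \<Rightarrow> bool" where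
  "inverse_operators X N Y N' T S \<longleftrightarrow>
     bounded_linear_between X N Y N' T \<and> bounded_linear_between Y N' X N S
     \<and> (\<forall>f\<in>X. N (\<lambda>x. S (T f) x - f x) = 0) \<and> (\<forall>g\<in>Y. N' (\<lambda>x. T (S g) x - g x) = 0)"

definition is_jet ::
    "(real^'n::finite) set \<Rightarrow> nat \<Rightarrow> (real^'n \<Rightarrow> real) \<Rightarrow> (real^'n \<Rightarrow> 'n jet) \<Rightarrow> bool" where
  "is_jet \<Omega> j u \<xi> \<longleftrightarrow> (\<forall>x. \<xi> x \<in> jet_space j)
     \<and> (\<forall>\<alpha>. mindex_order \<alpha> \<le> j \<longrightarrow> weak_derivative \<Omega> \<alpha> u (\<lambda>x. \<xi> x \<alpha>))"

definition jet :: "(real^'n::finite) set \<Rightarrow> nat \<Rightarrow> (real^'n \<Rightarrow> real) \<Rightarrow> real^'n \<Rightarrow> 'n jet" where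
  "jet \<Omega> j u x = (\<lambda>\<alpha>. if mindex_order \<alpha> \<le> j then wderiv \<Omega> \<alpha> u x else 0)"

definition nemytskii ::
    "(real^'n::finite) set \<Rightarrow> nat \<Rightarrow> nat \<Rightarrow> (real^'n \<Rightarrow> 'n jet \<Rightarrow> 'n jet \<Rightarrow> real)
      \<Rightarrow> (real^'n \<Rightarrow> real) \<Rightarrow> (real^'n \<Rightarrow> real) \<Rightarrow> real^'n \<Rightarrow> real" where
  "nemytskii \<Omega> k l c u f x = c x (jet \<Omega> k u x) (jet \<Omega> l f x)"

definition caratheodory ::
    "(real^'n::finite) set \<Rightarrow> nat \<Rightarrow> nat \<Rightarrow> (real^'n \<Rightarrow> 'n jet \<Rightarrow> 'n jet \<Rightarrow> real) \<Rightarrow> bool" where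
  "caratheodory \<Omega> k l c \<longleftrightarrow>
     (\<forall>\<xi>\<in>jet_space k. \<forall>\<zeta>\<in>jet_space l. (\<lambda>x. c x \<xi> \<zeta>) \<in> borel_measurable (lebesgue_on \<Omega>))
     \<and> (AE x in lebesgue_on \<Omega>. continuous_on (jet_space k \<times> jet_space l) (\<lambda>(\<xi>, \<zeta>). c x \<xi> \<zeta>))"

definition modulus_of_continuity :: "(real \<Rightarrow> real) \<Rightarrow> bool" where
  "modulus_of_continuity \<omega> \<longleftrightarrow> (\<forall>t\<ge>0. 0 \<le> \<omega> t) \<and> \<omega> 0 = 0"

text \<open>The data which exist for all \<open>R, R\<^sub>f > 0\<close> are given as functions of \<open>R\<close> and \<open>R\<^sub>f\<close>, because
  the continuity condition refers to the exponents of the growth condition.\<close>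

text \<open>For \<open>\<alpha> \<in> A_glob j s\<close> the denominator is nonnegative; when it is zero the quotient means
  \<open>\<infinity>\<close> and there is no upper bound.\<close>

definition admissible_exponent :: "nat \<Rightarrow> 'n::finite mindex \<Rightarrow> real \<Rightarrow> bool" where
  "admissible_exponent s \<alpha> q \<longleftrightarrow> 1 \<le> q \<and>
     (let d = real CARD('n); e = d - 2 * (real s - real (mindex_order \<alpha>)) in 0 < e \<longrightarrow> q \<le> d / e)"

definition growth_condition ::
    "(real^'n::finite) set \<Rightarrow> nat \<Rightarrow> nat \<Rightarrow> nat \<Rightarrow> (real^'n \<Rightarrow> 'n jet \<Rightarrow> 'n jet \<Rightarrow> real)
      \<Rightarrow> (real \<Rightarrow> real \<Rightarrow> real^'n \<Rightarrow> real) \<Rightarrow> (real \<Rightarrow> real \<Rightarrow> real)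
      \<Rightarrow> (real \<Rightarrow> real \<Rightarrow> 'n mindex \<Rightarrow> real) \<Rightarrow> (real \<Rightarrow> real \<Rightarrow> 'n mindex \<Rightarrow> real) \<Rightarrow> bool" where
  "growth_condition \<Omega> m k l c a b q p \<longleftrightarrow> (\<forall>R>0. \<forall>Rf>0.
     a R Rf \<in> L2 \<Omega> \<and> 0 \<le> b R Rf
     \<and> (\<forall>\<alpha>\<in>A_glob k (2 * m). admissible_exponent (2 * m) \<alpha> (q R Rf \<alpha>))
     \<and> (\<forall>\<alpha>\<in>A_glob l l. admissible_exponent l \<alpha> (p R Rf \<alpha>))
     \<and> (AE x in lebesgue_on \<Omega>. \<forall>\<xi>\<in>jet_space k. \<forall>\<zeta>\<in>jet_space l.
          L2_set \<xi> (A_loc k (2 * m)) \<le> R \<and> L2_set \<zeta> (A_loc l l) \<le> Rf \<longrightarrow>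
          \<bar>c x \<xi> \<zeta>\<bar> \<le> a R Rf x + b R Rf * ((\<Sum>\<alpha>\<in>A_glob k (2 * m). \<bar>\<xi> \<alpha>\<bar> powr q R Rf \<alpha>)
                                          + (\<Sum>\<alpha>\<in>A_glob l l. \<bar>\<zeta> \<alpha>\<bar> powr p R Rf \<alpha>))))"

text \<open>Real power with the convention \<open>0\<^sup>0 = 1\<close>, in contrast to \<open>0 powr 0 = 0\<close>; it matters for
  \<open>\<bar>\<xi>\<^sub>\<alpha>\<bar>\<close> raised to \<open>q\<^sub>\<alpha> - \<gamma>\<^sub>\<alpha>\<close>, where the exponent may be zero.\<close>

definition rpow :: "real \<Rightarrow> real \<Rightarrow> real" where
  "rpow x e = (if e = 0 then 1 else x powr e)"

definition continuity_condition ::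
    "(real^'n::finite) set \<Rightarrow> nat \<Rightarrow> nat \<Rightarrow> nat \<Rightarrow> (real^'n \<Rightarrow> 'n jet \<Rightarrow> 'n jet \<Rightarrow> real)
      \<Rightarrow> (real \<Rightarrow> real \<Rightarrow> 'n mindex \<Rightarrow> real) \<Rightarrow> (real \<Rightarrow> real \<Rightarrow> 'n mindex \<Rightarrow> real)
      \<Rightarrow> (real \<Rightarrow> real \<Rightarrow> real \<Rightarrow> real) \<Rightarrow> (real \<Rightarrow> real \<Rightarrow> real)
      \<Rightarrow> (real \<Rightarrow> real \<Rightarrow> 'n mindex \<Rightarrow> real) \<Rightarrow> (real \<Rightarrow> real \<Rightarrow> 'n mindex \<Rightarrow> real) \<Rightarrow> bool" where
  "continuity_condition \<Omega> m k l c q p \<omega> L \<gamma> \<delta> \<longleftrightarrow> (\<forall>R>0. \<forall>Rf>0.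
     modulus_of_continuity (\<omega> R Rf) \<and> mono_on {0..} (\<omega> R Rf)
     \<and> concave_on {0..} (\<lambda>t. (\<omega> R Rf (sqrt t))\<^sup>2)
     \<and> (\<forall>\<alpha>\<in>A_glob k (2 * m). 0 < \<gamma> R Rf \<alpha> \<and> \<gamma> R Rf \<alpha> \<le> 1)
     \<and> (\<forall>\<alpha>\<in>A_glob l l. 0 < \<delta> R Rf \<alpha> \<and> \<delta> R Rf \<alpha> \<le> 1)
     \<and> (AE x in lebesgue_on \<Omega>. \<forall>\<xi>1\<in>jet_space k. \<forall>\<xi>2\<in>jet_space k. \<forall>\<zeta>1\<in>jet_space l. \<forall>\<zeta>2\<in>jet_space l.
          L2_set \<xi>1 (A_loc k (2 * m)) \<le> R \<and> L2_set \<xi>2 (A_loc k (2 * m)) \<le> R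
          \<and> L2_set \<zeta>1 (A_loc l l) \<le> Rf \<and> L2_set \<zeta>2 (A_loc l l) \<le> Rf \<longrightarrow>
          \<bar>c x \<xi>1 \<zeta>1 - c x \<xi>2 \<zeta>2\<bar> \<le>
            L R Rf * \<omega> R Rf (L2_set (\<lambda>\<alpha>. \<xi>1 \<alpha> - \<xi>2 \<alpha>) (A_loc k (2 * m))
                            + L2_set (\<lambda>\<alpha>. \<zeta>1 \<alpha> - \<zeta>2 \<alpha>) (A_loc l l))
            + L R Rf * (\<Sum>\<alpha>\<in>A_glob k (2 * m).
                (rpow \<bar>\<xi>1 \<alpha>\<bar> (q R Rf \<alpha> - \<gamma> R Rf \<alpha>) + rpow \<bar>\<xi>2 \<alpha>\<bar> (q R Rf \<alpha> - \<gamma> R Rf \<alpha>))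
                * \<bar>\<xi>1 \<alpha> - \<xi>2 \<alpha>\<bar> powr \<gamma> R Rf \<alpha>)
            + L R Rf * (\<Sum>\<alpha>\<in>A_glob l l.
                (rpow \<bar>\<zeta>1 \<alpha>\<bar> (p R Rf \<alpha> - \<delta> R Rf \<alpha>) + rpow \<bar>\<zeta>2 \<alpha>\<bar> (p R Rf \<alpha> - \<delta> R Rf \<alpha>))
                * \<bar>\<zeta>1 \<alpha> - \<zeta>2 \<alpha>\<bar> powr \<delta> R Rf \<alpha>)))"

definition linearization_condition ::
    "(real^'n::finite) set \<Rightarrow> nat \<Rightarrow> nat \<Rightarrow> nat \<Rightarrow> (real^'n \<Rightarrow> 'n jet \<Rightarrow> 'n jet \<Rightarrow> real)
      \<Rightarrow> (real^'n \<Rightarrow> real) set \<Rightarrow> (real^'n \<Rightarrow> real) set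
      \<Rightarrow> (real^'n \<Rightarrow> real) \<Rightarrow> (real^'n \<Rightarrow> real) \<Rightarrow> bool" where
  "linearization_condition \<Omega> m k l c U F u0 f0 \<longleftrightarrow> (\<exists>r>0. \<exists>s>0. \<exists>A Ainv. \<exists>\<theta>.
     inverse_operators F (Sobolev_norm \<Omega> l) (L2 \<Omega>) (L2_norm \<Omega>) A Ainv
     \<and> 0 < \<theta> \<and> \<theta> < 1
     \<and> (\<forall>u\<in>U. \<forall>f1\<in>F. \<forall>f2\<in>F.
          Sobolev_norm \<Omega> (2 * m) (\<lambda>x. u x - u0 x) < r
          \<and> Sobolev_norm \<Omega> l (\<lambda>x. f1 x - f0 x) < s
          \<and> Sobolev_norm \<Omega> l (\<lambda>x. f2 x - f0 x) < s \<longrightarrow>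
          L2_norm \<Omega> (\<lambda>x. nemytskii \<Omega> k l c u f1 x - nemytskii \<Omega> k l c u f2 x
                          - A (\<lambda>y. f1 y - f2 y) x)
            \<le> \<theta> / operator_norm (L2 \<Omega>) (L2_norm \<Omega>) (Sobolev_norm \<Omega> l) Ainv
                * Sobolev_norm \<Omega> l (\<lambda>x. f1 x - f2 x)))"

end

theory Submission
  imports Defs
begin

text \<open>Everything rests on the Sobolev embeddings of \<open>H\<^sup>s(\<Omega>)\<close>.  A bounded $C^1$ domain is covered by
  finitely many open sets on each of which one fixed truncated cone, translated to any point of the
  set inside the domain, stays in the domain.  Averaging a derivative \<open>v = \<partial>\<^sup>\<alpha>u\<close> over the cone at scale \<open>t\<close> and
  differentiating in \<open>t\<close> trades one power of \<open>t\<close> for one further derivative of \<open>u\<close>; iterating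
  down to order \<open>s\<close> and letting the scale tend to \<open>0\<close> bounds \<open>\<bar>v(x)\<bar>\<close> by
  \<open>\<integral> t\<^sup>n (average of P over x + tQ) dt\<close> with \<open>n + 1 = s - \<bar>\<alpha>\<bar>\<close> and \<open>P\<close> the sum of all
  derivatives up to order \<open>s\<close>.  By Cauchy--Schwarz this is bounded when \<open>s - \<bar>\<alpha>\<bar> > d/2\<close>.  In the
  remaining cases, including the critical exponent, a layer-cake argument gives the \<open>L\<^sup>p\<close> bound: at
  level \<open>\<lambda>\<close> the integral is cut at a scale \<open>\<tau>(\<lambda>)\<close> and the density at a height \<open>h(\<lambda>)\<close> so that only
  the near part of the large values of \<open>P\<close> can lift the total above \<open>\<lambda>\<close>.

  Given the embeddings, the growth condition bounds \<open>C(u; f)\<close> in \<open>L\<^sup>2\<close>.  For the modulus, put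
  \<open>t = \<parallel>u - v\<parallel>\<close>, factor \<open>t\<^sup>\<gamma>\<close> out of \<open>\<bar>\<partial>\<^sup>\<alpha>(u - v)\<bar>\<^sup>\<gamma>\<close> and absorb the rest by Young's inequality
  \<open>y\<^sup>q\<^sup>-\<^sup>\<gamma> z\<^sup>\<gamma> \<le> y\<^sup>q + z\<^sup>q\<close> with \<open>z = \<bar>\<partial>\<^sup>\<alpha>(u - v)\<bar> / t\<close>; the first argument of \<open>\<omega>\<close> is controlled by the \<open>L\<^sup>\<infinity>\<close>
  embedding.\<close>

subsection \<open>Test functions\<close>

text \<open>The main obstacle is that elements of \<open>Sobolev\<close> are known only through weak
  derivatives, so nothing may be differentiated pointwise. The scale derivative of a rescaled
  kernel, however, is a divergence in the integration variable, and the kernel itself is a test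
  function as long as its cone stays in the domain. Weak derivatives thus enter in the very form in
  which they are defined.

  At the endpoint exponent both cuts are powers of the level. The measure of a superlevel set is
  then controlled by the integral of P over {P > h}, and integrating this over all levels returns a
  multiple of the integral of P^2, with no loss in the exponent.

  The exponents fit together because a term |xi|^q of the growth bound has to be square integrable:
  d/(d - 2r) with r = s - |alpha| is exactly half of the Sobolev exponent 2d/(d - 2r).

  Finally, \<open>wderiv\<close> is an arbitrary choice, so linearity, measurability and
  independence of representatives hold only almost everywhere; they all come from testing against
  smooth functions of compact support.\<close>

definition flat :: "real poly \<Rightarrow> real \<Rightarrow> real" where
  "flat P x = (if 0 < x then poly P (1 / x) * exp (- 1 / x) else 0)"

lemma poly_times_exp_tendsto_0: "((\<lambda>y. poly P y * exp (- y)) \<longlongrightarrow> (0::real)) at_top"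
proof -
  have "((\<lambda>y. \<Sum>i\<le>degree P. coeff P i * (y ^ i / exp y)) \<longlongrightarrow> (\<Sum>i\<le>degree P. coeff P i * 0)) at_top"
    by (intro tendsto_intros tendsto_power_div_exp_0)
  moreover have "(\<lambda>y. \<Sum>i\<le>degree P. coeff P i * (y ^ i / exp y)) = (\<lambda>y. poly P y * exp (- y))"
    by (auto simp: poly_altdef sum_distrib_right exp_minus divide_inverse mult.assoc)
  ultimately show ?thesis by simp
qed

text \<open>The chain rule on P(1/x) exp(-1/x) brings out a factor 1/x^2, which is the monomial
  \<open>[:0, 0, 1:]\<close> in 1/x, times (P - P')(1/x) exp(-1/x). The family is therefore closed
  under differentiation, and the single rule \<open>smooth_flat\<close> for all P suffices
  below.\<close>

lemma flat_has_derivative: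
  "(flat P has_real_derivative flat ([:0, 0, 1:] * (P - pderiv P)) x) (at x)"
proof -
  let ?Q = "[:0, 0, 1:] * (P - pderiv P)"
  consider "x > 0" | "x < 0" | "x = 0" by linarith
  then show ?thesis
  proof cases
    case 1
    have "((\<lambda>x. poly P (1 / x) * exp (- 1 / x)) has_real_derivative flat ?Q x) (at x)"
      using 1 by (auto intro!: derivative_eq_intros simp: flat_def power2_eq_square field_simps)
    then show ?thesis
      by (rule has_field_derivative_transform_within[where d = x]) (use 1 in \<open>auto simp: flat_def dist_real_def\<close>)
  next
    case 2
    have "((\<lambda>x. 0) has_real_derivative flat ?Q x) (at x)"
      using 2 by (auto simp: flat_def)
    then show ?thesis
      by (rule has_field_derivative_transform_within[where d = "-x"]) (use 2 in \<open>auto simp: flat_def dist_real_def\<close>)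
  next
    case 3
    have "((\<lambda>h. flat P h / h) \<longlongrightarrow> 0) (at_right 0)"
    proof -
      \<comment> \<open>With y = 1/h the difference quotient \<open>flat P h / h\<close> becomes y
        P(y) exp(-y).\<close>
      have "((\<lambda>y. poly ([:0, 1:] * P) y * exp (- y)) \<longlongrightarrow> 0) at_top"
        by (rule poly_times_exp_tendsto_0)
      then have *: "((\<lambda>h. poly ([:0, 1:] * P) (inverse h) * exp (- inverse h)) \<longlongrightarrow> 0) (at_right (0::real))"
        by (rule filterlim_compose[OF _ filterlim_inverse_at_top_right])
      show ?thesis
        by (rule Lim_transform_eventually[OF *])
           (auto simp: eventually_at_filter flat_def field_simps intro!: always_eventually)
    qed
    moreover have "((\<lambda>h. flat P h / h) \<longlongrightarrow> 0) (at_left 0)"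
      by (rule Lim_transform_eventually[OF tendsto_const])
         (auto simp: eventually_at_filter flat_def intro!: always_eventually)
    ultimately have "((\<lambda>h. flat P h / h) \<longlongrightarrow> 0) (at 0)"
      by (simp add: filterlim_at_split)
    then show ?thesis
      using 3 unfolding DERIV_def by simp (simp add: flat_def)
  qed
qed

text \<open>A class of infinitely differentiable functions just large enough to contain smooth bumps, for
  which closure under partial derivatives is a rule induction.\<close>

inductive smooth :: "(real^'n::finite \<Rightarrow> real) \<Rightarrow> bool" where
  smooth_const: "smooth (\<lambda>x. a)"
| smooth_coord: "smooth (\<lambda>x. x $ i)"
| smooth_add: "smooth f \<Longrightarrow> smooth g \<Longrightarrow> smooth (\<lambda>x. f x + g x)"
| smooth_mult: "smooth f \<Longrightarrow> smooth g \<Longrightarrow> smooth (\<lambda>x. f x * g x)"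
| smooth_flat: "smooth f \<Longrightarrow> smooth (\<lambda>x. flat P (f x))"

text \<open>Differentiability and membership of the directional derivatives in the class go through
  the induction together; the second half is what lets \<open>pderivatives\<close> be iterated to
  any order.\<close>

lemma smooth_has_derivative:
  assumes "smooth (f :: real^'n::finite \<Rightarrow> real)"
  shows "\<exists>f'. (\<forall>x. (f has_derivative f' x) (at x)) \<and> (\<forall>h. smooth (\<lambda>x. f' x h))"
  using assms
proof induction
  case (smooth_const a)
  show ?case by (rule exI[of _ "\<lambda>x h. 0"]) (auto intro: smooth.intros)
next
  case (smooth_coord i)
  show ?case
    by (rule exI[of _ "\<lambda>x h. h $ i"])
       (auto intro: smooth.intros bounded_linear_imp_has_derivative bounded_linear_vec_nth)
next
  case (smooth_add f g)
  then obtain f' g' where f': "\<forall>x. (f has_derivative f' x) (at x)" "\<forall>h. smooth (\<lambda>x. f' x h)"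
    and g': "\<forall>x. (g has_derivative g' x) (at x)" "\<forall>h. smooth (\<lambda>x. g' x h)" by blast
  show ?case
    by (rule exI[of _ "\<lambda>x h. f' x h + g' x h"])
       (use f' g' in \<open>auto intro: smooth.intros intro!: derivative_intros\<close>)
next
  case (smooth_mult f g)
  then obtain f' g' where f': "\<forall>x. (f has_derivative f' x) (at x)" "\<forall>h. smooth (\<lambda>x. f' x h)"
    and g': "\<forall>x. (g has_derivative g' x) (at x)" "\<forall>h. smooth (\<lambda>x. g' x h)" by blast
  show ?case
    by (rule exI[of _ "\<lambda>x h. f x * g' x h + f' x h * g x"])
       (use f' g' smooth_mult.hyps in \<open>auto intro!: has_derivative_mult smooth.smooth_add intro: smooth.smooth_mult\<close>)
next
  case (smooth_flat f P)
  then obtain f' where f': "\<forall>x. (f has_derivative f' x) (at x)" "\<forall>h. smooth (\<lambda>x. f' x h)" by blast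
  let ?Q = "[:0, 0, 1:] * (P - pderiv P)"
  have "((\<lambda>x. flat P (f x)) has_derivative (\<lambda>h. flat ?Q (f x) * f' x h)) (at x)" for x
    using has_derivative_compose[OF f'(1)[rule_format, of x]
        flat_has_derivative[of P "f x", unfolded has_field_derivative_def]] by simp
  then show ?case
    by (intro exI[of _ "\<lambda>x h. flat ?Q (f x) * f' x h"])
       (use f' smooth_flat.hyps in \<open>auto intro: smooth.intros\<close>)
qed

lemma pderivative_eq: "(f has_derivative f') (at x) \<Longrightarrow> pderivative i f x = f' (axis i 1)"
  unfolding pderivative_def by (simp flip: frechet_derivative_at)

lemma smooth_differentiable: "smooth f \<Longrightarrow> f differentiable (at x)"
  using smooth_has_derivative[of f] by (auto simp: differentiable_def)

lemma smooth_pderivative: assumes "smooth f" shows "smooth (pderivative i f)"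
proof -
  obtain f' where f': "\<forall>x. (f has_derivative f' x) (at x)" "\<forall>h. smooth (\<lambda>x. f' x h)"
    using smooth_has_derivative[OF assms] by blast
  have "pderivative i f = (\<lambda>x. f' x (axis i 1))"
    using f'(1) by (auto intro!: pderivative_eq)
  with f'(2) show ?thesis by simp
qed

lemma smooth_pderivatives: "smooth f \<Longrightarrow> smooth (pderivatives js f)"
  by (induction js) (auto intro: smooth_pderivative)

lemma smooth_continuous: "smooth f \<Longrightarrow> continuous_on A f"
  by (auto intro!: continuous_at_imp_continuous_on differentiable_imp_continuous_within smooth_differentiable)

lemma smooth_borel [measurable]: "smooth f \<Longrightarrow> f \<in> borel_measurable borel"
  by (intro borel_measurable_continuous_onI smooth_continuous)

lemma smooth_prod: "finite I \<Longrightarrow> (\<And>i. i \<in> I \<Longrightarrow> smooth (f i)) \<Longrightarrow> smooth (\<lambda>x. \<Prod>i\<in>I. f i x)"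
  by (induction I rule: finite_induct) (auto intro: smooth.intros)

lemma smooth_affine:
  assumes "smooth (f :: real^'n::finite \<Rightarrow> real)"
  shows "smooth (\<lambda>x. f (c *\<^sub>R (x - a)))"
  using assms
proof induction
  case (smooth_coord i)
  have "smooth (\<lambda>x. c * (x $ i + - (a $ i)))"
    by (intro smooth.intros)
  then show ?case by simp
qed (auto intro: smooth.intros)

text \<open>The test functions with which weak derivatives are actually tested. Vanishing outside a
  compact K is used in place of the closure of the support, because the same K then serves all
  derivatives.\<close>

definition smooth_compact :: "(real^'n::finite) set \<Rightarrow> (real^'n \<Rightarrow> real) set" where
  "smooth_compact \<Omega> = {\<phi>. smooth \<phi> \<and> (\<exists>K. compact K \<and> K \<subseteq> \<Omega> \<and> (\<forall>x. x \<notin> K \<longrightarrow> \<phi> x = 0))}"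

lemma smooth_compact_subset_test_functions: "smooth_compact \<Omega> \<subseteq> test_functions \<Omega>"
proof
  fix \<phi> assume "\<phi> \<in> smooth_compact \<Omega>"
  then obtain K where K: "smooth \<phi>" "compact K" "K \<subseteq> \<Omega>" "\<And>x. x \<notin> K \<Longrightarrow> \<phi> x = 0"
    by (auto simp: smooth_compact_def)
  have "closure {x. \<phi> x \<noteq> 0} \<subseteq> K"
    by (rule closure_minimal) (use K compact_imp_closed in auto)
  then show "\<phi> \<in> test_functions \<Omega>"
    using K smooth_differentiable[OF smooth_pderivatives[OF K(1)]]
      compact_Int_closed[OF K(2) closed_closure, of "{x. \<phi> x \<noteq> 0}"]
    unfolding test_functions_def by (auto simp: Int_absorb1)
qed

lemma smooth_compact_pderivative:
  assumes "\<phi> \<in> smooth_compact \<Omega>" shows "pderivative i \<phi> \<in> smooth_compact \<Omega>"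
proof -
  obtain K where K: "smooth \<phi>" "compact K" "K \<subseteq> \<Omega>" "\<And>x. x \<notin> K \<Longrightarrow> \<phi> x = 0"
    using assms by (auto simp: smooth_compact_def)
  have "pderivative i \<phi> x = 0" if "x \<notin> K" for x
  proof -
    have "(\<phi> has_derivative (\<lambda>h. 0)) (at x)"
    proof (rule has_derivative_transform_within_open[where f = "\<lambda>x. 0" and s = "- K"])
      show "open (- K)" using K(2) compact_imp_closed by auto
    qed (use K that in auto)
    from pderivative_eq[OF this] show ?thesis by simp
  qed
  with K smooth_pderivative[OF K(1)] show ?thesis unfolding smooth_compact_def by blast
qed

lemma smooth_compact_pderivatives:
  "\<phi> \<in> smooth_compact \<Omega> \<Longrightarrow> pderivatives js \<phi> \<in> smooth_compact \<Omega>"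
  by (induction js) (auto intro: smooth_compact_pderivative)

lemma smooth_compact_bounded:
  assumes "\<phi> \<in> smooth_compact \<Omega>" obtains B where "B > 0" "\<And>x. \<bar>\<phi> x\<bar> \<le> B"
proof -
  obtain K where K: "smooth \<phi>" "compact K" "\<And>x. x \<notin> K \<Longrightarrow> \<phi> x = 0"
    using assms by (auto simp: smooth_compact_def)
  have "bounded (\<phi> ` K)"
    using compact_continuous_image[OF smooth_continuous[OF K(1)] K(2)] compact_imp_bounded by blast
  then obtain B where B: "B > 0" "\<And>x. x \<in> K \<Longrightarrow> \<bar>\<phi> x\<bar> \<le> B"
    by (auto simp: bounded_pos)
  then have "\<bar>\<phi> x\<bar> \<le> B" for x
    by (cases "x \<in> K") (use K B(1) in auto)
  with B(1) that show ?thesis by blast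
qed

text \<open>The factor n steepens the flanks: for c > 0 the value \<open>flat 1 (n * c)\<close> is
  exp(-1/(n c)) and tends to 1, so the bumps approach the indicator of the open box from
  inside.\<close>

definition box_bump :: "real^'n::finite \<Rightarrow> real^'n \<Rightarrow> nat \<Rightarrow> real^'n \<Rightarrow> real" where
  "box_bump a b n x = (\<Prod>i\<in>UNIV. flat 1 (real n * (x $ i - a $ i)) * flat 1 (real n * (b $ i - x $ i)))"

lemma flat_1_bounds: "0 \<le> flat 1 x" "flat 1 x \<le> 1"
  by (auto simp: flat_def)

lemma box_bump_bounds: "0 \<le> box_bump a b n x" "box_bump a b n x \<le> 1"
  unfolding box_bump_def
  by (auto intro!: prod_nonneg prod_le_1 mult_nonneg_nonneg mult_le_one simp: flat_1_bounds)

lemma box_bump_eq_0: "x \<notin> box a b \<Longrightarrow> box_bump a b n x = 0"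
  by (auto simp: box_bump_def mem_box_cart flat_def zero_less_mult_iff)

lemma box_bump_pos: "x \<in> box a b \<Longrightarrow> 0 < n \<Longrightarrow> 0 < box_bump a b n x"
  unfolding box_bump_def mem_box_cart
  by (intro prod_pos) (auto simp: flat_def zero_less_mult_iff)

lemma smooth_box_bump: "smooth (box_bump a b n)"
proof -
  have "smooth (\<lambda>x. \<Prod>i\<in>UNIV. flat 1 (real n * (x $ i + - a $ i)) * flat 1 (real n * (b $ i + (- 1) * x $ i)))"
    by (intro smooth_prod smooth.intros) auto
  then show ?thesis by (simp add: box_bump_def[abs_def])
qed

lemma box_bump_smooth_compact: "cbox a b \<subseteq> \<Omega> \<Longrightarrow> box_bump a b n \<in> smooth_compact \<Omega>"
  unfolding smooth_compact_def mem_Collect_eq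
  by (intro conjI smooth_box_bump exI[of _ "cbox a b"] compact_cbox allI impI box_bump_eq_0)
     (auto simp: box_subset_cbox[THEN subsetD])

lemma box_bump_tendsto: "(\<lambda>n. box_bump a b n x) \<longlonglongrightarrow> indicator (box a b) x"
proof (cases "x \<in> box a b")
  case True
  have *: "(\<lambda>n. flat 1 (real n * c)) \<longlonglongrightarrow> 1" if "c > 0" for c
  proof -
    have "(\<lambda>n. exp (- (1 / c) * (1 / real n))) \<longlonglongrightarrow> exp (- (1 / c) * 0)"
      by (intro tendsto_intros lim_1_over_n)
    moreover have "\<forall>\<^sub>F n in sequentially. exp (- (1 / c) * (1 / real n)) = flat 1 (real n * c)"
      using eventually_gt_at_top[of 0] by eventually_elim (use that in \<open>auto simp: flat_def field_simps\<close>)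
    ultimately show ?thesis by (auto intro: Lim_transform_eventually)
  qed
  have "(\<lambda>n. box_bump a b n x) \<longlonglongrightarrow> (\<Prod>i\<in>(UNIV :: 'a set). 1 * 1)"
    unfolding box_bump_def using True by (intro tendsto_intros *) (auto simp: mem_box_cart)
  with True show ?thesis by simp
qed (simp add: box_bump_eq_0)

section \<open>The fundamental lemma of the calculus of variations\<close>

text \<open>Off a negligible set the averages of f over the cubes with corner x and side h tend to f
  x. If f x were negative, a small cube inside N would have a negative integral.\<close>

lemma AE_nonneg_if_cbox_integrals_nonneg:
  fixes f :: "real^'n::finite \<Rightarrow> real"
  assumes f: "integrable lebesgue f" and N: "open N"
    and nonneg: "\<And>a b. cbox a b \<subseteq> N \<Longrightarrow> 0 \<le> (\<integral>x. indicator (cbox a b) x * f x \<partial>lebesgue)"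
  shows "AE x in lebesgue. x \<in> N \<longrightarrow> 0 \<le> f x"
proof -
  have si: "set_integrable lebesgue (cbox a b) f" for a b
    unfolding set_integrable_def using f by (intro integrable_mult_indicator) auto
  then have "f integrable_on cbox a b" for a b
    by (rule set_lebesgue_integral_eq_integral(1))
  then obtain Z where Z: "negligible Z" "\<And>x e. \<lbrakk>x \<notin> Z; 0 < e\<rbrakk> \<Longrightarrow>
     \<exists>d>0. \<forall>h. 0 < h \<and> h < d \<longrightarrow>
       norm (integral (cbox x (x + h *\<^sub>R One)) f /\<^sub>R h ^ DIM(real^'n) - f x) < e"
    using integrable_ccontinuous_explicit[of f] by blast
  have "0 \<le> f x" if xN: "x \<in> N" and xZ: "x \<notin> Z" for x
  proof (rule ccontr)
    assume "\<not> 0 \<le> f x"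
    then obtain d where d: "d > 0" "\<And>h. 0 < h \<Longrightarrow> h < d \<Longrightarrow>
       norm (integral (cbox x (x + h *\<^sub>R One)) f /\<^sub>R h ^ DIM(real^'n) - f x) < - f x"
      using Z(2)[OF xZ, of "- f x"] by (metis neg_0_less_iff_less not_le)
    obtain e where e: "e > 0" "ball x e \<subseteq> N" using openE[OF N xN] by blast
    \<comment> \<open>Below d for the differentiation estimate, and small enough that the diagonal
      of the cube is shorter than e.\<close>
    define h where "h = min (d / 2) (e / (2 * norm (One :: real^'n)))"
    have One: "norm (One :: real^'n) > 0"
      by simp
    have h: "0 < h" "h < d" "h * norm (One :: real^'n) < e"
      using d(1) e(1) One by (auto simp: h_def min_def field_simps)
    have "cbox x (x + h *\<^sub>R One) \<subseteq> N"
    proof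
      fix y assume y: "y \<in> cbox x (x + h *\<^sub>R One)"
      have "norm (y - x) \<le> norm (h *\<^sub>R One :: real^'n)"
        by (rule norm_le_componentwise) (use y h(1) in \<open>auto simp: mem_box inner_simps abs_if\<close>)
      then have "y \<in> ball x e"
        using h by (auto simp: dist_norm norm_minus_commute)
      with e show "y \<in> N" by blast
    qed
    from nonneg[OF this] have "0 \<le> integral (cbox x (x + h *\<^sub>R One)) f"
      using set_lebesgue_integral_eq_integral(2)[OF si[of x "x + h *\<^sub>R One"]]
      by (simp add: set_lebesgue_integral_def)
    then have "0 \<le> integral (cbox x (x + h *\<^sub>R One)) f /\<^sub>R h ^ DIM(real^'n)"
      using h(1) by auto
    with d(2)[OF h(1,2)] show False by auto
  qed
  moreover have "AE x in lebesgue. x \<notin> Z"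
    using Z(1) by (simp add: negligible_iff_null_sets AE_not_in)
  ultimately show ?thesis by (auto elim: eventually_mono)
qed

text \<open>Box bumps turn vanishing test integrals into vanishing integrals over boxes. The sign
  criterion, applied to g and to -g, then gives g = 0 on each box, and countably many boxes fill the
  open set.\<close>

lemma AE_zero_if_test_integrals_zero:
  fixes g :: "real^'n::finite \<Rightarrow> real"
  assumes \<Omega>: "open \<Omega>" and g: "locally_integrable \<Omega> g"
    and zero: "\<And>\<phi>. \<phi> \<in> smooth_compact \<Omega> \<Longrightarrow> (\<integral>x. g x * \<phi> x \<partial>lebesgue_on \<Omega>) = 0"
  shows "AE x in lebesgue_on \<Omega>. g x = 0"
proof -
  have int: "integrable lebesgue (\<lambda>x. indicator (cbox a b) x * g x)" if "cbox a b \<subseteq> \<Omega>" for a b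
  proof -
    have "integrable (lebesgue_on (cbox a b)) g"
      using g that compact_cbox unfolding locally_integrable_def by blast
    then show ?thesis by (subst (asm) integrable_restrict_space) auto
  qed
  have box0: "(\<integral>x. indicator (cbox a b) x * g x \<partial>lebesgue) = 0" if ab: "cbox a b \<subseteq> \<Omega>" for a b
  proof -
    have "(\<lambda>n. \<integral>x. indicator (cbox a b) x * g x * box_bump a b n x \<partial>lebesgue)
       \<longlonglongrightarrow> (\<integral>x. indicator (cbox a b) x * g x * indicator (box a b) x \<partial>lebesgue)"
    proof (rule integral_dominated_convergence[where w = "\<lambda>x. \<bar>indicator (cbox a b) x * g x\<bar>"])
      show "(\<lambda>x. indicator (cbox a b) x * g x * box_bump a b n x) \<in> borel_measurable lebesgue" for n
        by (rule borel_measurable_times[OF borel_measurable_integrable[OF int[OF ab]]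
            measurable_completion]) (simp add: smooth_borel[OF smooth_box_bump])
      show "(\<lambda>x. indicator (cbox a b) x * g x * indicator (box a b) x) \<in> borel_measurable lebesgue"
        by (rule borel_measurable_times[OF borel_measurable_integrable[OF int[OF ab]]])
           (simp add: borel_measurable_indicator)
      show "integrable lebesgue (\<lambda>x. \<bar>indicator (cbox a b) x * g x\<bar>)" using int[OF ab] by auto
      show "AE x in lebesgue. (\<lambda>n. indicator (cbox a b) x * g x * box_bump a b n x)
          \<longlonglongrightarrow> indicator (cbox a b) x * g x * indicator (box a b) x"
        by (rule AE_I2, rule tendsto_mult[OF tendsto_const box_bump_tendsto])
      show "AE x in lebesgue. norm (indicator (cbox a b) x * g x * box_bump a b n x)
          \<le> \<bar>indicator (cbox a b) x * g x\<bar>" for n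
      proof (rule AE_I2)
        fix x
        have "\<bar>indicator (cbox a b) x * g x\<bar> * box_bump a b n x \<le> \<bar>indicator (cbox a b) x * g x\<bar>"
          by (rule mult_left_le) (simp_all add: box_bump_bounds)
        then show "norm (indicator (cbox a b) x * g x * box_bump a b n x) \<le> \<bar>indicator (cbox a b) x * g x\<bar>"
          by (simp add: abs_mult box_bump_bounds)
      qed
    qed
    moreover have "(\<integral>x. indicator (cbox a b) x * g x * box_bump a b n x \<partial>lebesgue) = 0" for n
    proof -
      have "(\<integral>x. indicator (cbox a b) x * g x * box_bump a b n x \<partial>lebesgue)
        = (\<integral>x. indicator \<Omega> x *\<^sub>R (g x * box_bump a b n x) \<partial>lebesgue)"
      proof (rule Bochner_Integration.integral_cong[OF refl])
        fix x
        show "indicator (cbox a b) x * g x * box_bump a b n x = indicator \<Omega> x *\<^sub>R (g x * box_bump a b n x)"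
          using ab box_subset_cbox[of a b] box_bump_eq_0[of x a b n]
          by (cases "x \<in> box a b") (auto simp: indicator_def)
      qed
      also have "\<dots> = (\<integral>x. g x * box_bump a b n x \<partial>lebesgue_on \<Omega>)"
        using \<Omega> by (simp add: integral_restrict_space)
      finally show ?thesis using zero[OF box_bump_smooth_compact[OF ab]] by simp
    qed
    ultimately have "(\<integral>x. indicator (cbox a b) x * g x * indicator (box a b) x \<partial>lebesgue) = 0"
      by (simp add: LIMSEQ_const_iff)
    moreover have "(\<integral>x. indicator (cbox a b) x * g x * indicator (box a b) x \<partial>lebesgue)
      = (\<integral>x. indicator (cbox a b) x * g x \<partial>lebesgue)"
    proof (rule integral_cong_AE)
      have "AE x in lebesgue. x \<notin> cbox a b - box a b"
        by (rule AE_not_in) (simp only: negligible_frontier_interval flip: negligible_iff_null_sets)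
      then show "AE x in lebesgue. indicator (cbox a b) x * g x * indicator (box a b) x = indicator (cbox a b) x * g x"
        by eventually_elim (auto simp: indicator_def)
      show "(\<lambda>x. indicator (cbox a b) x * g x * indicator (box a b) x) \<in> borel_measurable lebesgue"
        by (rule borel_measurable_times[OF borel_measurable_integrable[OF int[OF ab]]])
           (simp add: borel_measurable_indicator)
      show "(\<lambda>x. indicator (cbox a b) x * g x) \<in> borel_measurable lebesgue"
        by (rule borel_measurable_integrable[OF int[OF ab]])
    qed
    ultimately show ?thesis by simp
  qed
  \<comment> \<open>Since g is only locally integrable, it is cut off to the closed box before the
    sign criterion, which asks for integrability on the whole space.\<close>
  have loc: "AE x in lebesgue. x \<in> box a b \<longrightarrow> g x = 0" if ab: "cbox a b \<subseteq> \<Omega>" for a b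
  proof -
    have *: "indicator (cbox a' b') x * (indicator (cbox a b) x * g x) = indicator (cbox a' b') x * g x"
      if "cbox a' b' \<subseteq> box a b" for a' b' x
    proof (cases "x \<in> cbox a' b'")
      case True
      then have "x \<in> cbox a b" using that box_subset_cbox by blast
      then show ?thesis by simp
    qed simp
    have "(\<integral>x. indicator (cbox a' b') x * (indicator (cbox a b) x * g x) \<partial>lebesgue) = 0"
      if "cbox a' b' \<subseteq> box a b" for a' b'
      unfolding *[OF that] by (rule box0) (use that ab box_subset_cbox[of a b] in blast)
    note zero = this
    have "AE x in lebesgue. x \<in> box a b \<longrightarrow> 0 \<le> indicator (cbox a b) x * g x"
      by (rule AE_nonneg_if_cbox_integrals_nonneg[OF int[OF ab] open_box]) (simp only: zero)
    moreover have "AE x in lebesgue. x \<in> box a b \<longrightarrow> 0 \<le> - (indicator (cbox a b) x * g x)"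
      by (rule AE_nonneg_if_cbox_integrals_nonneg[OF integrable_minus[OF int[OF ab]] open_box])
         (simp only: mult_minus_right integral_minus zero)
    ultimately    show ?thesis
    proof eventually_elim
      case (elim x)
      then show ?case
        using box_subset_cbox[of a b] by (cases "x \<in> box a b") (auto simp: indicator_def)
    qed
  qed
  obtain D where D: "countable D" "D \<subseteq> Pow \<Omega>" "\<And>X. X \<in> D \<Longrightarrow> \<exists>a b. X = cbox a b" "\<Union>D = \<Omega>"
    by (rule open_countable_Union_open_cbox[OF \<Omega>], rule that)
  have "AE x in lebesgue. \<forall>X\<in>D. x \<in> X \<longrightarrow> g x = 0"
    unfolding AE_ball_countable[OF D(1)]
  proof
    fix X assume "X \<in> D"
    then obtain a b where X: "X = cbox a b" "cbox a b \<subseteq> \<Omega>" using D by blast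
    have "AE x in lebesgue. x \<notin> cbox a b - box a b"
      by (rule AE_not_in) (simp only: negligible_frontier_interval flip: negligible_iff_null_sets)
    with loc[OF X(2)] show "AE x in lebesgue. x \<in> X \<longrightarrow> g x = 0"
      unfolding X(1) by eventually_elim auto
  qed
  then have "AE x in lebesgue. x \<in> \<Omega> \<longrightarrow> g x = 0"
    by (rule eventually_mono) (use D(4) in blast)
  then show ?thesis
    using \<Omega> by (simp add: AE_restrict_space_iff)
qed

subsection \<open>Averages at a scale\<close>

lemma nn_integral_lborel_affine:
  fixes g :: "real^'n::finite \<Rightarrow> ennreal"
  assumes [measurable]: "g \<in> borel_measurable borel" and c: "c \<noteq> 0"
  shows "(\<integral>\<^sup>+x. g x \<partial>lborel) = ennreal (\<bar>c\<bar> ^ CARD('n)) * (\<integral>\<^sup>+z. g (a + c *\<^sub>R z) \<partial>lborel)"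
  by (subst lborel_affine[OF c, of a]) (simp add: nn_integral_density nn_integral_distr nn_integral_cmult)

lemma integral_lborel_affine:
  fixes g :: "real^'n::finite \<Rightarrow> real"
  assumes [measurable]: "g \<in> borel_measurable borel" and c: "c \<noteq> 0"
  shows "(\<integral>x. g x \<partial>lborel) = \<bar>c\<bar> ^ CARD('n) * (\<integral>z. g (a + c *\<^sub>R z) \<partial>lborel)"
  by (subst lborel_affine[OF c, of a]) (simp add: integral_density integral_distr)

text \<open>A kernel of the same mass as \<psi> that lives on x + t Q when \<psi> lives on Q. The
  support is attached to x without reflection, so that it is the cone with vertex x that has to stay
  in the domain.\<close>

definition rescale :: "(real^'n::finite \<Rightarrow> real) \<Rightarrow> real^'n \<Rightarrow> real \<Rightarrow> real^'n \<Rightarrow> real" where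
  "rescale \<psi> x t y = \<psi> ((1 / t) *\<^sub>R (y - x)) / t ^ CARD('n)"

text \<open>For nonnegative f and t > 0 this is t^(-d) times the integral of f over x + t Q, that
  is, the average up to the factor |Q|. Values in \<open>ennreal\<close> allow Fubini before any
  integrability is known.\<close>

definition cavg :: "(real^'n::finite) set \<Rightarrow> (real^'n \<Rightarrow> real) \<Rightarrow> real^'n \<Rightarrow> real \<Rightarrow> ennreal" where
  "cavg Q f x t = (\<integral>\<^sup>+y. ennreal (f y * rescale (indicator Q) x t y) \<partial>lborel)"

text \<open>Formulated for functions on the whole space and with \<open>lborel\<close>: it is
  applied to Borel representatives that vanish off the domain, which makes product measures
  available.\<close>

definition weak_partial ::
    "(real^'n::finite) set \<Rightarrow> 'n \<Rightarrow> (real^'n \<Rightarrow> real) \<Rightarrow> (real^'n \<Rightarrow> real) \<Rightarrow> bool" where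
  "weak_partial \<Omega> i v w \<longleftrightarrow> (\<forall>\<phi>\<in>smooth_compact \<Omega>.
     (\<integral>y. v y * pderivative i \<phi> y \<partial>lborel) = - (\<integral>y. w y * \<phi> y \<partial>lborel))"

lemma rescale_measurable [measurable]:
  assumes [measurable]: "\<psi> \<in> borel_measurable borel" "f \<in> borel_measurable M" "g \<in> borel_measurable M"
    "h \<in> borel_measurable M"
  shows "(\<lambda>w. rescale \<psi> (f w) (g w) (h w)) \<in> borel_measurable M"
  unfolding rescale_def by measurable

lemma rescale_nonneg: "(\<And>z. 0 \<le> \<psi> z) \<Longrightarrow> 0 \<le> t \<Longrightarrow> 0 \<le> rescale \<psi> x t y"
  by (simp add: rescale_def)

text \<open>The substitution x = y - t z. It serves to move an average from a function onto the
  indicator of a box.\<close>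

lemma integral_rescale_snd:
  fixes \<psi> :: "real^'n::finite \<Rightarrow> real"
  assumes [measurable]: "\<psi> \<in> borel_measurable borel" "g \<in> borel_measurable borel" and t: "t > 0"
  shows "(\<integral>x. g x * rescale \<psi> x t y \<partial>lborel) = (\<integral>z. g (y - t *\<^sub>R z) * \<psi> z \<partial>lborel)"
proof -
  have "(\<integral>x. g x * rescale \<psi> x t y \<partial>lborel)
      = t ^ CARD('n) * (\<integral>z. g (y - t *\<^sub>R z) * rescale \<psi> (y + (- t) *\<^sub>R z) t y \<partial>lborel)"
    by (subst integral_lborel_affine[where c = "- t" and a = y]) (use t in auto)
  also have "\<dots> = (\<integral>z. t ^ CARD('n) * (g (y - t *\<^sub>R z) * rescale \<psi> (y + (- t) *\<^sub>R z) t y) \<partial>lborel)"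
    by simp
  also have "\<dots> = (\<integral>z. g (y - t *\<^sub>R z) * \<psi> z \<partial>lborel)"
    using t by (intro Bochner_Integration.integral_cong) (auto simp: rescale_def)
  finally show ?thesis .
qed

lemma nn_integral_rescale_snd:
  fixes \<psi> :: "real^'n::finite \<Rightarrow> real"
  assumes [measurable]: "\<psi> \<in> borel_measurable borel" and t: "t > 0"
  shows "(\<integral>\<^sup>+x. ennreal (rescale \<psi> x t y) \<partial>lborel) = (\<integral>\<^sup>+z. ennreal (\<psi> z) \<partial>lborel)"
proof -
  have "(\<integral>\<^sup>+x. ennreal (rescale \<psi> x t y) \<partial>lborel)
      = ennreal (t ^ CARD('n)) * (\<integral>\<^sup>+z. ennreal (rescale \<psi> (y + (- t) *\<^sub>R z) t y) \<partial>lborel)"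
    by (subst nn_integral_lborel_affine[where c = "- t" and a = y]) (use t in auto)
  also have "\<dots> = (\<integral>\<^sup>+z. ennreal (t ^ CARD('n)) * ennreal (rescale \<psi> (y + (- t) *\<^sub>R z) t y) \<partial>lborel)"
    by (simp add: nn_integral_cmult)
  also have "\<dots> = (\<integral>\<^sup>+z. ennreal (\<psi> z) \<partial>lborel)"
    using t by (intro nn_integral_cong) (simp add: rescale_def flip: ennreal_mult')
  finally show ?thesis .
qed

lemma nn_integral_rescale_fst:
  fixes \<psi> :: "real^'n::finite \<Rightarrow> real"
  assumes [measurable]: "\<psi> \<in> borel_measurable borel" and t: "t > 0"
  shows "(\<integral>\<^sup>+y. ennreal (rescale \<psi> x t y) \<partial>lborel) = (\<integral>\<^sup>+z. ennreal (\<psi> z) \<partial>lborel)"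
proof -
  have "(\<integral>\<^sup>+y. ennreal (rescale \<psi> x t y) \<partial>lborel)
      = ennreal (t ^ CARD('n)) * (\<integral>\<^sup>+z. ennreal (rescale \<psi> x t (x + t *\<^sub>R z)) \<partial>lborel)"
    by (subst nn_integral_lborel_affine[where c = t and a = x]) (use t in auto)
  also have "\<dots> = (\<integral>\<^sup>+z. ennreal (t ^ CARD('n)) * ennreal (rescale \<psi> x t (x + t *\<^sub>R z)) \<partial>lborel)"
    by (simp add: nn_integral_cmult)
  also have "\<dots> = (\<integral>\<^sup>+z. ennreal (\<psi> z) \<partial>lborel)"
    using t by (intro nn_integral_cong) (simp add: rescale_def flip: ennreal_mult')
  finally show ?thesis .
qed

lemma cavg_measurable [measurable]:
  assumes [measurable]: "Q \<in> sets borel" "f \<in> borel_measurable borel"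
    "g \<in> borel_measurable M" "h \<in> borel_measurable M"
  shows "(\<lambda>w. cavg Q f (g w) (h w)) \<in> borel_measurable M"
  unfolding cavg_def by measurable

lemma nn_integral_cavg:
  fixes f :: "real^'n::finite \<Rightarrow> real"
  assumes [measurable]: "Q \<in> sets borel" "f \<in> borel_measurable borel" and t: "t > 0"
  shows "(\<integral>\<^sup>+x. cavg Q f x t \<partial>lborel) = emeasure lborel Q * (\<integral>\<^sup>+y. ennreal (f y) \<partial>lborel)"
proof -
  have eq: "ennreal (f y * rescale (indicator Q) x t y) = ennreal (f y) * ennreal (rescale (indicator Q) x t y)" for x y
    using t by (simp add: rescale_nonneg ennreal_mult'')
  have "(\<integral>\<^sup>+x. cavg Q f x t \<partial>lborel)
    = (\<integral>\<^sup>+y. \<integral>\<^sup>+x. ennreal (f y) * ennreal (rescale (indicator Q) x t y) \<partial>lborel \<partial>lborel)"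
    unfolding cavg_def eq by (rule lborel_pair.Fubini') measurable
  also have "\<dots> = (\<integral>\<^sup>+y. ennreal (f y) * emeasure lborel Q \<partial>lborel)"
    using t by (simp add: nn_integral_cmult nn_integral_rescale_snd ennreal_indicator)
  finally show ?thesis by (simp add: nn_integral_multc mult.commute)
qed

lemma cavg_le_const:
  fixes f :: "real^'n::finite \<Rightarrow> real"
  assumes [measurable]: "Q \<in> sets borel" and f: "\<And>y. f y \<le> h" and h: "h \<ge> 0" and t: "t > 0"
  shows "cavg Q f x t \<le> ennreal h * emeasure lborel Q"
proof -
  have "cavg Q f x t \<le> (\<integral>\<^sup>+y. ennreal h * ennreal (rescale (indicator Q) x t y) \<partial>lborel)"
    unfolding cavg_def using t h
    by (intro nn_integral_mono) (auto simp: rescale_nonneg intro!: ennreal_leI mult_right_mono f simp flip: ennreal_mult')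
  also have "\<dots> = ennreal h * emeasure lborel Q"
    using t by (simp add: nn_integral_cmult nn_integral_rescale_fst ennreal_indicator)
  finally show ?thesis .
qed

lemma cavg_add:
  assumes [measurable]: "Q \<in> sets borel" "f \<in> borel_measurable borel" "g \<in> borel_measurable borel"
    and "\<And>y. 0 \<le> f y" "\<And>y. 0 \<le> g y" "t > 0"
  shows "cavg Q (\<lambda>y. f y + g y) x t = cavg Q f x t + cavg Q g x t"
proof -
  have "cavg Q f x t + cavg Q g x t = (\<integral>\<^sup>+y. ennreal (f y * rescale (indicator Q) x t y)
      + ennreal (g y * rescale (indicator Q) x t y) \<partial>lborel)"
    unfolding cavg_def by (intro nn_integral_add[symmetric]) measurable
  also have "\<dots> = cavg Q (\<lambda>y. f y + g y) x t"
    unfolding cavg_def using assms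
    by (intro nn_integral_cong) (simp add: rescale_nonneg distrib_right flip: ennreal_plus)
  finally show ?thesis ..
qed

text \<open>Cauchy-Schwarz; the square of the rescaled indicator is t^(-d) times the rescaled
  indicator, which has mass |Q|.\<close>

lemma cavg_square_le:
  fixes f :: "real^'n::finite \<Rightarrow> real"
  assumes [measurable]: "Q \<in> sets borel" "f \<in> borel_measurable borel" and t: "t > 0" and f: "\<And>y. 0 \<le> f y"
  shows "(cavg Q f x t)\<^sup>2 \<le> (\<integral>\<^sup>+y. ennreal ((f y)\<^sup>2) \<partial>lborel) * (ennreal (1 / t ^ CARD('n)) * emeasure lborel Q)"
proof -
  have "(cavg Q f x t)\<^sup>2 = (\<integral>\<^sup>+y. ennreal (f y) * ennreal (rescale (indicator Q) x t y) \<partial>lborel)\<^sup>2"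
    unfolding cavg_def using t f by (simp add: rescale_nonneg ennreal_mult)
  also have "\<dots> \<le> (\<integral>\<^sup>+y. (ennreal (f y))\<^sup>2 \<partial>lborel) * (\<integral>\<^sup>+y. (ennreal (rescale (indicator Q) x t y))\<^sup>2 \<partial>lborel)"
    by (rule Cauchy_Schwarz_nn_integral) measurable
  also have "(\<integral>\<^sup>+y. (ennreal (f y))\<^sup>2 \<partial>lborel) = (\<integral>\<^sup>+y. ennreal ((f y)\<^sup>2) \<partial>lborel)"
    using f by (simp add: ennreal_power)
  also have "(\<integral>\<^sup>+y. (ennreal (rescale (indicator Q) x t y))\<^sup>2 \<partial>lborel)
    = (\<integral>\<^sup>+y. ennreal (1 / t ^ CARD('n)) * ennreal (rescale (indicator Q) x t y) \<partial>lborel)"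
  proof (intro nn_integral_cong)
    fix y
    have "(rescale (indicator Q) x t y)\<^sup>2 = 1 / t ^ CARD('n) * rescale (indicator Q) x t y"
      by (simp add: rescale_def power2_eq_square indicator_def)
    then show "(ennreal (rescale (indicator Q) x t y))\<^sup>2 = ennreal (1 / t ^ CARD('n)) * ennreal (rescale (indicator Q) x t y)"
      using t by (simp add: ennreal_power rescale_nonneg flip: ennreal_mult)
  qed
  also have "\<dots> = ennreal (1 / t ^ CARD('n)) * emeasure lborel Q"
    using t by (simp add: nn_integral_cmult nn_integral_rescale_fst ennreal_indicator)
  finally show ?thesis .
qed

lemma norm_rescale_integral_le:
  assumes t: "t > 0" and \<psi>: "\<And>z. \<bar>\<psi> z\<bar> \<le> M * indicator Q z" and P: "\<And>y. \<bar>v y\<bar> \<le> P y"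
    and [measurable]: "Q \<in> sets borel" "P \<in> borel_measurable borel"
  shows "ennreal \<bar>\<integral>y. v y * rescale \<psi> x t y \<partial>lborel\<bar> \<le> ennreal M * cavg Q P x t"
proof (cases "integrable lborel (\<lambda>y. v y * rescale \<psi> x t y)")
  case True
  have M: "M * indicator Q z \<ge> 0" for z using \<psi>[of z] by linarith
  have "ennreal \<bar>\<integral>y. v y * rescale \<psi> x t y \<partial>lborel\<bar> \<le> (\<integral>\<^sup>+y. ennreal \<bar>v y * rescale \<psi> x t y\<bar> \<partial>lborel)"
    using integral_norm_bound_ennreal[OF True] by simp
  also have "\<dots> \<le> (\<integral>\<^sup>+y. ennreal M * ennreal (P y * rescale (indicator Q) x t y) \<partial>lborel)"
  proof (intro nn_integral_mono)
    fix y
    let ?z = "(1 / t) *\<^sub>R (y - x)"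
    have P0: "P y \<ge> 0" using P[of y] by linarith
    have "\<bar>v y * rescale \<psi> x t y\<bar> = \<bar>v y\<bar> * (\<bar>\<psi> ?z\<bar> / t ^ CARD('a))"
      using t by (simp add: rescale_def abs_mult)
    also have "\<dots> \<le> P y * (M * indicator Q ?z / t ^ CARD('a))"
      using t P P0 \<psi> by (intro mult_mono divide_right_mono) auto
    also have "\<dots> = M * (P y * rescale (indicator Q) x t y)"
      by (simp add: rescale_def)
    finally show "ennreal \<bar>v y * rescale \<psi> x t y\<bar> \<le> ennreal M * ennreal (P y * rescale (indicator Q) x t y)"
      using P0 t by (simp add: ennreal_mult''[symmetric] rescale_nonneg ennreal_leI)
  qed
  also have "\<dots> = ennreal M * cavg Q P x t"
    unfolding cavg_def by (intro nn_integral_cmult) measurable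
  finally show ?thesis .
\<comment> \<open>Without integrability the Bochner integral is 0 by convention and the bound is
  trivial.\<close>
qed (simp add: not_integrable_integral_eq)

section \<open>The scale derivative of an average\<close>

lemma pderivative_mult_coord:
  assumes "smooth \<psi>"
  shows "pderivative i (\<lambda>z. z $ i * \<psi> z) z = \<psi> z + z $ i * pderivative i \<psi> z"
proof -
  obtain \<psi>' where \<psi>': "(\<psi> has_derivative \<psi>') (at z)"
    using smooth_differentiable[OF assms, of z] by (auto simp: differentiable_def)
  have "((\<lambda>z. z $ i * \<psi> z) has_derivative (\<lambda>h. z $ i * \<psi>' h + h $ i * \<psi> z)) (at z)"
    by (intro has_derivative_mult \<psi>' bounded_linear_imp_has_derivative bounded_linear_vec_nth)
  from pderivative_eq[OF this] pderivative_eq[OF \<psi>'] show ?thesis by simp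
qed

lemma pderivative_rescale:
  fixes \<psi> :: "real^'n::finite \<Rightarrow> real"
  assumes "smooth \<psi>"
  shows "pderivative i (rescale \<psi> x t) y = pderivative i \<psi> ((1 / t) *\<^sub>R (y - x)) / (t * t ^ CARD('n))"
proof -
  let ?z = "(1 / t) *\<^sub>R (y - x)"
  obtain \<psi>' where \<psi>': "(\<psi> has_derivative \<psi>') (at ?z)"
    using smooth_differentiable[OF assms, of ?z] by (auto simp: differentiable_def)
  have "((\<lambda>y. (1 / t) *\<^sub>R (y - x)) has_derivative (\<lambda>h. (1 / t) *\<^sub>R h)) (at y)"
    by (auto intro!: derivative_eq_intros)
  from has_derivative_compose[OF this \<psi>']
  have "((\<lambda>y. \<psi> ((1 / t) *\<^sub>R (y - x))) has_derivative (\<lambda>h. \<psi>' ((1 / t) *\<^sub>R h))) (at y)" .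
  from has_derivative_mult_left[OF this, of "1 / t ^ CARD('n)"]
  have "(rescale \<psi> x t has_derivative (\<lambda>h. \<psi>' ((1 / t) *\<^sub>R h) / t ^ CARD('n))) (at y)"
    by (simp add: rescale_def[abs_def])
  from pderivative_eq[OF this, of i] pderivative_eq[OF \<psi>', of i]
    linear_scale[OF has_derivative_linear[OF \<psi>'], of "1 / t" "axis i 1"]
  show ?thesis by simp
qed

lemma has_derivative_sum_pderivative:
  assumes "(f has_derivative f') (at x)"
  shows "f' h = (\<Sum>i\<in>UNIV. h $ i * pderivative i f x)"
proof -
  have "f' h = f' (\<Sum>i\<in>UNIV. h $ i *\<^sub>R axis i 1)"
    by (simp add: basis_expansion scalar_mult_eq_scaleR[symmetric])
  also have "\<dots> = (\<Sum>i\<in>UNIV. h $ i * pderivative i f x)"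
    using has_derivative_linear[OF assms] pderivative_eq[OF assms]
    by (simp add: linear_sum linear_scale)
  finally show ?thesis .
qed

text \<open>The scale derivative of the kernel is a divergence in y because div(z \<psi>) = d \<psi>
  + z . grad \<psi>: the first summand comes from differentiating t^(-d), the second from the
  argument (y - x)/t. Tested against a weakly differentiable function, it becomes a sum of averages
  of first derivatives with kernels z_i \<psi>.\<close>

lemma rescale_has_derivative_scale:
  fixes \<psi> :: "real^'n::finite \<Rightarrow> real"
  assumes \<psi>: "smooth \<psi>" and t: "t > 0"
  shows "((\<lambda>t. rescale \<psi> x t y) has_real_derivative
    - (\<Sum>i\<in>UNIV. pderivative i (rescale (\<lambda>z. z $ i * \<psi> z) x t) y)) (at t)"
proof -
  let ?z = "(1 / t) *\<^sub>R (y - x)" and ?d = "CARD('n)"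
  obtain \<psi>' where \<psi>': "(\<psi> has_derivative \<psi>') (at ?z)"
    using smooth_differentiable[OF \<psi>, of ?z] by (auto simp: differentiable_def)
  have "((\<lambda>t. (1 / t) *\<^sub>R (y - x)) has_derivative (\<lambda>h. (- h / t\<^sup>2) *\<^sub>R (y - x))) (at t)"
    using t by (auto intro!: derivative_eq_intros simp: power2_eq_square)
  from has_derivative_compose[OF this \<psi>']
  have "((\<lambda>t. \<psi> ((1 / t) *\<^sub>R (y - x))) has_derivative (\<lambda>h. \<psi>' ((- h / t\<^sup>2) *\<^sub>R (y - x)))) (at t)" .
  moreover have "(\<lambda>h. \<psi>' ((- h / t\<^sup>2) *\<^sub>R (y - x))) = (*) (- (1 / t) * \<psi>' ?z)"
  proof
    fix h
    have "(- h / t\<^sup>2) *\<^sub>R (y - x) = (- (1 / t) * h) *\<^sub>R ?z"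
      using t by (simp add: power2_eq_square)
    then have "\<psi>' ((- h / t\<^sup>2) *\<^sub>R (y - x)) = \<psi>' ((- (1 / t) * h) *\<^sub>R ?z)" by (rule arg_cong)
    also have "\<dots> = (- (1 / t) * h) *\<^sub>R \<psi>' ?z"
      by (rule linear_scale[OF has_derivative_linear[OF \<psi>']])
    finally show "\<psi>' ((- h / t\<^sup>2) *\<^sub>R (y - x)) = - (1 / t) * \<psi>' ?z * h" by simp
  qed
  ultimately have "((\<lambda>t. \<psi> ((1 / t) *\<^sub>R (y - x))) has_real_derivative - (1 / t) * \<psi>' ?z) (at t)"
    by (simp only: has_field_derivative_def)
  moreover have "((\<lambda>t. 1 / t ^ ?d) has_real_derivative - real ?d / (t * t ^ ?d)) (at t)"
  proof -
    have td: "t ^ ?d = t * t ^ (?d - 1)"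
      using power_minus_mult[of ?d t] by (simp add: mult.commute)
    have "((\<lambda>t. inverse (t ^ ?d)) has_real_derivative
        - (inverse (t ^ ?d) * (real ?d * t ^ (?d - Suc 0)) * inverse (t ^ ?d))) (at t)"
      by (rule DERIV_inverse'[OF DERIV_pow]) (use t in auto)
    moreover have "- (inverse (t ^ ?d) * (real ?d * t ^ (?d - Suc 0)) * inverse (t ^ ?d)) = - real ?d / (t * t ^ ?d)"
      unfolding td using t by (simp add: divide_inverse)
    ultimately show ?thesis by (simp add: inverse_eq_divide)
  qed
  ultimately have "((\<lambda>t. \<psi> ((1 / t) *\<^sub>R (y - x)) * (1 / t ^ ?d)) has_real_derivative
      - (1 / t) * \<psi>' ?z * (1 / t ^ ?d) + - real ?d / (t * t ^ ?d) * \<psi> ?z) (at t)"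
    by (rule DERIV_mult)
  moreover have "- (1 / t) * \<psi>' ?z * (1 / t ^ ?d) + - real ?d / (t * t ^ ?d) * \<psi> ?z
    = - (\<Sum>i\<in>UNIV. pderivative i (rescale (\<lambda>z. z $ i * \<psi> z) x t) y)"
  proof -
    have "(\<Sum>i\<in>UNIV. pderivative i (rescale (\<lambda>z. z $ i * \<psi> z) x t) y)
      = (\<Sum>i\<in>UNIV. (\<psi> ?z + ?z $ i * pderivative i \<psi> ?z) / (t * t ^ ?d))"
      by (intro sum.cong refl) (simp only: pderivative_rescale[OF smooth_mult[OF smooth_coord \<psi>]] pderivative_mult_coord[OF \<psi>])
    also have "\<dots> = (real ?d * \<psi> ?z + (\<Sum>i\<in>UNIV. ?z $ i * pderivative i \<psi> ?z)) / (t * t ^ ?d)"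
      by (simp only: sum.distrib sum_constant flip: sum_divide_distrib)
    also have "\<dots> = (real ?d * \<psi> ?z + \<psi>' ?z) / (t * t ^ ?d)"
      by (simp only: has_derivative_sum_pderivative[OF \<psi>', of ?z])
    finally show ?thesis by (simp add: add_divide_distrib)
  qed
  ultimately show ?thesis by (simp add: rescale_def)
qed

lemma mindex_order_Suc: "mindex_order (\<alpha>(i := Suc (\<alpha> i))) = Suc (mindex_order \<alpha>)"
proof -
  have "mindex_order (\<alpha>(i := Suc (\<alpha> i))) = Suc (\<alpha> i) + (\<Sum>j\<in>UNIV - {i}. \<alpha> j)"
    unfolding mindex_order_def by (subst sum.remove[of _ i]) (auto intro!: sum.cong)
  also have "\<dots> = Suc (mindex_order \<alpha>)"
    unfolding mindex_order_def by (subst (2) sum.remove[of _ i]) auto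
  finally show ?thesis .
qed

text \<open>This is where the cone property enters: as x + t Q lies in the domain, the rescaled
  kernel is admissible as a test function.\<close>

lemma rescale_smooth_compact:
  fixes \<psi> :: "real^'n::finite \<Rightarrow> real"
  assumes \<psi>: "smooth \<psi>" and Q: "compact Q" "\<And>z. z \<notin> Q \<Longrightarrow> \<psi> z = 0" and t: "t > 0"
    and sub: "\<And>z. z \<in> Q \<Longrightarrow> x + t *\<^sub>R z \<in> \<Omega>"
  shows "rescale \<psi> x t \<in> smooth_compact \<Omega>"
proof -
  have "smooth (\<lambda>y. \<psi> ((1 / t) *\<^sub>R (y - x)) * (1 / t ^ CARD('n)))"
    by (intro smooth.intros smooth_affine \<psi>)
  then have "smooth (rescale \<psi> x t)"
    by (simp add: rescale_def[abs_def])
  moreover have "compact ((\<lambda>z. x + t *\<^sub>R z) ` Q)"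
    by (intro compact_continuous_image continuous_intros Q(1))
  moreover have "rescale \<psi> x t y = 0" if "y \<notin> (\<lambda>z. x + t *\<^sub>R z) ` Q" for y
  proof -
    have "y = x + t *\<^sub>R ((1 / t) *\<^sub>R (y - x))" using t by simp
    with that have "(1 / t) *\<^sub>R (y - x) \<notin> Q" by blast
    then show ?thesis using Q(2) by (simp add: rescale_def)
  qed
  ultimately show ?thesis
    using sub unfolding smooth_compact_def by (auto intro!: exI[of _ "(\<lambda>z. x + t *\<^sub>R z) ` Q"])
qed

lemma integrable_mult_smooth_compact:
  assumes "integrable lborel v" "\<phi> \<in> smooth_compact \<Omega>"
  shows "integrable lborel (\<lambda>y. v y * \<phi> y)"
proof -
  obtain B where B: "\<And>x. \<bar>\<phi> x\<bar> \<le> B" using smooth_compact_bounded[OF assms(2)] by blast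
  have "smooth \<phi>" using assms(2) by (auto simp: smooth_compact_def)
  then have [measurable]: "\<phi> \<in> borel_measurable borel" by (rule smooth_borel)
  have [measurable]: "v \<in> borel_measurable borel" using assms(1) by auto
  show ?thesis
  proof (rule Bochner_Integration.integrable_bound[where f = "\<lambda>y. B * \<bar>v y\<bar>"])
    show "integrable lborel (\<lambda>y. B * \<bar>v y\<bar>)" using assms(1) by auto
    show "AE y in lborel. norm (v y * \<phi> y) \<le> norm (B * \<bar>v y\<bar>)"
    proof (rule AE_I2)
      fix y
      have "\<bar>v y\<bar> * \<bar>\<phi> y\<bar> \<le> \<bar>v y\<bar> * \<bar>B\<bar>" using B[of y] by (intro mult_left_mono) auto
      then show "norm (v y * \<phi> y) \<le> norm (B * \<bar>v y\<bar>)" by (simp add: abs_mult mult.commute)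
    qed
  qed measurable
qed

text \<open>The fundamental theorem of calculus in the scale for each fixed y, then Fubini, then the
  weak derivative relation at each scale.\<close>

lemma rescale_integral_difference_le:
  fixes \<psi> v :: "real^'n::finite \<Rightarrow> real"
  assumes \<psi>: "smooth \<psi>" and Q: "compact Q" "\<And>z. z \<notin> Q \<Longrightarrow> \<psi> z = 0"
    and \<tau>: "0 < \<tau>" "\<tau> \<le> T" and sub: "\<And>t z. \<tau> \<le> t \<Longrightarrow> t \<le> T \<Longrightarrow> z \<in> Q \<Longrightarrow> x + t *\<^sub>R z \<in> \<Omega>"
    and v: "integrable lborel v" and w: "\<And>i. weak_partial \<Omega> i v (w i)"
  shows "ennreal \<bar>(\<integral>y. v y * rescale \<psi> x T y \<partial>lborel) - (\<integral>y. v y * rescale \<psi> x \<tau> y \<partial>lborel)\<bar>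
    \<le> (\<integral>\<^sup>+t. indicator {\<tau>..T} t * (\<Sum>i\<in>UNIV. ennreal \<bar>\<integral>y. w i y * rescale (\<lambda>z. z $ i * \<psi> z) x t y \<partial>lborel\<bar>) \<partial>lborel)"
proof -
  let ?d = "CARD('n)"
  define \<eta> where "\<eta> i = (\<lambda>z. z $ i * \<psi> z)" for i
  have \<eta>: "smooth (\<eta> i)" "\<And>z. z \<notin> Q \<Longrightarrow> \<eta> i z = 0" for i
    using \<psi> Q(2) by (auto simp: \<eta>_def intro: smooth.intros)
  define h where "h t y = (\<Sum>i\<in>UNIV. pderivative i (rescale (\<eta> i) x t) y)" for t y
  have h: "h t y = (\<Sum>i\<in>UNIV. pderivative i (\<eta> i) ((1 / t) *\<^sub>R (y - x)) / (t * t ^ ?d))" for t y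
    by (simp add: h_def pderivative_rescale[OF \<eta>(1)])
  have sm: "smooth (pderivative i (\<eta> i))" for i by (rule smooth_pderivative[OF \<eta>(1)])
  note [measurable] = smooth_borel[OF sm] smooth_borel[OF \<psi>] smooth_borel[OF \<eta>(1)]
  have [measurable]: "v \<in> borel_measurable borel" using v by auto
  have "\<exists>B. \<forall>z. \<bar>pderivative i (\<eta> i) z\<bar> \<le> B" for i
  proof -
    have "\<eta> i \<in> smooth_compact UNIV"
      using \<eta> Q unfolding smooth_compact_def by blast
    then show ?thesis
      using smooth_compact_bounded[OF smooth_compact_pderivative] by metis
  qed
  then obtain B where B: "\<And>i z. \<bar>pderivative i (\<eta> i) z\<bar> \<le> B i" by metis
  \<comment> \<open>The scale derivative of the kernel grows like t^(-d-1) near 0. The positive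
    lower scale \<tau> keeps it bounded, so that \<open>H\<close> is integrable on the product and
    Fubini applies.\<close>
  define C where "C = (\<Sum>i\<in>UNIV. B i / (\<tau> * \<tau> ^ ?d))"
  have hC: "\<bar>h t y\<bar> \<le> C" if "\<tau> \<le> t" for t y
  proof -
    have "\<bar>h t y\<bar> \<le> (\<Sum>i\<in>UNIV. \<bar>pderivative i (\<eta> i) ((1 / t) *\<^sub>R (y - x)) / (t * t ^ ?d)\<bar>)"
      unfolding h by (rule sum_abs)
    also have "\<dots> \<le> C"
      unfolding C_def
    proof (rule sum_mono)
      fix i :: 'n
      have "\<bar>pderivative i (\<eta> i) ((1 / t) *\<^sub>R (y - x))\<bar> / (t * t ^ ?d) \<le> B i / (\<tau> * \<tau> ^ ?d)"
        using B[of i] \<tau> that by (intro frac_le mult_mono power_mono) (auto intro: order_trans[OF abs_ge_zero])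
      then show "\<bar>pderivative i (\<eta> i) ((1 / t) *\<^sub>R (y - x)) / (t * t ^ ?d)\<bar> \<le> B i / (\<tau> * \<tau> ^ ?d)"
        using \<tau> that by (simp add: abs_mult)
    qed
    finally show ?thesis .
  qed
  have C0: "C \<ge> 0" using hC[of \<tau> x] by linarith
  have FTC: "(\<integral>t. - h t y * indicator {\<tau>..T} t \<partial>lborel) = rescale \<psi> x T y - rescale \<psi> x \<tau> y" for y
  proof (rule integral_FTC_Icc_real[OF \<tau>(2)])
    fix t assume t: "\<tau> \<le> t" "t \<le> T"
    show "((\<lambda>t. rescale \<psi> x t y) has_real_derivative - h t y) (at t)"
      unfolding h_def \<eta>_def by (rule rescale_has_derivative_scale[OF \<psi>]) (use t \<tau> in auto)
    have "isCont (\<lambda>t. pderivative i (\<eta> i) ((1 / t) *\<^sub>R (y - x))) t" for i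
    proof (rule isCont_o2[where g = "pderivative i (\<eta> i)"])
      show "isCont (\<lambda>t. (1 / t) *\<^sub>R (y - x)) t" using t \<tau> by (intro continuous_intros) auto
      show "isCont (pderivative i (\<eta> i)) ((1 / t) *\<^sub>R (y - x))"
        using smooth_continuous[OF sm, of UNIV] by (simp add: continuous_on_eq_continuous_at)
    qed
    then show "isCont (\<lambda>t. - h t y) t"
      unfolding h using t \<tau> by (intro continuous_intros) auto
  qed
  define H where "H t y = v y * (- h t y * indicator {\<tau>..T} t)" for t y
  have [measurable]: "(\<lambda>(t, y). H t y) \<in> borel_measurable (lborel \<Otimes>\<^sub>M lborel)"
    unfolding H_def h by measurable
  have H_le: "\<bar>H t y\<bar> \<le> indicator {\<tau>..T} t * (C * \<bar>v y\<bar>)" for t y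
  proof (cases "t \<in> {\<tau>..T}")
    case True
    then have "\<bar>v y\<bar> * \<bar>h t y\<bar> \<le> \<bar>v y\<bar> * C" by (intro mult_left_mono hC) auto
    with True show ?thesis by (simp add: H_def abs_mult mult.commute)
  qed (simp add: H_def)
  have Hint: "integrable (lborel \<Otimes>\<^sub>M lborel) (\<lambda>(t, y). H t y)"
  proof (rule integrableI_bounded)
    have "(\<integral>\<^sup>+ p. ennreal (norm (case p of (t, y) \<Rightarrow> H t y)) \<partial>(lborel \<Otimes>\<^sub>M lborel))
      = (\<integral>\<^sup>+t. \<integral>\<^sup>+y. ennreal \<bar>H t y\<bar> \<partial>lborel \<partial>lborel)"
      by (subst lborel.nn_integral_fst[symmetric]) simp_all
    also have "\<dots> \<le> (\<integral>\<^sup>+t. \<integral>\<^sup>+y. indicator {\<tau>..T} t * ennreal (C * \<bar>v y\<bar>) \<partial>lborel \<partial>lborel)"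
      using H_le by (intro nn_integral_mono)
        (simp add: ennreal_mult'[symmetric] C0 ennreal_leI flip: ennreal_indicator)
    also have "\<dots> = (\<integral>\<^sup>+t. indicator {\<tau>..T} t \<partial>(lborel :: real measure)) * (\<integral>\<^sup>+y. ennreal (C * \<bar>v y\<bar>) \<partial>lborel)"
      by (simp add: nn_integral_cmult nn_integral_multc)
    also have "\<dots> < \<infinity>"
    proof -
      have "(\<integral>\<^sup>+y. ennreal (C * \<bar>v y\<bar>) \<partial>lborel) < \<infinity>"
        using v C0 unfolding integrable_iff_bounded
        by (simp add: ennreal_mult' nn_integral_cmult ennreal_mult_less_top)
      then show ?thesis using \<tau> by (simp add: ennreal_mult_less_top)
    qed
    finally show "(\<integral>\<^sup>+ p. ennreal (norm (case p of (t, y) \<Rightarrow> H t y)) \<partial>(lborel \<Otimes>\<^sub>M lborel)) < \<infinity>" .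
  qed measurable
  have tf: "rescale \<psi> x t \<in> smooth_compact \<Omega>" "rescale (\<eta> i) x t \<in> smooth_compact \<Omega>"
    if "\<tau> \<le> t" "t \<le> T" for t i
    using that \<tau> by (auto intro!: rescale_smooth_compact[OF \<psi> Q(1,2)] rescale_smooth_compact[OF \<eta>(1) Q(1) \<eta>(2)] sub)
  have inner: "(\<integral>y. H t y \<partial>lborel)
      = indicator {\<tau>..T} t * (\<Sum>i\<in>UNIV. \<integral>y. w i y * rescale (\<eta> i) x t y \<partial>lborel)" for t
  proof (cases "t \<in> {\<tau>..T}")
    case True
    then have t: "\<tau> \<le> t" "t \<le> T" by auto
    have "(\<integral>y. H t y \<partial>lborel) = (\<integral>y. - (\<Sum>i\<in>UNIV. v y * pderivative i (rescale (\<eta> i) x t) y) \<partial>lborel)"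
      using True by (simp add: H_def h_def sum_distrib_left)
    also have "\<dots> = - (\<Sum>i\<in>UNIV. \<integral>y. v y * pderivative i (rescale (\<eta> i) x t) y \<partial>lborel)"
      using integrable_mult_smooth_compact[OF v smooth_compact_pderivative[OF tf(2)[OF t]]]
      by (simp add: Bochner_Integration.integral_sum)
    also have "\<dots> = (\<Sum>i\<in>UNIV. \<integral>y. w i y * rescale (\<eta> i) x t y \<partial>lborel)"
      using w tf(2)[OF t] by (simp add: weak_partial_def sum_negf)
    finally show ?thesis using True by simp
  qed (simp add: H_def)
  have "(\<integral>y. v y * rescale \<psi> x T y \<partial>lborel) - (\<integral>y. v y * rescale \<psi> x \<tau> y \<partial>lborel)
    = (\<integral>y. v y * rescale \<psi> x T y - v y * rescale \<psi> x \<tau> y \<partial>lborel)"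
    using \<tau> by (intro Bochner_Integration.integral_diff[symmetric] integrable_mult_smooth_compact[OF v tf(1)]) auto
  also have "\<dots> = (\<integral>y. \<integral>t. H t y \<partial>lborel \<partial>lborel)"
    unfolding H_def by (simp only: integral_mult_right_zero FTC right_diff_distrib)
  also have "\<dots> = (\<integral>t. \<integral>y. H t y \<partial>lborel \<partial>lborel)"
    by (rule lborel_pair.Fubini_integral[OF Hint])
  finally have "ennreal \<bar>(\<integral>y. v y * rescale \<psi> x T y \<partial>lborel) - (\<integral>y. v y * rescale \<psi> x \<tau> y \<partial>lborel)\<bar>
      \<le> (\<integral>\<^sup>+t. ennreal \<bar>\<integral>y. H t y \<partial>lborel\<bar> \<partial>lborel)"
    using integral_norm_bound_ennreal[OF lborel_pair.integrable_fst[OF Hint]] by simp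
  also have "\<dots> \<le> (\<integral>\<^sup>+t. indicator {\<tau>..T} t * (\<Sum>i\<in>UNIV. ennreal \<bar>\<integral>y. w i y * rescale (\<eta> i) x t y \<partial>lborel\<bar>) \<partial>lborel)"
  proof (rule nn_integral_mono)
    fix t
    have "ennreal \<bar>\<Sum>i\<in>UNIV. \<integral>y. w i y * rescale (\<eta> i) x t y \<partial>lborel\<bar>
       \<le> ennreal (\<Sum>i\<in>UNIV. \<bar>\<integral>y. w i y * rescale (\<eta> i) x t y \<partial>lborel\<bar>)"
      by (intro ennreal_leI sum_abs)
    then show "ennreal \<bar>\<integral>y. H t y \<partial>lborel\<bar>
      \<le> indicator {\<tau>..T} t * (\<Sum>i\<in>UNIV. ennreal \<bar>\<integral>y. w i y * rescale (\<eta> i) x t y \<partial>lborel\<bar>)"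
      unfolding inner by (cases "t \<in> {\<tau>..T}") simp_all
  qed
  finally show ?thesis unfolding \<eta>_def .
qed

subsection \<open>Pointwise bound by averages of the highest derivatives\<close>

text \<open>The integral remainder of a Taylor formula in the scale variable: each further
  integration over scales raises the weight t^n by one power, and the average at scale T absorbs the
  boundary terms.\<close>

definition taylor_bound ::
    "(real^'n::finite) set \<Rightarrow> (real^'n \<Rightarrow> real) \<Rightarrow> real \<Rightarrow> nat \<Rightarrow> real^'n \<Rightarrow> real \<Rightarrow> ennreal" where
  "taylor_bound Q P T n x \<tau>
     = cavg Q P x T + (\<integral>\<^sup>+t. ennreal (indicator {\<tau>..T} t * t ^ n) * cavg Q P x t \<partial>lborel)"

text \<open>Exchanging the integrals over \<tau> \<le> t \<le> r \<le> T leaves the inner length r -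
  \<tau> \<le> r, hence one more power of r. The boundary term only picks up T - \<tau> \<le>
  1.\<close>

lemma nn_integral_taylor_bound_le:
  fixes P :: "real^'n::finite \<Rightarrow> real"
  assumes [measurable]: "Q \<in> sets borel" "P \<in> borel_measurable borel" and \<tau>: "0 < \<tau>" "\<tau> \<le> T" "T \<le> 1"
  shows "(\<integral>\<^sup>+t. indicator {\<tau>..T} t * taylor_bound Q P T n x t \<partial>lborel) \<le> taylor_bound Q P T (Suc n) x \<tau>"
proof -
  let ?A = "cavg Q P x"
  have "(\<integral>\<^sup>+t. indicator {\<tau>..T} t * taylor_bound Q P T n x t \<partial>lborel)
    = (\<integral>\<^sup>+t. (indicator {\<tau>..T} t * ?A T
        + (\<integral>\<^sup>+r. indicator {\<tau>..T} t * (ennreal (indicator {t..T} r * r ^ n) * ?A r) \<partial>lborel)) \<partial>lborel)"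
    unfolding taylor_bound_def distrib_left by (simp add: nn_integral_cmult)
  also have "\<dots> = (\<integral>\<^sup>+t. indicator {\<tau>..T} t * ?A T \<partial>lborel)
      + (\<integral>\<^sup>+t. \<integral>\<^sup>+r. indicator {\<tau>..T} t * (ennreal (indicator {t..T} r * r ^ n) * ?A r) \<partial>lborel \<partial>lborel)"
    unfolding atLeastAtMost_iff indicator_def by (intro nn_integral_add) measurable
  also have "\<dots> \<le> ?A T + (\<integral>\<^sup>+t. ennreal (indicator {\<tau>..T} t * t ^ Suc n) * ?A t \<partial>lborel)"
  proof (rule add_mono)
    have "(\<integral>\<^sup>+t. indicator {\<tau>..T} t * ?A T \<partial>lborel) = ennreal (T - \<tau>) * ?A T"
      using \<tau> by (simp add: nn_integral_multc)
    also have "\<dots> \<le> 1 * ?A T"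
      using \<tau> by (intro mult_right_mono) (auto simp: ennreal_le_1)
    finally show "(\<integral>\<^sup>+t. indicator {\<tau>..T} t * ?A T \<partial>lborel) \<le> ?A T" by simp
    have "(\<integral>\<^sup>+t. \<integral>\<^sup>+r. indicator {\<tau>..T} t * (ennreal (indicator {t..T} r * r ^ n) * ?A r) \<partial>lborel \<partial>lborel)
      = (\<integral>\<^sup>+r. \<integral>\<^sup>+t. indicator {\<tau>..T} t * (ennreal (indicator {t..T} r * r ^ n) * ?A r) \<partial>lborel \<partial>lborel)"
      unfolding atLeastAtMost_iff indicator_def by (rule lborel_pair.Fubini') measurable
    also have "\<dots> \<le> (\<integral>\<^sup>+r. ennreal (indicator {\<tau>..T} r * r ^ Suc n) * ?A r \<partial>lborel)"
    proof (rule nn_integral_mono)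
      fix r :: real
      have "(\<integral>\<^sup>+t. indicator {\<tau>..T} t * (ennreal (indicator {t..T} r * r ^ n) * ?A r) \<partial>lborel)
        = (\<integral>\<^sup>+t. indicator {\<tau>..r} t * (ennreal (indicator {\<tau>..T} r * r ^ n) * ?A r) \<partial>lborel)"
        by (intro nn_integral_cong) (auto simp: indicator_def)
      also have "\<dots> = emeasure lborel {\<tau>..r} * (ennreal (indicator {\<tau>..T} r * r ^ n) * ?A r)"
        by (simp add: nn_integral_multc)
      also have "\<dots> \<le> ennreal (indicator {\<tau>..T} r * r ^ Suc n) * ?A r"
      proof (cases "r \<in> {\<tau>..T}")
        case True
        have "ennreal (r - \<tau>) * ennreal (r ^ n) \<le> ennreal (r ^ Suc n)"
          using True \<tau> by (auto simp: ennreal_mult'[symmetric] intro!: ennreal_leI mult_right_mono)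
        with True show ?thesis by (simp add: mult.assoc[symmetric] mult_right_mono)
      qed simp
      finally show "(\<integral>\<^sup>+t. indicator {\<tau>..T} t * (ennreal (indicator {t..T} r * r ^ n) * ?A r) \<partial>lborel)
        \<le> ennreal (indicator {\<tau>..T} r * r ^ Suc n) * ?A r" .
    qed
    finally show "(\<integral>\<^sup>+t. \<integral>\<^sup>+r. indicator {\<tau>..T} t * (ennreal (indicator {t..T} r * r ^ n) * ?A r) \<partial>lborel \<partial>lborel)
       \<le> (\<integral>\<^sup>+r. ennreal (indicator {\<tau>..T} r * r ^ Suc n) * ?A r \<partial>lborel)" .
  qed
  finally show ?thesis unfolding taylor_bound_def .
qed

text \<open>Induction on the number of orders still missing. One scale derivative replaces D
  \<alpha> by d derivatives of the next order and \<psi> by z_i \<psi>, so that M becomes M B and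
  the sum costs a factor d B; the boundary term at scale T accounts for the 1 in d B + 1.\<close>

lemma rescale_integral_le_taylor_bound:
  fixes D :: "'n::finite mindex \<Rightarrow> real^'n \<Rightarrow> real"
  assumes Q: "compact Q" and B: "\<And>z i. z \<in> Q \<Longrightarrow> \<bar>z $ i\<bar> \<le> B" and B0: "0 \<le> B"
    and T: "T \<le> 1" and sub: "\<And>t z. 0 < t \<Longrightarrow> t \<le> T \<Longrightarrow> z \<in> Q \<Longrightarrow> x + t *\<^sub>R z \<in> \<Omega>"
    and [measurable]: "P \<in> borel_measurable borel"
    and int: "\<And>\<alpha>. mindex_order \<alpha> \<le> s \<Longrightarrow> integrable lborel (D \<alpha>)"
    and P: "\<And>\<alpha> y. mindex_order \<alpha> \<le> s \<Longrightarrow> \<bar>D \<alpha> y\<bar> \<le> P y"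
    and wp: "\<And>\<alpha> i. mindex_order \<alpha> < s \<Longrightarrow> weak_partial \<Omega> i (D \<alpha>) (D (\<alpha>(i := Suc (\<alpha> i))))"
    and "mindex_order \<alpha> + Suc n = s" "smooth \<psi>" "0 \<le> M" "\<And>z. \<bar>\<psi> z\<bar> \<le> M * indicator Q z" "0 < \<tau>" "\<tau> \<le> T"
  shows "ennreal \<bar>\<integral>y. D \<alpha> y * rescale \<psi> x \<tau> y \<partial>lborel\<bar>
    \<le> ennreal (M * (real CARD('n) * B + 1) ^ Suc n) * taylor_bound Q P T n x \<tau>"
proof -
  let ?G = "\<lambda>\<alpha> \<psi> t. ennreal \<bar>\<integral>y. D \<alpha> y * rescale \<psi> x t y \<partial>lborel\<bar>"
  let ?d = "real CARD('n)"
  have [measurable]: "Q \<in> sets borel" using Q by (simp add: borel_compact)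
  have scale: "?G \<alpha> \<psi> \<tau> \<le> ennreal M * cavg Q P x T
      + (\<integral>\<^sup>+t. indicator {\<tau>..T} t * (\<Sum>i\<in>UNIV. ?G (\<alpha>(i := Suc (\<alpha> i))) (\<lambda>z. z $ i * \<psi> z) t) \<partial>lborel)"
    if \<alpha>: "mindex_order \<alpha> < s" and \<psi>: "smooth \<psi>" "\<And>z. \<bar>\<psi> z\<bar> \<le> M * indicator Q z" and \<tau>: "0 < \<tau>" "\<tau> \<le> T"
    for \<alpha> \<psi> M \<tau>
  proof -
    let ?g = "\<lambda>t. \<integral>y. D \<alpha> y * rescale \<psi> x t y \<partial>lborel"
    have Q0: "\<psi> z = 0" if "z \<notin> Q" for z using \<psi>(2)[of z] that by simp
    have "?G \<alpha> \<psi> \<tau> \<le> ennreal (\<bar>?g T\<bar> + \<bar>?g T - ?g \<tau>\<bar>)"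
      by (rule ennreal_leI) linarith
    also have "\<dots> = ?G \<alpha> \<psi> T + ennreal \<bar>?g T - ?g \<tau>\<bar>" by (simp add: ennreal_plus)
    also have "\<dots> \<le> ennreal M * cavg Q P x T
      + (\<integral>\<^sup>+t. indicator {\<tau>..T} t * (\<Sum>i\<in>UNIV. ?G (\<alpha>(i := Suc (\<alpha> i))) (\<lambda>z. z $ i * \<psi> z) t) \<partial>lborel)"
      using \<tau> \<alpha> \<psi> wp int P
      by (intro add_mono norm_rescale_integral_le rescale_integral_difference_le[OF \<psi>(1) Q Q0 \<tau>, where \<Omega> = \<Omega>] sub) auto
    finally show ?thesis .
  qed
  have coord: "smooth (\<lambda>z. z $ i * \<psi> z)" "\<bar>z $ i * \<psi> z\<bar> \<le> (M * B) * indicator Q z"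
    if "smooth \<psi>" "\<And>z. \<bar>\<psi> z\<bar> \<le> M * indicator Q z" "0 \<le> M" for \<psi> M i z
  proof -
    show "smooth (\<lambda>z. z $ i * \<psi> z)" using that by (intro smooth.intros)
    show "\<bar>z $ i * \<psi> z\<bar> \<le> (M * B) * indicator Q z"
    proof (cases "z \<in> Q")
      case True
      then have "\<bar>z $ i\<bar> * \<bar>\<psi> z\<bar> \<le> B * M"
        using B[OF True, of i] that(2)[of z] B0 by (intro mult_mono) auto
      with True show ?thesis by (simp add: abs_mult mult.commute)
    next
      case False
      then show ?thesis using that(2)[of z] by simp
    qed
  qed
  have tb: "cavg Q P x T \<le> taylor_bound Q P T n x \<tau>" for n \<tau>
    unfolding taylor_bound_def by simp
  show ?thesis
    using assms(10-)
  proof (induction n arbitrary: \<alpha> \<psi> M \<tau>)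
    case 0
    note asm = this
    \<comment> \<open>One order is missing, so the next derivatives have order s and their averages
      are bounded directly by those of P.\<close>
    have step: "?G (\<alpha>(i := Suc (\<alpha> i))) (\<lambda>z. z $ i * \<psi> z) t \<le> ennreal (M * B) * cavg Q P x t"
      if "t \<in> {\<tau>..T}" for i t
      using that asm by (intro norm_rescale_integral_le coord P) (auto simp: mindex_order_Suc)
    have "?G \<alpha> \<psi> \<tau> \<le> ennreal M * cavg Q P x T
      + (\<integral>\<^sup>+t. indicator {\<tau>..T} t * (\<Sum>i\<in>UNIV. ?G (\<alpha>(i := Suc (\<alpha> i))) (\<lambda>z. z $ i * \<psi> z) t) \<partial>lborel)"
      using asm by (intro scale) auto
    also have "\<dots> \<le> ennreal M * cavg Q P x T
      + (\<integral>\<^sup>+t. ennreal (?d * (M * B)) * (ennreal (indicator {\<tau>..T} t * t ^ 0) * cavg Q P x t) \<partial>lborel)"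
    proof (intro add_mono order_refl nn_integral_mono)
      fix t
      show "indicator {\<tau>..T} t * (\<Sum>i\<in>UNIV. ?G (\<alpha>(i := Suc (\<alpha> i))) (\<lambda>z. z $ i * \<psi> z) t)
        \<le> ennreal (?d * (M * B)) * (ennreal (indicator {\<tau>..T} t * t ^ 0) * cavg Q P x t)"
      proof (cases "t \<in> {\<tau>..T}")
        case True
        have "(\<Sum>i\<in>UNIV. ?G (\<alpha>(i := Suc (\<alpha> i))) (\<lambda>z. z $ i * \<psi> z) t)
          \<le> (\<Sum>i\<in>(UNIV :: 'n set). ennreal (M * B) * cavg Q P x t)"
          by (intro sum_mono step True)
        also have "\<dots> = ennreal (?d * (M * B)) * cavg Q P x t"
          by (simp add: ennreal_mult' mult.assoc ennreal_of_nat_eq_real_of_nat)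
        finally show ?thesis using True by simp
      qed simp
    qed
    also have "\<dots> = ennreal M * cavg Q P x T + ennreal (?d * (M * B)) *
      (\<integral>\<^sup>+t. ennreal (indicator {\<tau>..T} t * t ^ 0) * cavg Q P x t \<partial>lborel)"
      by (subst nn_integral_cmult) simp_all
    also have "\<dots> \<le> ennreal (M * (?d * B + 1)) * cavg Q P x T + ennreal (M * (?d * B + 1)) *
      (\<integral>\<^sup>+t. ennreal (indicator {\<tau>..T} t * t ^ 0) * cavg Q P x t \<partial>lborel)"
      using \<open>0 \<le> M\<close> B0 by (intro add_mono mult_right_mono ennreal_leI) (auto simp: algebra_simps)
    finally show ?case by (simp add: taylor_bound_def distrib_left)
  next
    case (Suc n)
    note asm = this
    let ?K = "?d * B + 1"
    have K: "?K \<ge> 1" using B0 by simp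
    have step: "?G (\<alpha>(i := Suc (\<alpha> i))) (\<lambda>z. z $ i * \<psi> z) t \<le> ennreal (M * B * ?K ^ Suc n) * taylor_bound Q P T n x t"
      if "t \<in> {\<tau>..T}" for i t
    proof (rule asm(1))
      show "mindex_order (\<alpha>(i := Suc (\<alpha> i))) + Suc n = s" using asm(2) by (simp only: mindex_order_Suc)
    qed (use that asm(2-) B0 coord in auto)
    have "?G \<alpha> \<psi> \<tau> \<le> ennreal M * cavg Q P x T
      + (\<integral>\<^sup>+t. indicator {\<tau>..T} t * (\<Sum>i\<in>UNIV. ?G (\<alpha>(i := Suc (\<alpha> i))) (\<lambda>z. z $ i * \<psi> z) t) \<partial>lborel)"
      using asm(2-) by (intro scale) auto
    also have "\<dots> \<le> ennreal M * cavg Q P x T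
      + (\<integral>\<^sup>+t. ennreal (?d * (M * B * ?K ^ Suc n)) * (indicator {\<tau>..T} t * taylor_bound Q P T n x t) \<partial>lborel)"
    proof (intro add_mono order_refl nn_integral_mono)
      fix t
      show "indicator {\<tau>..T} t * (\<Sum>i\<in>UNIV. ?G (\<alpha>(i := Suc (\<alpha> i))) (\<lambda>z. z $ i * \<psi> z) t)
        \<le> ennreal (?d * (M * B * ?K ^ Suc n)) * (indicator {\<tau>..T} t * taylor_bound Q P T n x t)"
      proof (cases "t \<in> {\<tau>..T}")
        case True
        have "(\<Sum>i\<in>UNIV. ?G (\<alpha>(i := Suc (\<alpha> i))) (\<lambda>z. z $ i * \<psi> z) t)
          \<le> (\<Sum>i\<in>(UNIV :: 'n set). ennreal (M * B * ?K ^ Suc n) * taylor_bound Q P T n x t)"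
          by (intro sum_mono step True)
        also have "\<dots> = ennreal (?d * (M * B * ?K ^ Suc n)) * taylor_bound Q P T n x t"
          by (simp add: ennreal_mult' mult.assoc ennreal_of_nat_eq_real_of_nat)
        finally show ?thesis using True by simp
      qed simp
    qed
    also have "\<dots> = ennreal M * cavg Q P x T + ennreal (?d * (M * B * ?K ^ Suc n)) *
      (\<integral>\<^sup>+t. indicator {\<tau>..T} t * taylor_bound Q P T n x t \<partial>lborel)"
      unfolding taylor_bound_def atLeastAtMost_iff indicator_def by (subst nn_integral_cmult) simp_all
    also have "\<dots> \<le> ennreal M * taylor_bound Q P T (Suc n) x \<tau>
      + ennreal (?d * (M * B * ?K ^ Suc n)) * taylor_bound Q P T (Suc n) x \<tau>"
      using asm(2-) T by (intro add_mono mult_left_mono tb nn_integral_taylor_bound_le) auto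
    also have "\<dots> = ennreal (M + ?d * (M * B * ?K ^ Suc n)) * taylor_bound Q P T (Suc n) x \<tau>"
      using \<open>0 \<le> M\<close> B0 K by (simp add: ennreal_plus distrib_right)
    also have "\<dots> \<le> ennreal (M * ?K ^ Suc (Suc n)) * taylor_bound Q P T (Suc n) x \<tau>"
    proof (intro mult_right_mono ennreal_leI)
      \<comment> \<open>With K = d B + 1, the boundary contribution M is absorbed as M K^(n+1), and
        the two coefficients 1 and d B then add up to one more factor K.\<close>
      have "1 \<le> ?K ^ Suc n" by (rule one_le_power[OF K])
      then have "M * 1 \<le> M * ?K ^ Suc n" using \<open>0 \<le> M\<close> by (rule mult_left_mono)
      then show "M + ?d * (M * B * ?K ^ Suc n) \<le> M * ?K ^ Suc (Suc n)"
        by (simp add: algebra_simps)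
    qed simp
    finally show ?case .
  qed
qed

text \<open>Lebesgue differentiation is not needed: integrated over a box, the averaging moves to the indicator
  of the box, where dominated convergence applies.\<close>

lemma AE_le_if_rescale_integral_le:
  fixes u \<psi> :: "real^'n::finite \<Rightarrow> real" and R :: "real^'n \<Rightarrow> ennreal"
  assumes u: "integrable lborel u" and \<psi>: "integrable lborel \<psi>" "(\<integral>z. \<psi> z \<partial>lborel) = 1"
    and T: "T > 0" and N: "open N" and [measurable]: "R \<in> borel_measurable borel"
    and R: "(\<integral>\<^sup>+x. R x \<partial>lborel) < \<infinity>"
    and le: "\<And>x \<tau>. x \<in> N \<Longrightarrow> 0 < \<tau> \<Longrightarrow> \<tau> \<le> T \<Longrightarrow> ennreal \<bar>\<integral>y. u y * rescale \<psi> x \<tau> y \<partial>lborel\<bar> \<le> R x"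
  shows "AE x in lborel. x \<in> N \<longrightarrow> ennreal \<bar>u x\<bar> \<le> R x"
proof -
  have [measurable]: "u \<in> borel_measurable borel" "\<psi> \<in> borel_measurable borel" using u \<psi> by auto
  define R' where "R' x = enn2real (R x)" for x
  have [measurable]: "R' \<in> borel_measurable borel" unfolding R'_def by measurable
  have fin: "AE x in lborel. R x = ennreal (R' x)"
    using nn_integral_PInf_AE[of R lborel] R by (auto simp: R'_def elim!: eventually_mono simp: less_top)
  have R'int: "integrable lborel R'"
  proof (rule integrableI_nonneg)
    have "(\<integral>\<^sup>+x. ennreal (R' x) \<partial>lborel) = (\<integral>\<^sup>+x. R x \<partial>lborel)"
      by (rule nn_integral_cong_AE) (use fin in \<open>auto elim!: eventually_mono\<close>)
    with R show "(\<integral>\<^sup>+x. ennreal (R' x) \<partial>lborel) < \<infinity>" by simp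
  qed (auto simp: R'_def)
  have box_le: "\<bar>\<integral>x. indicator (cbox a b) x * u x \<partial>lborel\<bar> \<le> (\<integral>x. indicator (cbox a b) x * R' x \<partial>lborel)"
    if ab: "cbox a b \<subseteq> N" for a b
  proof -
    define t where "t n = T / real (Suc n)" for n
    have t: "0 < t n" "t n \<le> T" for n
      using T by (auto simp: t_def field_simps)
    have t0: "t \<longlonglongrightarrow> 0"
      using tendsto_mult[OF tendsto_const[of T] LIMSEQ_inverse_real_of_nat]
      by (simp add: t_def[abs_def] divide_inverse)
    define \<Psi> where "\<Psi> = (\<integral>z. \<bar>\<psi> z\<bar> \<partial>lborel)"
    define k where "k n y = (\<integral>z. indicator (cbox a b) (y - t n *\<^sub>R z) * \<psi> z \<partial>lborel)" for n y
    have [measurable]: "k n \<in> borel_measurable borel" for n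
      unfolding k_def[abs_def] by measurable
    have k_le: "\<bar>k n y\<bar> \<le> \<Psi>" for n y
    proof -
      have "\<bar>k n y\<bar> \<le> (\<integral>z. norm (indicator (cbox a b) (y - t n *\<^sub>R z) * \<psi> z) \<partial>lborel)"
        unfolding k_def real_norm_def[symmetric] by (rule integral_norm_bound)
      also have "\<dots> \<le> \<Psi>"
        unfolding \<Psi>_def
        by (rule integral_mono')(use \<psi> in \<open>auto simp: indicator_def\<close>)
      finally show ?thesis .
    qed
    \<comment> \<open>At a boundary point the indicator of the box jumps and the limit may be a
      different number; the boundary is a null set.\<close>
    have k_lim: "(\<lambda>n. k n y) \<longlonglongrightarrow> indicator (cbox a b) y" if y: "y \<notin> cbox a b - box a b" for y
    proof -
      have "(\<lambda>n. k n y) \<longlonglongrightarrow> (\<integral>z. indicator (cbox a b) y * \<psi> z \<partial>lborel)"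
        unfolding k_def
      proof (rule integral_dominated_convergence[where w = "\<lambda>z. \<bar>\<psi> z\<bar>"])
        show "AE z in lborel. (\<lambda>n. indicator (cbox a b) (y - t n *\<^sub>R z) * \<psi> z) \<longlonglongrightarrow> indicator (cbox a b) y * \<psi> z"
        proof (rule AE_I2)
          fix z
          have lim: "(\<lambda>n. y - t n *\<^sub>R z) \<longlonglongrightarrow> y"
            using tendsto_diff[OF tendsto_const[of y] tendsto_scaleR[OF t0 tendsto_const[of z]]] by simp
          have "\<forall>\<^sub>F n in sequentially. indicator (cbox a b) (y - t n *\<^sub>R z) = (indicator (cbox a b) y :: real)"
          proof (cases "y \<in> box a b")
            case True
            have "\<forall>\<^sub>F n in sequentially. y - t n *\<^sub>R z \<in> box a b"
              by (rule topological_tendstoD[OF lim open_box True])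
            then show ?thesis
              by eventually_elim (use True box_subset_cbox[of a b] in \<open>auto simp: indicator_def\<close>)
          next
            case False
            with y have "y \<in> - cbox a b" by auto
            then have "\<forall>\<^sub>F n in sequentially. y - t n *\<^sub>R z \<in> - cbox a b"
              by (intro topological_tendstoD[OF lim]) auto
            then show ?thesis
              by eventually_elim (use \<open>y \<in> - cbox a b\<close> in \<open>auto simp: indicator_def\<close>)
          qed
          then have "\<forall>\<^sub>F n in sequentially. indicator (cbox a b) y * \<psi> z = indicator (cbox a b) (y - t n *\<^sub>R z) * \<psi> z"
            by (rule eventually_mono) simp
          then show "(\<lambda>n. indicator (cbox a b) (y - t n *\<^sub>R z) * \<psi> z) \<longlonglongrightarrow> indicator (cbox a b) y * \<psi> z"
            by (rule Lim_transform_eventually[OF tendsto_const])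
        qed
        show "AE z in lborel. norm (indicator (cbox a b) (y - t n *\<^sub>R z) * \<psi> z) \<le> \<bar>\<psi> z\<bar>" for n
          by (auto simp: indicator_def)
      qed (use \<psi> in auto)
      then show ?thesis using \<psi> by simp
    qed
    have bdry: "AE y in lborel. y \<notin> cbox a b - box a b"
    proof -
      have "AE y in lebesgue. y \<notin> cbox a b - box a b"
        by (rule AE_not_in) (simp only: negligible_frontier_interval flip: negligible_iff_null_sets)
      then show ?thesis by (simp add: AE_completion_iff)
    qed
    have lim: "(\<lambda>n. \<integral>y. u y * k n y \<partial>lborel) \<longlonglongrightarrow> (\<integral>y. u y * indicator (cbox a b) y \<partial>lborel)"
    proof (rule integral_dominated_convergence[where w = "\<lambda>y. \<bar>u y\<bar> * \<Psi>"])
      show "AE y in lborel. (\<lambda>n. u y * k n y) \<longlonglongrightarrow> u y * indicator (cbox a b) y"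
        using bdry by eventually_elim (intro tendsto_mult tendsto_const k_lim)
      show "AE y in lborel. norm (u y * k n y) \<le> \<bar>u y\<bar> * \<Psi>" for n
        using k_le[of n] by (auto simp: abs_mult intro!: AE_I2 mult_left_mono)
    qed (use u in auto)
    have "\<bar>\<integral>y. u y * k n y \<partial>lborel\<bar> \<le> (\<integral>x. indicator (cbox a b) x * R' x \<partial>lborel)" for n
    proof -
      let ?H = "\<lambda>x y. indicator (cbox a b) x * (u y * rescale \<psi> x (t n) y)"
      have Hint: "integrable (lborel \<Otimes>\<^sub>M lborel) (\<lambda>(x, y). ?H x y)"
      proof (rule integrableI_bounded)
        have "(\<integral>\<^sup>+ p. ennreal (norm (case p of (x, y) \<Rightarrow> ?H x y)) \<partial>(lborel \<Otimes>\<^sub>M lborel))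
          = (\<integral>\<^sup>+y. \<integral>\<^sup>+x. ennreal \<bar>?H x y\<bar> \<partial>lborel \<partial>lborel)"
          by (subst lborel_pair.nn_integral_snd[symmetric]) simp_all
        also have "\<dots> \<le> (\<integral>\<^sup>+y. \<integral>\<^sup>+x. ennreal \<bar>u y\<bar> * ennreal (rescale (\<lambda>z. \<bar>\<psi> z\<bar>) x (t n) y) \<partial>lborel \<partial>lborel)"
          using t(1)[of n] by (intro nn_integral_mono)
            (auto simp: indicator_def abs_mult rescale_def simp flip: ennreal_mult'')
        also have "\<dots> = (\<integral>\<^sup>+y. ennreal \<bar>u y\<bar> \<partial>lborel) * (\<integral>\<^sup>+z. ennreal \<bar>\<psi> z\<bar> \<partial>lborel)"
          by (simp add: nn_integral_cmult nn_integral_rescale_snd t nn_integral_multc)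
        also have "\<dots> < \<infinity>"
          using u \<psi> by (simp add: integrable_iff_bounded ennreal_mult_less_top)
        finally show "(\<integral>\<^sup>+ p. ennreal (norm (case p of (x, y) \<Rightarrow> ?H x y)) \<partial>(lborel \<Otimes>\<^sub>M lborel)) < \<infinity>" .
      qed measurable
      have "(\<integral>y. u y * k n y \<partial>lborel) = (\<integral>y. \<integral>x. ?H x y \<partial>lborel \<partial>lborel)"
      proof (rule Bochner_Integration.integral_cong[OF refl])
        fix y
        have "k n y = (\<integral>x. indicator (cbox a b) x * rescale \<psi> x (t n) y \<partial>lborel)"
          unfolding k_def by (rule integral_rescale_snd[symmetric]) (use t in auto)
        then show "u y * k n y = (\<integral>x. ?H x y \<partial>lborel)"
          by (simp only: mult.left_commute[of _ "u y"] integral_mult_right_zero)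
      qed
      also have "\<dots> = (\<integral>x. \<integral>y. ?H x y \<partial>lborel \<partial>lborel)"
        by (rule lborel_pair.Fubini_integral[OF Hint])
      finally have "\<bar>\<integral>y. u y * k n y \<partial>lborel\<bar> \<le> (\<integral>x. norm (\<integral>y. ?H x y \<partial>lborel) \<partial>lborel)"
        using integral_norm_bound[of lborel "\<lambda>x. \<integral>y. ?H x y \<partial>lborel"] by simp
      also have "\<dots> \<le> (\<integral>x. indicator (cbox a b) x * R' x \<partial>lborel)"
      proof (rule integral_mono_AE)
        show "integrable lborel (\<lambda>x. norm (\<integral>y. ?H x y \<partial>lborel))"
          by (intro integrable_norm lborel_pair.integrable_fst[OF Hint])
        show "integrable lborel (\<lambda>x. indicator (cbox a b) x * R' x)"
          using integrable_mult_indicator[of "cbox a b" lborel R'] R'int by simp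
        show "AE x in lborel. norm (\<integral>y. ?H x y \<partial>lborel) \<le> indicator (cbox a b) x * R' x"
          using fin
        proof eventually_elim
          case (elim x)
          show ?case
          proof (cases "x \<in> cbox a b")
            case True
            then have "ennreal \<bar>\<integral>y. u y * rescale \<psi> x (t n) y \<partial>lborel\<bar> \<le> ennreal (R' x)"
              using le[of x "t n"] ab t elim by auto
            then show ?thesis using True by (simp add: R'_def)
          qed simp
        qed
      qed
      finally show ?thesis .
    qed
    from tendsto_le[OF _ tendsto_const tendsto_rabs[OF lim]] this
    have "\<bar>\<integral>y. u y * indicator (cbox a b) y \<partial>lborel\<bar> \<le> (\<integral>x. indicator (cbox a b) x * R' x \<partial>lborel)"
      by (simp add: always_eventually)
    then show ?thesis by (simp add: mult.commute)
  qed
  have ind: "integrable lborel (\<lambda>x. indicator (cbox a b) x * f x)" if "integrable lborel f" for a b and f :: "real^'n \<Rightarrow> real"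
    using integrable_mult_indicator[of "cbox a b" lborel f] that by simp
  \<comment> \<open>The two signs c turn the box inequality for |u| into the sign criterion for R' +
    u and R' - u.\<close>
  have nonneg: "AE x in lborel. x \<in> N \<longrightarrow> 0 \<le> R' x + c * u x" if c: "\<bar>c\<bar> = 1" for c :: real
  proof -
    have "AE x in lebesgue. x \<in> N \<longrightarrow> 0 \<le> R' x + c * u x"
    proof (rule AE_nonneg_if_cbox_integrals_nonneg[OF _ N])
      show "integrable lebesgue (\<lambda>x. R' x + c * u x)"
        by (rule integrable_completion[THEN iffD2]) (use R'int u in auto)
      fix a b assume ab: "cbox a b \<subseteq> N"
      have "(\<integral>x. indicator (cbox a b) x * (R' x + c * u x) \<partial>lebesgue)
        = (\<integral>x. indicator (cbox a b) x * (R' x + c * u x) \<partial>lborel)"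
        by (rule integral_completion) simp
      also have "\<dots> = (\<integral>x. indicator (cbox a b) x * R' x + c * (indicator (cbox a b) x * u x) \<partial>lborel)"
        by (simp add: algebra_simps)
      also have "\<dots> = (\<integral>x. indicator (cbox a b) x * R' x \<partial>lborel) + c * (\<integral>x. indicator (cbox a b) x * u x \<partial>lborel)"
        using ind[OF R'int] ind[OF u] by (subst Bochner_Integration.integral_add) auto
      also have "\<dots> \<ge> 0"
        using box_le[OF ab] c by (auto simp: abs_if split: if_splits)
      finally show "0 \<le> (\<integral>x. indicator (cbox a b) x * (R' x + c * u x) \<partial>lebesgue)" .
    qed
    then show ?thesis by (simp add: AE_completion_iff)
  qed
  have "AE x in lborel. x \<in> N \<longrightarrow> 0 \<le> R' x + u x" "AE x in lborel. x \<in> N \<longrightarrow> 0 \<le> R' x - u x"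
    using nonneg[of 1] nonneg[of "-1"] by simp_all
  with fin show ?thesis
  proof eventually_elim
    case (elim x)
    then show ?case by (auto intro!: ennreal_leI)
  qed
qed

lemma taylor_bound_measurable [measurable]:
  assumes [measurable]: "Q \<in> sets borel" "P \<in> borel_measurable borel"
  shows "(\<lambda>x. taylor_bound Q P T n x \<tau>) \<in> borel_measurable borel"
  unfolding taylor_bound_def by measurable

text \<open>Only finiteness matters: the almost-everywhere comparison asks for a right-hand side of
  finite integral.\<close>

lemma nn_integral_taylor_bound:
  fixes P :: "real^'n::finite \<Rightarrow> real"
  assumes [measurable]: "Q \<in> sets borel" and P: "integrable lborel P" and T: "0 < T" "T \<le> 1"
    and Q: "emeasure lborel Q < \<infinity>"
  shows "(\<integral>\<^sup>+x. taylor_bound Q P T n x 0 \<partial>lborel) < \<infinity>"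
proof -
  have [measurable]: "P \<in> borel_measurable borel" using P by auto
  let ?c = "emeasure lborel Q * (\<integral>\<^sup>+y. ennreal (P y) \<partial>lborel)"
  have le: "(\<integral>\<^sup>+x. cavg Q P x t \<partial>lborel) \<le> ?c" if "t \<ge> 0" for t
  proof (cases "t = 0")
    case True
    \<comment> \<open>At t = 0 the kernel divides by 0 to the power d, which is 0, so the average is
      0 by the convention for division.\<close>
    then show ?thesis by (simp add: cavg_def rescale_def zero_power)
  next
    case False
    with that show ?thesis by (simp add: nn_integral_cavg)
  qed
  have c: "?c < \<infinity>"
    using P Q unfolding real_integrable_def by (simp add: ennreal_mult_less_top less_top)
  have "(\<integral>\<^sup>+x. taylor_bound Q P T n x 0 \<partial>lborel)
    = (\<integral>\<^sup>+x. cavg Q P x T \<partial>lborel) + (\<integral>\<^sup>+x. \<integral>\<^sup>+t. ennreal (indicator {0..T} t * t ^ n) * cavg Q P x t \<partial>lborel \<partial>lborel)"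
    unfolding taylor_bound_def by (rule nn_integral_add) measurable
  also have "(\<integral>\<^sup>+x. \<integral>\<^sup>+t. ennreal (indicator {0..T} t * t ^ n) * cavg Q P x t \<partial>lborel \<partial>lborel)
    = (\<integral>\<^sup>+t. \<integral>\<^sup>+x. ennreal (indicator {0..T} t * t ^ n) * cavg Q P x t \<partial>lborel \<partial>lborel)"
    by (rule lborel_pair.Fubini'[symmetric]) measurable
  also have "\<dots> \<le> (\<integral>\<^sup>+t. indicator {0..T} t * ?c \<partial>lborel)"
  proof (rule nn_integral_mono)
    fix t :: real
    show "(\<integral>\<^sup>+x. ennreal (indicator {0..T} t * t ^ n) * cavg Q P x t \<partial>lborel) \<le> indicator {0..T} t * ?c"
    proof (cases "t \<in> {0..T}")
      case True
      have "(\<integral>\<^sup>+x. ennreal (indicator {0..T} t * t ^ n) * cavg Q P x t \<partial>lborel) = ennreal (t ^ n) * (\<integral>\<^sup>+x. cavg Q P x t \<partial>lborel)"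
        using True by (simp add: nn_integral_cmult)
      also have "\<dots> \<le> 1 * ?c"
        using True T by (intro mult_mono le) (auto simp: power_le_one ennreal_le_1)
      finally show ?thesis using True by simp
    qed simp
  qed
  also have "\<dots> = ennreal T * ?c"
    using T by (simp add: nn_integral_multc)
  finally have *: "(\<integral>\<^sup>+x. taylor_bound Q P T n x 0 \<partial>lborel) \<le> (\<integral>\<^sup>+x. cavg Q P x T \<partial>lborel) + ennreal T * ?c"
    by simp
  have "(\<integral>\<^sup>+x. cavg Q P x T \<partial>lborel) < \<infinity>" using le[of T] T c by (auto intro: le_less_trans)
  moreover have "ennreal T * ?c < \<infinity>" using c by (simp add: ennreal_mult_less_top)
  ultimately show ?thesis using * by (auto intro: le_less_trans)
qed

lemma taylor_bound_antimono:
  assumes "0 \<le> \<tau>" "\<tau> \<le> \<tau>'"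
  shows "taylor_bound Q P T n x \<tau>' \<le> taylor_bound Q P T n x \<tau>"
proof -
  have "indicator {\<tau>'..T} t * t ^ n \<le> indicator {\<tau>..T} t * t ^ n" for t
    using assms by (cases "\<tau> \<le> t"; cases "\<tau>' \<le> t"; cases "t \<le> T") simp_all
  then show ?thesis
    unfolding taylor_bound_def
    by (intro add_left_mono nn_integral_mono mult_right_mono[OF ennreal_leI]) auto
qed

lemma emeasure_box_pos:
  fixes lo hi :: "'a::euclidean_space"
  assumes "box lo hi \<noteq> {}" shows "0 < emeasure lborel (box lo hi)"
proof -
  have lt: "lo \<bullet> b < hi \<bullet> b" if "b \<in> Basis" for b
    using assms that by (simp add: box_ne_empty)
  then have "0 < (\<Prod>b\<in>Basis. (hi - lo) \<bullet> b)"
    by (intro prod_pos) (auto simp: inner_diff_left)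
  then show ?thesis
    using lt by (simp add: emeasure_lborel_box_eq less_imp_le)
qed

lemma normalized_box_bump:
  fixes lo hi :: "real^'n::finite"
  assumes "box lo hi \<noteq> {}"
  obtains \<psi> M where "smooth \<psi>" "integrable lborel \<psi>" "(\<integral>z. \<psi> z \<partial>lborel) = 1" "0 \<le> M"
    "\<And>z. \<bar>\<psi> z\<bar> \<le> M * indicator (cbox lo hi) z"
proof -
  let ?\<phi> = "box_bump lo hi 1"
  let ?I = "\<integral>z. ?\<phi> z \<partial>lborel"
  have le: "?\<phi> z \<le> indicator (cbox lo hi) z" for z
    using box_bump_eq_0[of z lo hi 1] box_bump_bounds[of lo hi 1 z] box_subset_cbox[of lo hi]
    by (cases "z \<in> box lo hi") (auto simp: indicator_def)
  have int: "integrable lborel ?\<phi>"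
  proof (rule Bochner_Integration.integrable_bound[where f = "indicator (cbox lo hi) :: real^'n \<Rightarrow> real"])
    show "integrable lborel (indicator (cbox lo hi) :: real^'n \<Rightarrow> real)"
      using emeasure_lborel_cbox_finite[of lo hi] by (simp add: integrable_indicator_iff)
    show "AE z in lborel. norm (?\<phi> z) \<le> norm (indicator (cbox lo hi) z :: real)"
      using le box_bump_bounds(1)[of lo hi 1] by auto
  qed (simp add: smooth_borel smooth_box_bump)
  have "?I > 0"
  proof -
    have "?I \<noteq> 0"
    proof
      assume "?I = 0"
      then have "AE z in lborel. ?\<phi> z = 0"
        using integral_nonneg_eq_0_iff_AE[OF int] box_bump_bounds(1)[of lo hi 1] by auto
      then have "AE z in lborel. z \<notin> box lo hi"
        by (rule eventually_mono) (use box_bump_pos[of _ lo hi 1] in force)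
      then have "emeasure lborel (box lo hi) = 0"
        by (subst (asm) AE_iff_measurable[OF _ refl]) auto
      with emeasure_box_pos[OF assms] show False by simp
    qed
    moreover have "?I \<ge> 0" using box_bump_bounds(1) by (intro Bochner_Integration.integral_nonneg) auto
    ultimately show ?thesis by simp
  qed
  show ?thesis
  proof (rule that[of "\<lambda>z. (1 / ?I) * ?\<phi> z" "1 / ?I"])
    show "smooth (\<lambda>z. (1 / ?I) * ?\<phi> z)" by (intro smooth.intros smooth_box_bump)
    show "\<bar>(1 / ?I) * ?\<phi> z\<bar> \<le> 1 / ?I * indicator (cbox lo hi) z" for z
      using le[of z] box_bump_bounds(1)[of lo hi 1 z] \<open>?I > 0\<close>
      by (auto simp: abs_mult divide_right_mono)
  qed (use int \<open>?I > 0\<close> in auto)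
qed

text \<open>The bound at scale \<tau> grows as \<tau> decreases, so its value at 0 dominates all
  scales at once, which is the form the comparison with |D \<alpha>| asks for. C is fixed before the
  functions, since it has to serve the whole Sobolev space.\<close>

lemma AE_le_taylor_bound:
  fixes lo hi :: "real^'n::finite"
  assumes Q: "box lo hi \<noteq> {}" and N: "open N" and T: "0 < T" "T \<le> 1"
    and sub: "\<And>x t z. x \<in> N \<Longrightarrow> x \<in> \<Omega> \<Longrightarrow> 0 < t \<Longrightarrow> t \<le> T \<Longrightarrow> z \<in> cbox lo hi \<Longrightarrow> x + t *\<^sub>R z \<in> \<Omega>" and \<Omega>: "open \<Omega>"
  shows "\<exists>C\<ge>0. \<forall>s (D :: 'n mindex \<Rightarrow> real^'n \<Rightarrow> real) P \<alpha> n. mindex_order \<alpha> + Suc n = s \<longrightarrow> s \<le> smax \<longrightarrow> integrable lborel P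
      \<longrightarrow> (\<forall>\<alpha>. mindex_order \<alpha> \<le> s \<longrightarrow> integrable lborel (D \<alpha>) \<and> (\<forall>y. \<bar>D \<alpha> y\<bar> \<le> P y))
      \<longrightarrow> (\<forall>\<alpha> i. mindex_order \<alpha> < s \<longrightarrow> weak_partial \<Omega> i (D \<alpha>) (D (\<alpha>(i := Suc (\<alpha> i)))))
      \<longrightarrow> (AE x in lborel. x \<in> N \<inter> \<Omega> \<longrightarrow> ennreal \<bar>D \<alpha> x\<bar> \<le> ennreal C * taylor_bound (cbox lo hi) P T n x 0)"
proof -
  obtain \<psi> M where \<psi>: "smooth \<psi>" "integrable lborel \<psi>" "(\<integral>z. \<psi> z \<partial>lborel) = 1" "0 \<le> M"
    "\<And>z. \<bar>\<psi> z\<bar> \<le> M * indicator (cbox lo hi) z"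
    using normalized_box_bump[OF Q] by blast
  obtain B where B: "0 < B" "\<And>z. z \<in> cbox lo hi \<Longrightarrow> norm z \<le> B"
    using bounded_cbox[of lo hi] by (auto simp: bounded_pos)
  have B': "\<bar>z $ i\<bar> \<le> B" if "z \<in> cbox lo hi" for z i
    using component_le_norm_cart[of z i] B(2)[OF that] by linarith
  \<comment> \<open>The base is at least 1, so the exponent \<open>smax\<close> covers every
    \<open>Suc n\<close> that occurs.\<close>
  let ?C = "M * (real CARD('n) * B + 1) ^ smax"
  show ?thesis
  proof (intro exI[of _ ?C] conjI allI impI)
    show "0 \<le> ?C" using \<psi>(4) B(1) by simp
    fix s P n and \<alpha> :: "'n mindex" and D :: "'n mindex \<Rightarrow> real^'n \<Rightarrow> real"
    assume s: "mindex_order \<alpha> + Suc n = s" "s \<le> smax" and P: "integrable lborel P"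
      and D: "\<forall>\<alpha>. mindex_order \<alpha> \<le> s \<longrightarrow> integrable lborel (D \<alpha>) \<and> (\<forall>y. \<bar>D \<alpha> y\<bar> \<le> P y)"
      and wp: "\<forall>\<alpha> i. mindex_order \<alpha> < s \<longrightarrow> weak_partial \<Omega> i (D \<alpha>) (D (\<alpha>(i := Suc (\<alpha> i))))"
    have [measurable]: "P \<in> borel_measurable borel" using P by auto
    show "AE x in lborel. x \<in> N \<inter> \<Omega> \<longrightarrow> ennreal \<bar>D \<alpha> x\<bar> \<le> ennreal ?C * taylor_bound (cbox lo hi) P T n x 0"
    proof (rule AE_le_if_rescale_integral_le[OF _ \<psi>(2,3) T(1)])
      show "integrable lborel (D \<alpha>)" using D s by auto
      show "open (N \<inter> \<Omega>)" using N \<Omega> by auto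
      have "(\<integral>\<^sup>+x. taylor_bound (cbox lo hi) P T n x 0 \<partial>lborel) < \<infinity>"
        by (rule nn_integral_taylor_bound[OF _ P T emeasure_lborel_cbox_finite]) simp
      then show "(\<integral>\<^sup>+x. ennreal ?C * taylor_bound (cbox lo hi) P T n x 0 \<partial>lborel) < \<infinity>"
        by (simp add: nn_integral_cmult ennreal_mult_less_top)
      fix x \<tau> assume x: "x \<in> N \<inter> \<Omega>" and \<tau>: "0 < \<tau>" "\<tau> \<le> T"
      have "ennreal \<bar>\<integral>y. D \<alpha> y * rescale \<psi> x \<tau> y \<partial>lborel\<bar>
        \<le> ennreal (M * (real CARD('n) * B + 1) ^ Suc n) * taylor_bound (cbox lo hi) P T n x \<tau>"
      proof (rule rescale_integral_le_taylor_bound[where \<Omega> = \<Omega> and s = s and D = D])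
        show "weak_partial \<Omega> i (D \<alpha>) (D (\<alpha>(i := Suc (\<alpha> i))))" if "mindex_order \<alpha> < s" for \<alpha> i
          using wp that by blast
      qed (use B B' T D s \<psi> \<tau> x sub in auto)
      also have "\<dots> \<le> ennreal ?C * taylor_bound (cbox lo hi) P T n x 0"
        using s \<psi>(4) B(1) \<tau>
        by (intro mult_mono ennreal_leI mult_left_mono power_increasing taylor_bound_antimono) auto
      finally show "ennreal \<bar>\<integral>y. D \<alpha> y * rescale \<psi> x \<tau> y \<partial>lborel\<bar> \<le> ennreal ?C * taylor_bound (cbox lo hi) P T n x 0" .
    qed measurable
  qed
qed

subsection \<open>Potential estimates\<close>

lemma nn_integral_powr:
  fixes e c :: real
  assumes "- 1 < e" "0 \<le> c"
  shows "(\<integral>\<^sup>+t. ennreal (indicator {0..c} t * t powr e) \<partial>lborel) = ennreal (c powr (e + 1) / (e + 1))"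
  by (rule nn_integral_has_integral_lebesgue[OF _ has_integral_powr_from_0]) (use assms in auto)

lemma nn_integral_powr_tail:
  fixes e a :: real
  assumes "e < - 1" "0 < a"
  shows "(\<integral>\<^sup>+t. ennreal (indicator {a..} t * t powr e) \<partial>lborel) = ennreal (- (a powr (e + 1)) / (e + 1))"
  by (rule nn_integral_has_integral_lebesgue[OF _ has_integral_powr_to_inf]) (use assms in auto)

lemma ennreal_le_if_square_le:
  assumes "a\<^sup>2 \<le> ennreal (r\<^sup>2)" "0 \<le> r" shows "a \<le> ennreal r"
proof (cases a)
  case (real x)
  then have "x\<^sup>2 \<le> r\<^sup>2" using assms by (simp add: ennreal_power)
  then have "x \<le> r" using assms(2) by (rule power2_le_imp_le)
  then show ?thesis using real by (simp add: ennreal_leI)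
next
  case top
  then show ?thesis using assms by (simp add: power2_eq_square ennreal_top_mult top_unique)
qed

text \<open>With the L2 norm of P normalised to at most 1, Cauchy-Schwarz yields the decay t^(-d/2).
  The comparisons with d/2 below arise from integrating this decay against a power of t.\<close>

lemma cavg_le_powr:
  fixes P :: "real^'n::finite \<Rightarrow> real"
  assumes [measurable]: "Q \<in> sets borel" "P \<in> borel_measurable borel" and t: "t > 0" and P: "\<And>y. 0 \<le> P y"
    and P2: "(\<integral>\<^sup>+y. ennreal ((P y)\<^sup>2) \<partial>lborel) \<le> 1" and q: "emeasure lborel Q = ennreal q" "0 \<le> q"
  shows "cavg Q P x t \<le> ennreal (sqrt q * t powr (- (real CARD('n) / 2)))"
proof (rule ennreal_le_if_square_le)
  have "(t powr (- (real CARD('n) / 2)))\<^sup>2 = 1 / t ^ CARD('n)"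
  proof -
    have "(t powr (- (real CARD('n) / 2)))\<^sup>2 = t powr (- real CARD('n))"
      by (simp add: power2_eq_square flip: powr_add)
    also have "\<dots> = 1 / t ^ CARD('n)"
      using t by (simp add: powr_minus_divide powr_realpow)
    finally show ?thesis .
  qed
  then have eq: "(sqrt q * t powr (- (real CARD('n) / 2)))\<^sup>2 = 1 / t ^ CARD('n) * q"
    using q by (simp add: power_mult_distrib)
  have "(cavg Q P x t)\<^sup>2 \<le> (\<integral>\<^sup>+y. ennreal ((P y)\<^sup>2) \<partial>lborel) * (ennreal (1 / t ^ CARD('n)) * emeasure lborel Q)"
    by (rule cavg_square_le) (use t P in auto)
  also have "\<dots> \<le> 1 * (ennreal (1 / t ^ CARD('n)) * emeasure lborel Q)"
    by (intro mult_right_mono P2) auto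
  finally show "(cavg Q P x t)\<^sup>2 \<le> ennreal ((sqrt q * t powr (- (real CARD('n) / 2)))\<^sup>2)"
    unfolding eq q using t q(2) by (simp flip: ennreal_mult')
qed (use q in auto)

text \<open>The integrand is at most a multiple of t^(n - d/2), which is integrable at 0 precisely
  when n + 1 > d/2.\<close>

lemma taylor_bound_bounded:
  fixes Q :: "(real^'n::finite) set"
  assumes [measurable]: "Q \<in> sets borel" and q: "emeasure lborel Q < \<infinity>" and T: "0 < T"
    and n: "real CARD('n) / 2 < real n + 1"
  shows "\<exists>K\<ge>0. \<forall>P x. P \<in> borel_measurable borel \<longrightarrow> (\<forall>y. 0 \<le> P y) \<longrightarrow> (\<integral>\<^sup>+y. ennreal ((P y)\<^sup>2) \<partial>lborel) \<le> 1
    \<longrightarrow> taylor_bound Q P T n x 0 \<le> ennreal K"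
proof -
  let ?q = "measure lborel Q" and ?h = "real CARD('n) / 2"
  have q': "emeasure lborel Q = ennreal ?q" using q by (simp add: emeasure_eq_ennreal_measure)
  let ?e = "real n - ?h"
  let ?K = "sqrt ?q * T powr (- ?h) + sqrt ?q * (T powr (?e + 1) / (?e + 1))"
  show ?thesis
  proof (intro exI[of _ ?K] conjI allI impI)
    show "0 \<le> ?K" using n by auto
    fix P :: "real^'n \<Rightarrow> real" and x
    assume [measurable]: "P \<in> borel_measurable borel" and P: "\<forall>y. 0 \<le> P y"
      and P2: "(\<integral>\<^sup>+y. ennreal ((P y)\<^sup>2) \<partial>lborel) \<le> 1"
    have le: "cavg Q P x t \<le> ennreal (sqrt ?q * t powr (- ?h))" if "t > 0" for t
      using that P P2 q' by (intro cavg_le_powr) auto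
    have "(\<integral>\<^sup>+t. ennreal (indicator {0..T} t * t ^ n) * cavg Q P x t \<partial>lborel)
      \<le> (\<integral>\<^sup>+t. ennreal (sqrt ?q) * ennreal (indicator {0..T} t * t powr ?e) \<partial>lborel)"
    proof (rule nn_integral_mono_AE)
      show "AE t in lborel. ennreal (indicator {0..T} t * t ^ n) * cavg Q P x t
        \<le> ennreal (sqrt ?q) * ennreal (indicator {0..T} t * t powr ?e)"
        using AE_lborel_singleton[of 0]
      proof eventually_elim
        case (elim t)
        show ?case
        proof (cases "t \<in> {0..T}")
          case True
          with elim have t: "t > 0" by auto
          have "ennreal (t ^ n) * cavg Q P x t \<le> ennreal (t ^ n) * ennreal (sqrt ?q * t powr (- ?h))"
            by (intro mult_left_mono le t) auto
          also have "\<dots> = ennreal (sqrt ?q) * ennreal (t powr ?e)"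
          proof -
            have "t powr ?e = t ^ n * t powr (- ?h)"
              using t by (simp add: powr_add[of t "real n" "- ?h", simplified] powr_realpow)
            then show ?thesis
              by (simp only: ennreal_mult'[symmetric] zero_le_power[OF less_imp_le[OF t]] real_sqrt_ge_zero measure_nonneg mult.left_commute)
          qed
          finally show ?thesis using True by simp
        qed simp
      qed
    qed
    also have "\<dots> = ennreal (sqrt ?q) * ennreal (T powr (?e + 1) / (?e + 1))"
      using n T by (subst nn_integral_cmult) (auto simp: nn_integral_powr)
    also have "\<dots> = ennreal (sqrt ?q * (T powr (?e + 1) / (?e + 1)))"
      by (rule ennreal_mult'[symmetric]) simp
    finally have "taylor_bound Q P T n x 0 \<le> ennreal (sqrt ?q * T powr (- ?h)) + ennreal (sqrt ?q * (T powr (?e + 1) / (?e + 1)))"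
      unfolding taylor_bound_def using le[OF T] by (rule add_mono[rotated])
    also have "\<dots> = ennreal ?K"
      using n by (intro ennreal_plus[symmetric]) auto
    finally show "taylor_bound Q P T n x 0 \<le> ennreal ?K" .
  qed
qed

section \<open>Lp bounds for potentials\<close>

text \<open>A Riesz potential of order \<sigma>, written as an integral over scales. For the unit
  ball as Q and all positive scales it is the integral of |x - y|^(\<sigma> - d) P(y) up to a
  constant; the set I permits cutting it by scale.\<close>

definition potential :: "(real^'n::finite) set \<Rightarrow> real set \<Rightarrow> real \<Rightarrow> (real^'n \<Rightarrow> real) \<Rightarrow> real^'n \<Rightarrow> ennreal" where
  "potential Q I \<sigma> P x = (\<integral>\<^sup>+t. ennreal (indicator I t * t powr (\<sigma> - 1)) * cavg Q P x t \<partial>lborel)"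

lemma potential_measurable [measurable]:
  assumes [measurable]: "Q \<in> sets borel" "I \<in> sets borel" "P \<in> borel_measurable borel"
  shows "potential Q I \<sigma> P \<in> borel_measurable borel"
  unfolding potential_def[abs_def] by measurable

lemma nn_integral_potential:
  fixes Q :: "(real^'n::finite) set"
  assumes [measurable]: "Q \<in> sets borel" "P \<in> borel_measurable borel" and "0 < \<sigma>" "0 < \<tau>"
  shows "(\<integral>\<^sup>+x. potential Q {0..\<tau>} \<sigma> P x \<partial>lborel)
    = ennreal (\<tau> powr \<sigma> / \<sigma>) * (emeasure lborel Q * (\<integral>\<^sup>+y. ennreal (P y) \<partial>lborel))"
proof -
  let ?c = "emeasure lborel Q * (\<integral>\<^sup>+y. ennreal (P y) \<partial>lborel)"
  have "(\<integral>\<^sup>+x. potential Q {0..\<tau>} \<sigma> P x \<partial>lborel)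
    = (\<integral>\<^sup>+t. \<integral>\<^sup>+x. ennreal (indicator {0..\<tau>} t * t powr (\<sigma> - 1)) * cavg Q P x t \<partial>lborel \<partial>lborel)"
    unfolding potential_def by (rule lborel_pair.Fubini'[symmetric]) measurable
  also have "\<dots> = (\<integral>\<^sup>+t. ennreal (indicator {0..\<tau>} t * t powr (\<sigma> - 1)) * ?c \<partial>lborel)"
  proof (rule nn_integral_cong_AE)
    show "AE t in lborel. (\<integral>\<^sup>+x. ennreal (indicator {0..\<tau>} t * t powr (\<sigma> - 1)) * cavg Q P x t \<partial>lborel)
       = ennreal (indicator {0..\<tau>} t * t powr (\<sigma> - 1)) * ?c"
      using AE_lborel_singleton[of 0]
    proof eventually_elim
      case (elim t)
      then show ?case by (cases "t \<in> {0..\<tau>}") (simp_all add: nn_integral_cmult nn_integral_cavg)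
    qed
  qed
  also have "\<dots> = ennreal (\<tau> powr \<sigma> / \<sigma>) * ?c"
    using assms nn_integral_powr[of "\<sigma> - 1" \<tau>] by (subst nn_integral_multc) auto
  finally show ?thesis .
qed

text \<open>Up to scale \<tau> the density is split at height h, and its low part contributes at
  most h |Q| times the integral of t^(\<sigma> - 1). Beyond \<tau> the decay t^(-d/2) is used, and
  the tail converges because \<sigma> < d/2.\<close>

lemma potential_le_near_far:
  fixes Q :: "(real^'n::finite) set"
  assumes [measurable]: "Q \<in> sets borel" "P \<in> borel_measurable borel" and P: "\<And>y. 0 \<le> P y"
    and P2: "(\<integral>\<^sup>+y. ennreal ((P y)\<^sup>2) \<partial>lborel) \<le> 1" and q: "emeasure lborel Q = ennreal q" "0 \<le> q"
    and \<sigma>: "0 < \<sigma>" "\<sigma> < real CARD('n) / 2" and \<tau>: "0 < \<tau>" and h: "0 \<le> h"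
  shows "potential Q {0..} \<sigma> P x \<le> potential Q {0..\<tau>} \<sigma> (\<lambda>y. P y * indicator {y. h < P y} y) x
    + ennreal (h * q * \<tau> powr \<sigma> / \<sigma>)
    + ennreal (sqrt q / (real CARD('n) / 2 - \<sigma>) * \<tau> powr (\<sigma> - real CARD('n) / 2))"
proof -
  let ?d2 = "real CARD('n) / 2"
  let ?P1 = "\<lambda>y. P y * indicator {y. \<not> h < P y} y" and ?P2 = "\<lambda>y. P y * indicator {y. h < P y} y"
  let ?k = "\<lambda>I t. ennreal (indicator I t * t powr (\<sigma> - 1))"
  have le: "?k {0..} t * cavg Q P x t \<le> ?k {0..\<tau>} t * cavg Q ?P2 x t + ennreal (h * q) * ?k {0..\<tau>} t
      + ennreal (sqrt q) * ennreal (indicator {\<tau>..} t * t powr (\<sigma> - 1 - ?d2))" if t0: "t \<noteq> 0" for t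
  proof -
    consider "t < 0" | "0 < t" "t \<le> \<tau>" | "0 < t" "\<tau> < t" using t0 by linarith
    then show ?thesis
    proof cases
      case 1
      then show ?thesis by simp
    next
      case 2
      have "cavg Q P x t = cavg Q (\<lambda>y. ?P2 y + ?P1 y) x t"
        by (intro arg_cong[where f = "\<lambda>f. cavg Q f x t"]) (auto simp: indicator_def)
      also have "\<dots> = cavg Q ?P2 x t + cavg Q ?P1 x t"
        by (rule cavg_add) (use P 2 in auto)
      also have "cavg Q ?P1 x t \<le> ennreal h * emeasure lborel Q"
        by (rule cavg_le_const) (use h 2 in \<open>auto simp: indicator_def\<close>)
      finally have "cavg Q P x t \<le> cavg Q ?P2 x t + ennreal (h * q)"
        using h q by (simp add: ennreal_mult')
      then have "?k {0..} t * cavg Q P x t \<le> ?k {0..} t * (cavg Q ?P2 x t + ennreal (h * q))"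
        by (rule mult_left_mono) simp
      also have "\<dots> = ?k {0..\<tau>} t * cavg Q ?P2 x t + ennreal (h * q) * ?k {0..\<tau>} t"
        using 2 by (simp add: distrib_left mult.commute)
      finally show ?thesis by (rule order_trans) simp
    next
      case 3
      have "?k {0..} t * cavg Q P x t \<le> ?k {0..} t * ennreal (sqrt q * t powr (- ?d2))"
        by (intro mult_left_mono cavg_le_powr P P2 q) (use 3 in auto)
      also have "\<dots> = ennreal (sqrt q) * ennreal (indicator {\<tau>..} t * t powr (\<sigma> - 1 - ?d2))"
      proof -
        have "t powr (\<sigma> - 1 - ?d2) = t powr (\<sigma> - 1) * t powr (- ?d2)"
          by (simp flip: powr_add)
        then show ?thesis using 3 q by (simp add: ennreal_mult mult_ac)
      qed
      finally show ?thesis by (rule order_trans) simp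
    qed
  qed
  have "potential Q {0..} \<sigma> P x \<le> (\<integral>\<^sup>+t. (?k {0..\<tau>} t * cavg Q ?P2 x t + ennreal (h * q) * ?k {0..\<tau>} t)
      + ennreal (sqrt q) * ennreal (indicator {\<tau>..} t * t powr (\<sigma> - 1 - ?d2)) \<partial>lborel)"
    unfolding potential_def
    by (rule nn_integral_mono_AE) (use AE_lborel_singleton[of 0] le in \<open>auto elim!: eventually_mono\<close>)
  also have "\<dots> = (\<integral>\<^sup>+t. ?k {0..\<tau>} t * cavg Q ?P2 x t \<partial>lborel) + (\<integral>\<^sup>+t. ennreal (h * q) * ?k {0..\<tau>} t \<partial>lborel)
      + (\<integral>\<^sup>+t. ennreal (sqrt q) * ennreal (indicator {\<tau>..} t * t powr (\<sigma> - 1 - ?d2)) \<partial>lborel)"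
    by (simp add: nn_integral_add)
  finally have *: "potential Q {0..} \<sigma> P x \<le> (\<integral>\<^sup>+t. ?k {0..\<tau>} t * cavg Q ?P2 x t \<partial>lborel)
      + (\<integral>\<^sup>+t. ennreal (h * q) * ?k {0..\<tau>} t \<partial>lborel)
      + (\<integral>\<^sup>+t. ennreal (sqrt q) * ennreal (indicator {\<tau>..} t * t powr (\<sigma> - 1 - ?d2)) \<partial>lborel)" .
  have near: "(\<integral>\<^sup>+t. ennreal (h * q) * ?k {0..\<tau>} t \<partial>lborel) = ennreal (h * q * \<tau> powr \<sigma> / \<sigma>)"
  proof -
    have I: "(\<integral>\<^sup>+t. ?k {0..\<tau>} t \<partial>lborel) = ennreal (\<tau> powr \<sigma> / \<sigma>)"
      using nn_integral_powr[of "\<sigma> - 1" \<tau>] \<sigma> \<tau> by simp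
    have "(\<integral>\<^sup>+t. ennreal (h * q) * ?k {0..\<tau>} t \<partial>lborel) = ennreal (h * q) * ennreal (\<tau> powr \<sigma> / \<sigma>)"
      unfolding I[symmetric] by (rule nn_integral_cmult) measurable
    also have "\<dots> = ennreal (h * q * (\<tau> powr \<sigma> / \<sigma>))"
      by (rule ennreal_mult'[symmetric]) (use h q in simp)
    also have "h * q * (\<tau> powr \<sigma> / \<sigma>) = h * q * \<tau> powr \<sigma> / \<sigma>" by simp
    finally show ?thesis .
  qed
  have far: "(\<integral>\<^sup>+t. ennreal (sqrt q) * ennreal (indicator {\<tau>..} t * t powr (\<sigma> - 1 - ?d2)) \<partial>lborel)
    = ennreal (sqrt q / (?d2 - \<sigma>) * \<tau> powr (\<sigma> - ?d2))"
  proof -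
    have e1: "\<sigma> - 1 - ?d2 + 1 = \<sigma> - ?d2" by simp
    have e2: "- (\<tau> powr (\<sigma> - ?d2)) / (\<sigma> - ?d2) = 1 / (?d2 - \<sigma>) * \<tau> powr (\<sigma> - ?d2)"
      using minus_divide_divide[of "\<tau> powr (\<sigma> - ?d2)" "?d2 - \<sigma>"] by simp
    have I: "(\<integral>\<^sup>+t. ennreal (indicator {\<tau>..} t * t powr (\<sigma> - 1 - ?d2)) \<partial>lborel) = ennreal (1 / (?d2 - \<sigma>) * \<tau> powr (\<sigma> - ?d2))"
      using nn_integral_powr_tail[of "\<sigma> - 1 - ?d2" \<tau>] \<sigma> \<tau> unfolding e1 e2 by auto
    have "(\<integral>\<^sup>+t. ennreal (sqrt q) * ennreal (indicator {\<tau>..} t * t powr (\<sigma> - 1 - ?d2)) \<partial>lborel)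
      = ennreal (sqrt q) * ennreal (1 / (?d2 - \<sigma>) * \<tau> powr (\<sigma> - ?d2))"
      unfolding I[symmetric] by (rule nn_integral_cmult) measurable
    also have "\<dots> = ennreal (sqrt q * (1 / (?d2 - \<sigma>) * \<tau> powr (\<sigma> - ?d2)))"
      by (rule ennreal_mult'[symmetric]) (use q in simp)
    also have "sqrt q * (1 / (?d2 - \<sigma>) * \<tau> powr (\<sigma> - ?d2)) = sqrt q / (?d2 - \<sigma>) * \<tau> powr (\<sigma> - ?d2)"
      by simp
    finally show ?thesis .
  qed
  show ?thesis using * unfolding near far by (simp only: potential_def)
qed

text \<open>A Marcinkiewicz-type argument with cuts that depend on the level \<rho>. They are chosen
  so that the far part and the low near part together stay at 3 \<rho> / 4; on {w \<ge> \<rho>} the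
  high near part is then at least \<rho> / 4, and Markov's inequality applies to it. In the integral
  over \<rho> the region h(\<rho>) < P(y) contributes a multiple of P(y), which turns the remaining
  factor P(y) into P(y)^2.\<close>

lemma potential_Lp_bound:
  fixes Q :: "(real^'n::finite) set"
  assumes [measurable]: "Q \<in> sets borel" and q: "emeasure lborel Q = ennreal q" "0 < q"
    and \<sigma>: "0 < \<sigma>" "\<sigma> < real CARD('n) / 2" and p: "p = real CARD('n) / (real CARD('n) / 2 - \<sigma>)"
  shows "\<exists>K\<ge>0. \<forall>P w. P \<in> borel_measurable borel \<longrightarrow> (\<forall>y. 0 \<le> P y) \<longrightarrow> (\<integral>\<^sup>+y. ennreal ((P y)\<^sup>2) \<partial>lborel) \<le> 1
    \<longrightarrow> w \<in> borel_measurable borel \<longrightarrow> (\<forall>x. 0 \<le> w x)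
    \<longrightarrow> (AE x in lborel. ennreal (w x) \<le> potential Q {0..} \<sigma> P x)
    \<longrightarrow> (\<integral>\<^sup>+x. ennreal (w x powr p) \<partial>lborel) \<le> ennreal K"
proof -
  define d2 where "d2 = real CARD('n) / 2"
  define e where "e = d2 - \<sigma>"
  have e: "e > 0" using \<sigma> by (simp add: e_def d2_def)
  have p2: "p / 2 = 1 + \<sigma> / e"
    using e p by (simp add: e_def d2_def field_simps)
  have "\<sigma> / e > 0" using \<sigma>(1) e by simp
  with p2 have p_gt: "p > 2" by linarith
  define \<kappa> where "\<kappa> = sqrt q / e"
  have \<kappa>: "\<kappa> > 0" using q e by (simp add: \<kappa>_def)
  define c1 where "c1 = (2 * \<kappa>) powr (\<sigma> / e)"
  have c1: "c1 > 0" using \<kappa> by (simp add: c1_def)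
  \<comment> \<open>The constant that makes the low near part equal to \<rho> / 4.\<close>
  define c2 where "c2 = \<sigma> / (4 * q * c1)"
  have c2: "c2 > 0" using \<sigma> q c1 by (simp add: c2_def)
  \<comment> \<open>The solution of \<kappa> \<tau>^(-e) = \<rho> / 2, so that the far part amounts
    to \<rho> / 2.\<close>
  define \<tau> where "\<tau> \<rho> = (\<rho> / (2 * \<kappa>)) powr (- 1 / e)" for \<rho>
  have \<tau>: "\<tau> \<rho> > 0" "sqrt q / (d2 - \<sigma>) * \<tau> \<rho> powr (\<sigma> - d2) = \<rho> / 2"
    "\<tau> \<rho> powr \<sigma> = c1 * \<rho> powr (- \<sigma> / e)" if "\<rho> > 0" for \<rho>
  proof -
    show "\<tau> \<rho> > 0" using that \<kappa> by (simp add: \<tau>_def)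
    have "\<tau> \<rho> powr (\<sigma> - d2) = (\<rho> / (2 * \<kappa>)) powr ((- 1 / e) * (\<sigma> - d2))"
      by (simp add: \<tau>_def powr_powr)
    also have "(- 1 / e) * (\<sigma> - d2) = 1" using e by (simp add: e_def field_simps)
    finally have "\<tau> \<rho> powr (\<sigma> - d2) = \<rho> / (2 * \<kappa>)" using that \<kappa> by simp
    then have "sqrt q / (d2 - \<sigma>) * \<tau> \<rho> powr (\<sigma> - d2) = \<kappa> * (\<rho> / (2 * \<kappa>))"
      by (simp only: \<kappa>_def e_def)
    also have "\<dots> = \<rho> / 2" using \<kappa> by simp
    finally show "sqrt q / (d2 - \<sigma>) * \<tau> \<rho> powr (\<sigma> - d2) = \<rho> / 2" .
    have "\<tau> \<rho> powr \<sigma> = (\<rho> / (2 * \<kappa>)) powr (- \<sigma> / e)"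
      by (simp add: \<tau>_def powr_powr)
    also have "\<dots> = \<rho> powr (- \<sigma> / e) / (2 * \<kappa>) powr (- \<sigma> / e)"
      by (rule powr_divide)
    also have "\<dots> = c1 * \<rho> powr (- \<sigma> / e)"
      by (simp add: c1_def powr_minus divide_inverse)
    finally show "\<tau> \<rho> powr \<sigma> = c1 * \<rho> powr (- \<sigma> / e)" .
  qed
  \<comment> \<open>As \<tau>^\<sigma> is a multiple of \<rho>^(-\<sigma>/e) and p/2 = 1 +
    \<sigma>/e, the power p/2 makes h \<tau>^\<sigma> proportional to \<rho>.\<close>
  define h where "h \<rho> = c2 * \<rho> powr (p / 2)" for \<rho>
  have h: "h \<rho> \<ge> 0" "h \<rho> * q * \<tau> \<rho> powr \<sigma> / \<sigma> = \<rho> / 4" if "\<rho> > 0" for \<rho>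
  proof -
    show "h \<rho> \<ge> 0" using c2 by (simp add: h_def)
    have "\<rho> powr (p / 2) * \<rho> powr (- \<sigma> / e) = \<rho>"
      using that by (simp add: p2 flip: powr_add)
    moreover have "h \<rho> * q * \<tau> \<rho> powr \<sigma> / \<sigma> = (c2 * q * c1 / \<sigma>) * (\<rho> powr (p / 2) * \<rho> powr (- \<sigma> / e))"
      by (simp add: h_def \<tau>(3)[OF that])
    moreover have "c2 * q * c1 / \<sigma> = 1 / 4"
      using \<sigma> q c1 by (simp add: c2_def)
    ultimately have "h \<rho> * q * \<tau> \<rho> powr \<sigma> / \<sigma> = 1 / 4 * \<rho>" by (simp only:)
    then show "h \<rho> * q * \<tau> \<rho> powr \<sigma> / \<sigma> = \<rho> / 4" by simp
  qed
  define C3 where "C3 = 4 * p * c1 * q / \<sigma>"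
  have C3: "C3 \<ge> 0" using p_gt c1 q \<sigma> by (simp add: C3_def)
  \<comment> \<open>The integral of \<rho>^(p/2 - 1) up to the level where h reaches P y is 2 P y /
    (p c2); the rest is the factor C3 P y.\<close>
  let ?K = "2 * C3 / (p * c2)"
  show ?thesis
  proof (intro exI[of _ ?K] conjI allI impI)
    show "0 \<le> ?K" using C3 p_gt c2 by simp
    fix P w :: "real^'n \<Rightarrow> real"
    assume [measurable]: "P \<in> borel_measurable borel" "w \<in> borel_measurable borel"
      and P: "\<forall>y. 0 \<le> P y" and P2: "(\<integral>\<^sup>+y. ennreal ((P y)\<^sup>2) \<partial>lborel) \<le> 1"
      and w: "\<forall>x. 0 \<le> w x" and le: "AE x in lborel. ennreal (w x) \<le> potential Q {0..} \<sigma> P x"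
    let ?P2 = "\<lambda>\<rho> y. P y * indicator {y. h \<rho> < P y} y"
    have dist: "emeasure lborel {x. \<rho> \<le> w x}
        \<le> ennreal (4 / \<rho> * (\<tau> \<rho> powr \<sigma> / \<sigma>) * q) * (\<integral>\<^sup>+y. ennreal (?P2 \<rho> y) \<partial>lborel)" if \<rho>: "\<rho> > 0" for \<rho>
    proof -
      let ?near = "potential Q {0..\<tau> \<rho>} \<sigma> (?P2 \<rho>)"
      have [measurable]: "?near \<in> borel_measurable borel" by measurable
      have "emeasure lborel {x. \<rho> \<le> w x} \<le> emeasure lborel {x \<in> UNIV. 1 \<le> ennreal (4 / \<rho>) * ?near x}"
      proof (rule emeasure_mono_AE)
        show "AE x in lborel. x \<in> {x. \<rho> \<le> w x} \<longrightarrow> x \<in> {x \<in> UNIV. 1 \<le> ennreal (4 / \<rho>) * ?near x}"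
          using le
        proof eventually_elim
          case (elim x)
          show ?case
          proof
            assume "x \<in> {x. \<rho> \<le> w x}"
            then have "ennreal \<rho> \<le> potential Q {0..} \<sigma> P x"
              using elim by (auto intro: order_trans ennreal_leI)
            also have "\<dots> \<le> ?near x + ennreal (\<rho> / 4) + ennreal (\<rho> / 2)"
            proof -
              have "potential Q {0..} \<sigma> P x \<le> ?near x + ennreal (h \<rho> * q * \<tau> \<rho> powr \<sigma> / \<sigma>)
                  + ennreal (sqrt q / (real CARD('n) / 2 - \<sigma>) * \<tau> \<rho> powr (\<sigma> - real CARD('n) / 2))"
                by (rule potential_le_near_far) (use P P2 q \<sigma> \<tau>(1)[OF \<rho>] h(1)[OF \<rho>] in auto)
              then show ?thesis by (simp only: h(2)[OF \<rho>] \<tau>(2)[OF \<rho>] d2_def[symmetric])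
            qed
            finally have *: "ennreal \<rho> \<le> ?near x + ennreal (\<rho> / 4) + ennreal (\<rho> / 2)" .
            have "ennreal (\<rho> / 4) \<le> ?near x"
            proof (cases "?near x")
              case (real r)
              with * \<rho> have "\<rho> \<le> r + \<rho> / 4 + \<rho> / 2" by (simp flip: ennreal_plus)
              then show ?thesis using real by (simp add: ennreal_leI)
            qed simp
            then have "ennreal (4 / \<rho>) * ennreal (\<rho> / 4) \<le> ennreal (4 / \<rho>) * ?near x"
              by (rule mult_left_mono) simp
            moreover have "ennreal (4 / \<rho>) * ennreal (\<rho> / 4) = 1"
              using \<rho> by (simp flip: ennreal_mult')
            ultimately show "x \<in> {x \<in> UNIV. 1 \<le> ennreal (4 / \<rho>) * ?near x}" by simp
          qed
        qed
      qed measurable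
      also have "\<dots> \<le> ennreal (4 / \<rho>) * set_nn_integral lborel UNIV ?near"
        by (rule nn_integral_Markov_inequality) simp_all
      also have "\<dots> = ennreal (4 / \<rho>) * (ennreal (\<tau> \<rho> powr \<sigma> / \<sigma>) * (ennreal q * (\<integral>\<^sup>+y. ennreal (?P2 \<rho> y) \<partial>lborel)))"
        using nn_integral_potential[of Q "?P2 \<rho>" \<sigma> "\<tau> \<rho>"] \<sigma> \<tau>(1)[OF \<rho>] by (simp add: q)
      also have "\<dots> = ennreal (4 / \<rho> * (\<tau> \<rho> powr \<sigma> / \<sigma>) * q) * (\<integral>\<^sup>+y. ennreal (?P2 \<rho> y) \<partial>lborel)"
      proof -
        have "ennreal (4 / \<rho> * (\<tau> \<rho> powr \<sigma> / \<sigma>) * q) = ennreal (4 / \<rho> * (\<tau> \<rho> powr \<sigma> / \<sigma>)) * ennreal q"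
          by (rule ennreal_mult'') (use q in simp)
        also have "ennreal (4 / \<rho> * (\<tau> \<rho> powr \<sigma> / \<sigma>)) = ennreal (4 / \<rho>) * ennreal (\<tau> \<rho> powr \<sigma> / \<sigma>)"
          by (rule ennreal_mult') (use \<rho> in simp)
        finally show ?thesis by (simp only: mult.assoc)
      qed
      finally show ?thesis .
    qed
    \<comment> \<open>The layer-cake weight and the Markov factor combine to the exponent p - 1 - 1
      - \<sigma>/e = p/2 - 1.\<close>
    have coeff: "p * \<rho> powr (p - 1) * (4 / \<rho> * (\<tau> \<rho> powr \<sigma> / \<sigma>) * q) = C3 * \<rho> powr (p / 2 - 1)" if "\<rho> > 0" for \<rho>
    proof -
      have "\<rho> powr (p / 2 - 1) = \<rho> powr (p - 1) * \<rho> powr (- 1) * \<rho> powr (- \<sigma> / e)"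
      proof -
        have "- \<sigma> / e = - (\<sigma> / e)" by simp
        with p2 have "p / 2 - 1 = p - 1 + - 1 + - \<sigma> / e" by linarith
        then show ?thesis by (simp only: powr_add)
      qed
      moreover have "\<rho> powr - 1 = 1 / \<rho>" using that by (simp add: powr_minus_divide)
      moreover have "p * a * (4 / r * (c1 * b / s) * q) = 4 * p * c1 * q / s * (a * (1 / r) * b)" for a b r s
        by (simp add: divide_inverse mult_ac)
      ultimately show ?thesis by (simp only: \<tau>(3)[OF that] C3_def)
    qed
    have "(\<integral>\<^sup>+x. ennreal (w x powr p) \<partial>lborel)
      = (\<integral>\<^sup>+x. \<integral>\<^sup>+\<rho>. ennreal p * ennreal (indicator {0..w x} \<rho> * \<rho> powr (p - 1)) \<partial>lborel \<partial>lborel)"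
    proof (rule nn_integral_cong)
      fix x
      show "ennreal (w x powr p) = (\<integral>\<^sup>+\<rho>. ennreal p * ennreal (indicator {0..w x} \<rho> * \<rho> powr (p - 1)) \<partial>lborel)"
      proof -
        have I: "(\<integral>\<^sup>+\<rho>. ennreal (indicator {0..w x} \<rho> * \<rho> powr (p - 1)) \<partial>lborel) = ennreal (w x powr p / p)"
          using p_gt w nn_integral_powr[of "p - 1" "w x"] by simp
        have "ennreal p * ennreal (w x powr p / p) = ennreal (p * (w x powr p / p))"
          by (rule ennreal_mult'[symmetric]) (use p_gt in simp)
        then have "ennreal (w x powr p) = ennreal p * ennreal (w x powr p / p)" using p_gt by simp
        then show ?thesis unfolding I[symmetric] by (simp add: nn_integral_cmult)
      qed
    qed
    also have "\<dots> = (\<integral>\<^sup>+\<rho>. \<integral>\<^sup>+x. ennreal p * ennreal (indicator {0..w x} \<rho> * \<rho> powr (p - 1)) \<partial>lborel \<partial>lborel)"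
      unfolding indicator_def atLeastAtMost_iff by (rule lborel_pair.Fubini'[symmetric]) measurable
    also have "\<dots> \<le> (\<integral>\<^sup>+\<rho>. \<integral>\<^sup>+y. ennreal (indicator {0<..} \<rho> * (C3 * \<rho> powr (p / 2 - 1))) * ennreal (?P2 \<rho> y) \<partial>lborel \<partial>lborel)"
    proof (rule nn_integral_mono)
      fix \<rho> :: real
      show "(\<integral>\<^sup>+x. ennreal p * ennreal (indicator {0..w x} \<rho> * \<rho> powr (p - 1)) \<partial>lborel)
         \<le> (\<integral>\<^sup>+y. ennreal (indicator {0<..} \<rho> * (C3 * \<rho> powr (p / 2 - 1))) * ennreal (?P2 \<rho> y) \<partial>lborel)"
      proof (cases "\<rho> > 0")
        case True
        have "(\<integral>\<^sup>+x. ennreal p * ennreal (indicator {0..w x} \<rho> * \<rho> powr (p - 1)) \<partial>lborel)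
          = (\<integral>\<^sup>+x. ennreal (p * \<rho> powr (p - 1)) * indicator {x. \<rho> \<le> w x} x \<partial>lborel)"
          using True p_gt by (intro nn_integral_cong) (auto simp: indicator_def ennreal_mult')
        also have "\<dots> = ennreal (p * \<rho> powr (p - 1)) * emeasure lborel {x. \<rho> \<le> w x}"
          by (rule nn_integral_cmult_indicator) measurable
        also have "\<dots> \<le> ennreal (p * \<rho> powr (p - 1)) * (ennreal (4 / \<rho> * (\<tau> \<rho> powr \<sigma> / \<sigma>) * q) * (\<integral>\<^sup>+y. ennreal (?P2 \<rho> y) \<partial>lborel))"
          by (intro mult_left_mono dist True) simp
        also have "\<dots> = ennreal (p * \<rho> powr (p - 1) * (4 / \<rho> * (\<tau> \<rho> powr \<sigma> / \<sigma>) * q)) * (\<integral>\<^sup>+y. ennreal (?P2 \<rho> y) \<partial>lborel)"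
          using p_gt by (subst ennreal_mult') (auto simp: mult.assoc)
        also have "\<dots> = (\<integral>\<^sup>+y. ennreal (indicator {0<..} \<rho> * (C3 * \<rho> powr (p / 2 - 1))) * ennreal (?P2 \<rho> y) \<partial>lborel)"
          unfolding coeff[OF True] using True by (subst nn_integral_cmult) auto
        finally show ?thesis .
      next
        case False
        \<comment> \<open>At \<rho> = 0 this uses that 0 powr any exponent is 0.\<close>
        then have z: "ennreal (indicator {0..w x} \<rho> * \<rho> powr (p - 1)) = 0" for x
          by (cases "\<rho> = 0") auto
        show ?thesis unfolding z by simp
      qed
    qed
    also have "\<dots> = (\<integral>\<^sup>+y. \<integral>\<^sup>+\<rho>. ennreal (indicator {0<..} \<rho> * (C3 * \<rho> powr (p / 2 - 1))) * ennreal (?P2 \<rho> y) \<partial>lborel \<partial>lborel)"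
      unfolding h_def indicator_def mem_Collect_eq by (rule lborel_pair.Fubini'[symmetric]) measurable
    also have "\<dots> \<le> (\<integral>\<^sup>+y. ennreal ?K * ennreal ((P y)\<^sup>2) \<partial>lborel)"
    proof (rule nn_integral_mono)
      fix y
      \<comment> \<open>The level at which h takes the value P y.\<close>
      let ?r = "(P y / c2) powr (2 / p)"
      have Py: "P y \<ge> 0" using P by simp
      have "(\<integral>\<^sup>+\<rho>. ennreal (indicator {0<..} \<rho> * (C3 * \<rho> powr (p / 2 - 1))) * ennreal (?P2 \<rho> y) \<partial>lborel)
        \<le> (\<integral>\<^sup>+\<rho>. ennreal (C3 * P y) * ennreal (indicator {0..?r} \<rho> * \<rho> powr (p / 2 - 1)) \<partial>lborel)"
      proof (rule nn_integral_mono)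
        fix \<rho> :: real
        show "ennreal (indicator {0<..} \<rho> * (C3 * \<rho> powr (p / 2 - 1))) * ennreal (?P2 \<rho> y)
          \<le> ennreal (C3 * P y) * ennreal (indicator {0..?r} \<rho> * \<rho> powr (p / 2 - 1))"
        proof (cases "\<rho> > 0 \<and> h \<rho> < P y")
          case True
          then have "\<rho> powr (p / 2) \<le> P y / c2"
            using c2 by (simp add: h_def field_simps)
          then have "(\<rho> powr (p / 2)) powr (2 / p) \<le> ?r"
            using p_gt by (intro powr_mono2) auto
          then have "\<rho> \<le> ?r"
            using True p_gt by (simp add: powr_powr)
          then show ?thesis
            using True C3 Py by (simp add: ennreal_mult mult_ac)
        qed auto
      qed
      also have "\<dots> = ennreal (C3 * P y) * ennreal (P y / c2 / (p / 2))"
      proof -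
        have "?r powr (p / 2) = P y / c2"
          using p_gt c2 Py by (simp add: powr_powr)
        then have "(\<integral>\<^sup>+\<rho>. ennreal (indicator {0..?r} \<rho> * \<rho> powr (p / 2 - 1)) \<partial>lborel) = ennreal (P y / c2 / (p / 2))"
          using nn_integral_powr[of "p / 2 - 1" ?r] p_gt by simp
        then show ?thesis by (subst nn_integral_cmult) simp_all
      qed
      also have "ennreal (C3 * P y) * ennreal (P y / c2 / (p / 2)) = ennreal ?K * ennreal ((P y)\<^sup>2)"
      proof -
        have "C3 * P y * (P y / c2 / (p / 2)) = ?K * (P y)\<^sup>2"
          by (simp add: power2_eq_square mult_ac)
        moreover have "ennreal (C3 * P y) * ennreal (P y / c2 / (p / 2)) = ennreal (C3 * P y * (P y / c2 / (p / 2)))"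
          by (rule ennreal_mult'[symmetric]) (use C3 Py in simp)
        moreover have "ennreal ?K * ennreal ((P y)\<^sup>2) = ennreal (?K * (P y)\<^sup>2)"
          by (rule ennreal_mult'[symmetric]) (use C3 p_gt c2 in simp)
        ultimately show ?thesis by (simp only:)
      qed
      finally show "(\<integral>\<^sup>+\<rho>. ennreal (indicator {0<..} \<rho> * (C3 * \<rho> powr (p / 2 - 1))) * ennreal (?P2 \<rho> y) \<partial>lborel)
        \<le> ennreal ?K * ennreal ((P y)\<^sup>2)" .
    qed
    also have "\<dots> = ennreal ?K * (\<integral>\<^sup>+y. ennreal ((P y)\<^sup>2) \<partial>lborel)"
      by (rule nn_integral_cmult) measurable
    also have "\<dots> \<le> ennreal ?K * 1" by (intro mult_left_mono P2) simp
    finally show "(\<integral>\<^sup>+x. ennreal (w x powr p) \<partial>lborel) \<le> ennreal ?K" by simp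
  qed
qed

text \<open>For t \<le> 1 and \<sigma> \<le> n + 1 the weight t^n is below t^(\<sigma> - 1), so the
  bound splits into a constant from scale T and a potential of order \<sigma>. The constant is
  harmless on S, which has finite measure. Keeping \<sigma> free reaches the smaller exponents as
  well as the critical one.\<close>

lemma taylor_bound_Lp:
  fixes Q :: "(real^'n::finite) set"
  assumes [measurable]: "Q \<in> sets borel" "S \<in> sets borel" and q: "emeasure lborel Q = ennreal q" "0 < q"
    and S: "emeasure lborel S < \<infinity>" and T: "0 < T" "T \<le> 1" and C: "0 \<le> C"
    and \<sigma>: "0 < \<sigma>" "\<sigma> < real CARD('n) / 2" "\<sigma> \<le> real n + 1" and p: "p = real CARD('n) / (real CARD('n) / 2 - \<sigma>)"
  shows "\<exists>K\<ge>0. \<forall>P v. P \<in> borel_measurable borel \<longrightarrow> (\<forall>y. 0 \<le> P y) \<longrightarrow> (\<integral>\<^sup>+y. ennreal ((P y)\<^sup>2) \<partial>lborel) \<le> 1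
    \<longrightarrow> v \<in> borel_measurable borel
    \<longrightarrow> (AE x in lborel. x \<in> S \<longrightarrow> ennreal \<bar>v x\<bar> \<le> ennreal C * taylor_bound Q P T n x 0)
    \<longrightarrow> (\<integral>\<^sup>+x. ennreal (indicator S x * \<bar>v x\<bar> powr p) \<partial>lborel) \<le> ennreal K"
proof -
  let ?d2 = "real CARD('n) / 2"
  have d2\<sigma>: "0 < ?d2 - \<sigma>" using \<sigma>(2) by linarith
  have p0: "p > 0" unfolding p by (rule divide_pos_pos[OF _ d2\<sigma>]) simp
  from potential_Lp_bound[OF assms(1) q \<sigma>(1,2) p]
  obtain K where K: "K \<ge> 0" "\<forall>P w. P \<in> borel_measurable borel \<longrightarrow> (\<forall>y. 0 \<le> P y) \<longrightarrow> (\<integral>\<^sup>+y. ennreal ((P y)\<^sup>2) \<partial>lborel) \<le> 1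
    \<longrightarrow> w \<in> borel_measurable borel \<longrightarrow> (\<forall>x. 0 \<le> w x)
    \<longrightarrow> (AE x in lborel. ennreal (w x) \<le> potential Q {0..} \<sigma> P x)
    \<longrightarrow> (\<integral>\<^sup>+x. ennreal (w x powr p) \<partial>lborel) \<le> ennreal K"
    by (elim exE conjE)
  define c0 where "c0 = sqrt q * T powr (- ?d2)"
  have c0: "c0 \<ge> 0" using q by (simp add: c0_def)
  \<comment> \<open>Made positive because it is divided by below, while C may be 0.\<close>
  define C1 where "C1 = max C 1"
  have C1: "C1 > 0" "C \<le> C1" by (auto simp: C1_def)
  let ?K = "(2 * C1) powr p * (c0 powr p * measure lborel S + K)"
  show ?thesis
  proof (intro exI[of _ ?K] conjI allI impI)
    show "0 \<le> ?K" using K(1) by simp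
    fix P v :: "real^'n \<Rightarrow> real"
    assume [measurable]: "P \<in> borel_measurable borel" "v \<in> borel_measurable borel"
      and P: "\<forall>y. 0 \<le> P y" and P2: "(\<integral>\<^sup>+y. ennreal ((P y)\<^sup>2) \<partial>lborel) \<le> 1"
      and le: "AE x in lborel. x \<in> S \<longrightarrow> ennreal \<bar>v x\<bar> \<le> ennreal C * taylor_bound Q P T n x 0"
    \<comment> \<open>The excess of |v| / C1 over the constant part, cut off at 0, so that it is
      dominated by the potential alone.\<close>
    define w where "w x = indicator S x * max 0 (\<bar>v x\<bar> / C1 - c0)" for x
    have [measurable]: "w \<in> borel_measurable borel" unfolding w_def[abs_def] by measurable
    have tb: "taylor_bound Q P T n x 0 \<le> ennreal c0 + potential Q {0..} \<sigma> P x" for x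
    proof -
      have "indicator {0..T} t * t ^ n \<le> indicator {0..} t * t powr (\<sigma> - 1)" if "t \<noteq> 0" for t
      proof (cases "t \<in> {0..T}")
        case True
        then have t: "0 < t" "t \<le> 1" using that T by auto
        have "t powr real n \<le> t powr (\<sigma> - 1)" using t \<sigma>(3) by (intro powr_mono') auto
        then show ?thesis using t True by (simp add: powr_realpow)
      qed (use that in \<open>auto simp: indicator_def\<close>)
      then have "(\<integral>\<^sup>+t. ennreal (indicator {0..T} t * t ^ n) * cavg Q P x t \<partial>lborel) \<le> potential Q {0..} \<sigma> P x"
        unfolding potential_def
        by (intro nn_integral_mono_AE eventually_mono[OF AE_lborel_singleton[of 0]] mult_right_mono ennreal_leI) auto
      moreover have "cavg Q P x T \<le> ennreal c0"
        unfolding c0_def by (rule cavg_le_powr) (use T P P2 q in auto)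
      ultimately show ?thesis unfolding taylor_bound_def by (rule add_mono[rotated])
    qed
    have "AE x in lborel. ennreal (w x) \<le> potential Q {0..} \<sigma> P x"
      using le
    proof eventually_elim
      case (elim x)
      show ?case
      proof (cases "x \<in> S")
        case True
        have "ennreal \<bar>v x\<bar> \<le> ennreal C * taylor_bound Q P T n x 0"
          using elim True by blast
        also have "\<dots> \<le> ennreal C1 * (ennreal c0 + potential Q {0..} \<sigma> P x)"
          using C1(2) by (intro mult_mono ennreal_leI tb) simp_all
        finally have le: "ennreal \<bar>v x\<bar> \<le> ennreal C1 * (ennreal c0 + potential Q {0..} \<sigma> P x)" .
        show ?thesis
        proof (cases "potential Q {0..} \<sigma> P x")
          case (real r)
          have "ennreal C1 * (ennreal c0 + ennreal r) = ennreal (C1 * (c0 + r))"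
            using C1(1) c0 real by (simp add: ennreal_mult')
          with le real have "\<bar>v x\<bar> \<le> C1 * (c0 + r)"
            using C1(1) c0 by simp
          then have "\<bar>v x\<bar> / C1 \<le> c0 + r"
            using C1(1) by (simp add: divide_le_eq mult.commute)
          then have "w x \<le> r" using real True by (simp add: w_def)
          then show ?thesis unfolding real by (rule ennreal_leI)
        qed simp
      qed (simp add: w_def)
    qed
    then have wK: "(\<integral>\<^sup>+x. ennreal (w x powr p) \<partial>lborel) \<le> ennreal K"
      using P P2 by (intro K(2)[rule_format]) (auto simp: w_def)
    have "indicator S x * \<bar>v x\<bar> powr p \<le> (2 * C1) powr p * (c0 powr p * indicator S x + w x powr p)" for x
    proof (cases "x \<in> S")
      case True
      have w0: "w x \<ge> 0" by (simp add: w_def)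
      have "\<bar>v x\<bar> \<le> C1 * (c0 + w x)"
        using True C1 by (auto simp: w_def field_simps max_def)
      also have "\<dots> \<le> C1 * (2 * max c0 (w x))"
        using C1 by (intro mult_left_mono) auto
      finally have "\<bar>v x\<bar> powr p \<le> (2 * C1 * max c0 (w x)) powr p"
        using p0 by (intro powr_mono2) (auto simp: mult_ac)
      also have "\<dots> = (2 * C1) powr p * max c0 (w x) powr p"
        by (rule powr_mult)
      also have "\<dots> \<le> (2 * C1) powr p * (c0 powr p + w x powr p)"
        by (intro mult_left_mono) (auto simp: max_def)
      finally show ?thesis using True by simp
    qed simp
    then have "(\<integral>\<^sup>+x. ennreal (indicator S x * \<bar>v x\<bar> powr p) \<partial>lborel)
      \<le> (\<integral>\<^sup>+x. ennreal ((2 * C1) powr p) * (ennreal (c0 powr p) * indicator S x + ennreal (w x powr p)) \<partial>lborel)"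
      by (intro nn_integral_mono) (simp add: ennreal_leI flip: ennreal_mult' ennreal_plus ennreal_indicator)
    also have "\<dots> = ennreal ((2 * C1) powr p) * (ennreal (c0 powr p) * emeasure lborel S + (\<integral>\<^sup>+x. ennreal (w x powr p) \<partial>lborel))"
      by (simp add: nn_integral_cmult nn_integral_add)
    also have "\<dots> \<le> ennreal ((2 * C1) powr p) * (ennreal (c0 powr p) * ennreal (measure lborel S) + ennreal K)"
      using S wK by (intro mult_left_mono add_mono) (auto simp: emeasure_eq_ennreal_measure)
    also have "\<dots> = ennreal ?K"
      using K(1) by (simp flip: ennreal_mult' ennreal_plus)
    finally show "(\<integral>\<^sup>+x. ennreal (indicator S x * \<bar>v x\<bar> powr p) \<partial>lborel) \<le> ennreal ?K" .
  qed
qed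

subsection \<open>Cone condition\<close>

text \<open>The points x + t z with z in the box and 0 < t \<le> T sweep a truncated cone with
  vertex x, and one box serves all x of the patch. T \<le> 1 is kept because powers of t with
  different exponents are compared later.\<close>

definition cone_patch ::
    "(real^'n::finite) set \<Rightarrow> (real^'n) set \<Rightarrow> real^'n \<Rightarrow> real^'n \<Rightarrow> real \<Rightarrow> bool" where
  "cone_patch \<Omega> N lo hi T \<longleftrightarrow> open N \<and> box lo hi \<noteq> {} \<and> 0 < T \<and> T \<le> 1
     \<and> (\<forall>x\<in>N \<inter> \<Omega>. \<forall>t z. 0 < t \<longrightarrow> t \<le> T \<longrightarrow> z \<in> cbox lo hi \<longrightarrow> x + t *\<^sub>R z \<in> \<Omega>)"

lemma norm_le_card_mult:
  fixes z :: "real^'n::finite"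
  assumes "\<And>i. \<bar>z $ i\<bar> \<le> b" shows "norm z \<le> real CARD('n) * b"
  using norm_le_l1_cart[of z] sum_mono[of UNIV "\<lambda>i. \<bar>z $ i\<bar>" "\<lambda>i. b"] assms by simp

lemma interior_cone_patch:
  fixes \<Omega> :: "(real^'n::finite) set"
  assumes "open \<Omega>" "x0 \<in> \<Omega>"
  shows "\<exists>N lo hi T. x0 \<in> N \<and> cone_patch \<Omega> N lo hi T"
proof -
  obtain e where e: "e > 0" "ball x0 e \<subseteq> \<Omega>" using assms openE by blast
  let ?d = "real CARD('n)"
  let ?lo = "0 :: real^'n" and ?hi = "(\<chi> i. 1) :: real^'n"
  define T where "T = min 1 (e / (2 * ?d))"
  have T: "0 < T" "T \<le> 1" "T * ?d \<le> e / 2"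
    using e by (auto simp: T_def min_def field_simps)
  have "cone_patch \<Omega> (ball x0 (e / 2)) ?lo ?hi T"
    unfolding cone_patch_def
  proof (intro conjI ballI allI impI)
    show "box ?lo ?hi \<noteq> {}" by (simp add: interval_ne_empty_cart)
    fix x t z assume x: "x \<in> ball x0 (e / 2) \<inter> \<Omega>" and t: "0 < t" "t \<le> T" and z: "z \<in> cbox ?lo ?hi"
    have "norm z \<le> ?d * 1" by (rule norm_le_card_mult) (use z in \<open>auto simp: mem_box_cart\<close>)
    then have "norm (t *\<^sub>R z) \<le> T * ?d" using t by (auto intro!: mult_mono)
    then have "norm (t *\<^sub>R z) \<le> e / 2" using T by simp
    moreover have "norm (x0 - x) < e / 2" using x by (simp add: dist_norm)
    ultimately have "norm (x0 - x - t *\<^sub>R z) < e"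
      using norm_triangle_ineq4[of "x0 - x" "t *\<^sub>R z"] by linarith
    then have "x + t *\<^sub>R z \<in> ball x0 e" by (simp add: dist_norm diff_diff_eq)
    with e show "x + t *\<^sub>R z \<in> \<Omega>" by blast
  qed (use T in auto)
  then show ?thesis using e(1) by (metis centre_in_ball half_gt_zero)
qed

lemma C1_function_lipschitz:
  fixes \<gamma> :: "real^'n::finite \<Rightarrow> real"
  assumes \<gamma>: "C1_function \<gamma>"
  shows "\<exists>\<Lambda>\<ge>0. \<forall>x\<in>ball x0 \<rho>. \<forall>y\<in>ball x0 \<rho>. \<bar>\<gamma> x - \<gamma> y\<bar> \<le> \<Lambda> * norm (x - y)"
proof -
  have "\<exists>B\<ge>0. \<forall>x\<in>cball x0 \<rho>. \<bar>pderivative i \<gamma> x\<bar> \<le> B" for i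
  proof -
    have "continuous_on (cball x0 \<rho>) (pderivative i \<gamma>)"
      using \<gamma> by (auto simp: C1_function_def intro: continuous_on_subset)
    then have "bounded (pderivative i \<gamma> ` cball x0 \<rho>)"
      by (intro compact_imp_bounded compact_continuous_image) auto
    then show ?thesis by (auto simp: bounded_pos intro: less_imp_le)
  qed
  then obtain B where B: "\<And>i. B i \<ge> 0" "\<And>i x. x \<in> cball x0 \<rho> \<Longrightarrow> \<bar>pderivative i \<gamma> x\<bar> \<le> B i" by metis
  define \<Lambda> where "\<Lambda> = (\<Sum>i\<in>UNIV. B i)"
  have deriv: "(\<gamma> has_derivative frechet_derivative \<gamma> (at x)) (at x)" for x
    using \<gamma> by (simp add: C1_function_def frechet_derivative_works)
  have "onorm (frechet_derivative \<gamma> (at x)) \<le> \<Lambda>" if x: "x \<in> ball x0 \<rho>" for x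
  proof (rule onorm_le)
    fix h :: "real^'n"
    have "\<bar>frechet_derivative \<gamma> (at x) h\<bar> \<le> (\<Sum>i\<in>UNIV. \<bar>h $ i * pderivative i \<gamma> x\<bar>)"
      unfolding has_derivative_sum_pderivative[OF deriv, of x h] by (rule sum_abs)
    also have "\<dots> \<le> (\<Sum>i\<in>UNIV. norm h * B i)"
      unfolding abs_mult using x B component_le_norm_cart[of h] by (intro sum_mono mult_mono) auto
    finally show "norm (frechet_derivative \<gamma> (at x) h) \<le> \<Lambda> * norm h"
      by (simp add: \<Lambda>_def sum_distrib_left mult.commute)
  qed
  note on = this
  have "norm (\<gamma> x - \<gamma> y) \<le> \<Lambda> * norm (x - y)" if "x \<in> ball x0 \<rho>" "y \<in> ball x0 \<rho>" for x y
    by (rule differentiable_bound[where f' = "\<lambda>x. frechet_derivative \<gamma> (at x)",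
          OF convex_ball has_derivative_at_withinI[OF deriv] on that])
  moreover have "\<Lambda> \<ge> 0" using B by (auto simp: \<Lambda>_def intro: sum_nonneg)
  ultimately show ?thesis by auto
qed

text \<open>Directions close to the inward coordinate direction are taken. Moving by t z gains at
  least t (1 - \<kappa>) in that coordinate, while the sideways motion raises the graph by at most t
  \<Lambda> d \<kappa>, which is smaller.\<close>

lemma boundary_cone_patch:
  fixes \<Omega> :: "(real^'n::finite) set"
  assumes "C1_boundary \<Omega>" "x0 \<in> frontier \<Omega>"
  shows "\<exists>N lo hi T. x0 \<in> N \<and> cone_patch \<Omega> N lo hi T"
proof -
  from assms obtain \<rho> i \<sigma> \<gamma> where \<rho>: "\<rho> > 0" and \<sigma>: "\<sigma> \<in> {-1, 1 :: real}" and \<gamma>: "C1_function \<gamma>"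
    and indep: "\<forall>x y. (\<forall>j. j \<noteq> i \<longrightarrow> x $ j = y $ j) \<longrightarrow> \<gamma> x = \<gamma> y"
    and graph: "\<Omega> \<inter> ball x0 \<rho> = {x \<in> ball x0 \<rho>. \<sigma> * x $ i > \<gamma> x}"
    unfolding C1_boundary_def by (elim ballE bexE exE conjE) auto
  obtain \<Lambda> where \<Lambda>: "\<Lambda> \<ge> 0" "\<And>x y. x \<in> ball x0 \<rho> \<Longrightarrow> y \<in> ball x0 \<rho> \<Longrightarrow> \<bar>\<gamma> x - \<gamma> y\<bar> \<le> \<Lambda> * norm (x - y)"
    using C1_function_lipschitz[OF \<gamma>] by metis
  let ?d = "real CARD('n)"
  \<comment> \<open>Chosen so that \<kappa> + \<Lambda> d \<kappa> = 1/2; any value below 1 would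
    keep the gain above the rise of the graph.\<close>
  define \<kappa> where "\<kappa> = 1 / (2 * (1 + \<Lambda> * ?d))"
  have pos: "1 + \<Lambda> * ?d > 0" using \<Lambda> by (simp add: add_pos_nonneg)
  have \<kappa>: "\<kappa> > 0" "\<kappa> + \<Lambda> * ?d * \<kappa> = 1 / 2"
  proof -
    show "\<kappa> > 0" using pos by (simp add: \<kappa>_def)
    have "\<kappa> + \<Lambda> * ?d * \<kappa> = (1 + \<Lambda> * ?d) * \<kappa>" by (simp add: algebra_simps)
    also have "\<dots> = 1 / 2" using pos by (simp add: \<kappa>_def)
    finally show "\<kappa> + \<Lambda> * ?d * \<kappa> = 1 / 2" .
  qed
  have \<kappa>1: "\<kappa> \<le> 1 / 2" "\<Lambda> * (?d * \<kappa>) < 1 - \<kappa>"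
  proof -
    have "0 \<le> \<Lambda> * ?d * \<kappa>" using \<kappa>(1) \<Lambda>(1) by simp
    with \<kappa> show "\<kappa> \<le> 1 / 2" by linarith
    with \<kappa> show "\<Lambda> * (?d * \<kappa>) < 1 - \<kappa>" unfolding mult.assoc by linarith
  qed
  let ?lo = "(\<chi> j. (if j = i then \<sigma> else 0) - \<kappa>) :: real^'n"
  let ?hi = "(\<chi> j. (if j = i then \<sigma> else 0) + \<kappa>) :: real^'n"
  \<comment> \<open>All directions z have norm at most 2 d, so a displacement stays below \<rho> / 2
    and does not leave the ball where the graph description is valid.\<close>
  define T where "T = min 1 (\<rho> / (4 * ?d))"
  have T: "0 < T" "T \<le> 1" "T * (?d * 2) \<le> \<rho> / 2"
    using \<rho> by (auto simp: T_def min_def field_simps)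
  have "cone_patch \<Omega> (ball x0 (\<rho> / 2)) ?lo ?hi T"
    unfolding cone_patch_def
  proof (intro conjI ballI allI impI)
    show "box ?lo ?hi \<noteq> {}" using \<kappa>(1) by (simp add: interval_ne_empty_cart)
    fix x t z assume x: "x \<in> ball x0 (\<rho> / 2) \<inter> \<Omega>" and t: "0 < t" "t \<le> T" and z: "z \<in> cbox ?lo ?hi"
    \<comment> \<open>The sideways part of z. As \<gamma> does not depend on coordinate i, its
      increment is estimated along z' only, hence by \<kappa> instead of by the full length of
      z.\<close>
    define z' where "z' = (\<chi> j. if j = i then 0 else z $ j)"
    have zj: "\<bar>z $ j - (if j = i then \<sigma> else 0)\<bar> \<le> \<kappa>" for j
      using z by (auto simp: mem_box_cart abs_le_iff dest!: spec[of _ j] split: if_splits)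
    have "\<bar>z $ j\<bar> \<le> 2" for j using zj[of j] \<sigma> \<kappa>1 by (auto split: if_splits)
    then have z2: "norm z \<le> ?d * 2" by (rule norm_le_card_mult)
    have "\<bar>z' $ j\<bar> \<le> \<kappa>" for j using zj[of j] \<kappa> by (auto simp: z'_def)
    then have z'\<kappa>: "norm z' \<le> ?d * \<kappa>" by (rule norm_le_card_mult)
    also have "\<dots> \<le> ?d * 2" using \<kappa>1 by (intro mult_left_mono) auto
    finally have z'2: "norm z' \<le> ?d * 2" .
    have in_ball: "x + t *\<^sub>R w \<in> ball x0 \<rho>" if w: "norm w \<le> ?d * 2" for w
    proof -
      have "norm (t *\<^sub>R w) \<le> T * (?d * 2)" using t w by (auto intro!: mult_mono)
      then have "norm (t *\<^sub>R w) \<le> \<rho> / 2" using T by simp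
      moreover have "norm (x0 - x) < \<rho> / 2" using x by (simp add: dist_norm)
      ultimately have "norm (x0 - x - t *\<^sub>R w) < \<rho>"
        using norm_triangle_ineq4[of "x0 - x" "t *\<^sub>R w"] by linarith
      then show ?thesis by (simp add: dist_norm diff_diff_eq)
    qed
    have xb: "x \<in> ball x0 \<rho>" using x \<rho> by auto
    have "x \<in> \<Omega> \<inter> ball x0 \<rho>" using x xb by simp
    then have gx: "\<gamma> x < \<sigma> * x $ i" unfolding graph by simp
    have "\<gamma> (x + t *\<^sub>R z) = \<gamma> (x + t *\<^sub>R z')"
      by (rule indep[rule_format]) (simp add: z'_def)
    also have "\<dots> \<le> \<gamma> x + \<Lambda> * norm (t *\<^sub>R z')"
      using \<Lambda>(2)[OF in_ball[OF z'2] xb] by simp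
    also have "\<dots> \<le> \<gamma> x + t * (\<Lambda> * (?d * \<kappa>))"
      using mult_left_mono[OF z'\<kappa>, of "\<Lambda> * t"] \<Lambda>(1) t by (simp add: mult_ac)
    also have "\<dots> < \<gamma> x + t * (1 - \<kappa>)"
      using t \<kappa>1(2) by simp
    also have "\<dots> \<le> \<gamma> x + t * (\<sigma> * z $ i)"
      using zj[of i] \<sigma> t by (intro add_left_mono mult_left_mono) (auto simp: abs_le_iff)
    also have "\<dots> < \<sigma> * x $ i + t * (\<sigma> * z $ i)"
      using gx by simp
    also have "\<dots> = \<sigma> * (x + t *\<^sub>R z) $ i" by (simp add: distrib_left)
    finally have "\<gamma> (x + t *\<^sub>R z) < \<sigma> * (x + t *\<^sub>R z) $ i" .
    with in_ball[OF z2] have "x + t *\<^sub>R z \<in> \<Omega> \<inter> ball x0 \<rho>"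
      unfolding graph mem_Collect_eq by (intro conjI)
    then show "x + t *\<^sub>R z \<in> \<Omega>" by simp
  qed (use T in auto)
  moreover have "x0 \<in> ball x0 (\<rho> / 2)" using \<rho> by simp
  ultimately show ?thesis by blast
qed

lemma C1_domain_cone_patches:
  fixes \<Omega> :: "(real^'n::finite) set"
  assumes "C1_domain \<Omega>"
  shows "\<exists>I. finite I \<and> \<Omega> \<subseteq> (\<Union>(N, lo, hi, T)\<in>I. N) \<and> (\<forall>(N, lo, hi, T)\<in>I. cone_patch \<Omega> N lo hi T)"
proof -
  have \<Omega>: "open \<Omega>" "bounded \<Omega>" "C1_boundary \<Omega>" using assms by (auto simp: C1_domain_def)
  define \<P> where "\<P> = {(N, lo, hi, T). cone_patch \<Omega> N lo hi T}"
  have "compact (closure \<Omega>)" using \<Omega>(2) by (simp add: compact_closure)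
  moreover have "open (fst p)" if "p \<in> \<P>" for p
    using that by (auto simp: cone_patch_def \<P>_def)
  moreover have "closure \<Omega> \<subseteq> \<Union>(fst ` \<P>)"
  proof
    fix x assume "x \<in> closure \<Omega>"
    then have "x \<in> \<Omega> \<or> x \<in> frontier \<Omega>" using \<Omega>(1) by (auto simp: frontier_def interior_open)
    then obtain N lo hi T where N: "x \<in> N" "cone_patch \<Omega> N lo hi T"
      using interior_cone_patch[OF \<Omega>(1)] boundary_cone_patch[OF \<Omega>(3)] by blast
    then have "(N, lo, hi, T) \<in> \<P>" by (simp add: \<P>_def)
    with N(1) show "x \<in> \<Union>(fst ` \<P>)" by force
  qed
  ultimately obtain I where I: "I \<subseteq> \<P>" "finite I" "closure \<Omega> \<subseteq> \<Union>(fst ` I)"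
    by (rule compactE_image[of "closure \<Omega>" \<P> fst])
  have "\<Omega> \<subseteq> (\<Union>(N, lo, hi, T)\<in>I. N)"
  proof
    fix x assume "x \<in> \<Omega>"
    then obtain p where p: "p \<in> I" "x \<in> fst p" using I(3) closure_subset[of \<Omega>] by blast
    then show "x \<in> (\<Union>(N, lo, hi, T)\<in>I. N)" by (intro UN_I[OF p(1)]) (cases p, simp)
  qed
  moreover have "\<forall>(N, lo, hi, T)\<in>I. cone_patch \<Omega> N lo hi T"
    using I(1) by (auto simp: \<P>_def)
  ultimately have "finite I \<and> \<Omega> \<subseteq> (\<Union>(N, lo, hi, T)\<in>I. N) \<and> (\<forall>(N, lo, hi, T)\<in>I. cone_patch \<Omega> N lo hi T)"
    using I(2) by (intro conjI)
  then show ?thesis by (rule exI[of _ I])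
qed

subsection \<open>Weak derivatives and Sobolev embeddings\<close>

text \<open>\<open>weak_derivative\<close> quantifies over all lists with the given counts, so a
  witness is needed before it says anything about a candidate derivative.\<close>

lemma exists_list_with_counts: "\<exists>js :: 'n::finite list. count_list js = \<alpha>"
proof (induction "mindex_order \<alpha>" arbitrary: \<alpha>)
  case 0
  then have "\<alpha> = (\<lambda>i. 0)" by (auto simp: mindex_order_def)
  then show ?case by (intro exI[of _ "[]"]) auto
next
  case (Suc n)
  then have "\<exists>i. \<alpha> i \<noteq> 0" by (metis mindex_order_def nat.distinct(1) sum.neutral)
  then obtain i where i: "\<alpha> i \<noteq> 0" by blast
  define \<beta> where "\<beta> = \<alpha>(i := \<alpha> i - 1)"
  have \<alpha>: "\<alpha> = \<beta>(i := Suc (\<beta> i))" using i by (auto simp: \<beta>_def)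
  have "n = mindex_order \<beta>" using Suc(2) mindex_order_Suc[of \<beta> i] by (simp flip: \<alpha>)
  from Suc(1)[OF this] obtain js where js: "count_list js = \<beta>" by blast
  have "count_list (i # js) = \<alpha>" unfolding \<alpha> by (rule ext) (auto simp: js)
  then show ?case by blast
qed

lemma pderivatives_append: "pderivatives (xs @ ys) \<phi> = pderivatives xs (pderivatives ys \<phi>)"
  by (induction xs) auto

text \<open>Rests on the completeness of Lebesgue measure. Functions obtained by choice, such as
  \<open>wderiv\<close>, inherit measurability in this way from any good representative.\<close>

lemma borel_measurable_lebesgue_on_AE:
  fixes f g :: "'a::euclidean_space \<Rightarrow> real"
  assumes g: "g \<in> borel_measurable (lebesgue_on S)" and S: "S \<in> sets lebesgue"
    and ae: "AE x in lebesgue_on S. f x = g x"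
  shows "f \<in> borel_measurable (lebesgue_on S)"
proof (rule measurableI)
  fix A :: "real set" assume A: "A \<in> sets borel"
  have ae': "AE x in lebesgue. x \<in> S \<longrightarrow> f x = g x"
    using ae S by (simp add: AE_restrict_space_iff)
  have "g -` A \<inter> S \<in> sets (lebesgue_on S)"
    using measurable_sets[OF g A] by simp
  then have "g -` A \<inter> S \<in> sets lebesgue" using S by (simp add: sets_restrict_space_iff)
  then have "f -` A \<inter> S \<in> sets lebesgue"
    by (rule completion.in_sets_AE[rotated]) (use ae' in \<open>auto elim!: eventually_mono\<close>)
  then show "f -` A \<inter> space (lebesgue_on S) \<in> sets (lebesgue_on S)"
    using S by (simp add: sets_restrict_space_iff)
qed simp

lemma integrable_locally_integrable_mult:
  assumes \<Omega>: "open \<Omega>" and g: "locally_integrable \<Omega> g" and \<phi>: "\<phi> \<in> smooth_compact \<Omega>"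
  shows "integrable (lebesgue_on \<Omega>) (\<lambda>x. g x * \<phi> x)"
proof -
  obtain K where K: "compact K" "K \<subseteq> \<Omega>" "\<And>x. x \<notin> K \<Longrightarrow> \<phi> x = 0" and sm: "smooth \<phi>"
    using \<phi> by (auto simp: smooth_compact_def)
  obtain B where B: "B > 0" "\<And>x. \<bar>\<phi> x\<bar> \<le> B" using smooth_compact_bounded[OF \<phi>] by blast
  have Ks: "K \<in> sets lebesgue" using K(1) by (simp add: borel_compact)
  have "integrable (lebesgue_on K) g" using g K by (simp add: locally_integrable_def)
  then have int: "integrable lebesgue (\<lambda>x. indicator K x * g x)"
    using Ks by (simp add: integrable_restrict_space)
  have m\<phi>: "\<phi> \<in> borel_measurable lebesgue" by (rule measurable_completion) (simp add: smooth_borel sm)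
  have "integrable lebesgue (\<lambda>x. (indicator K x * g x) * \<phi> x)"
  proof (rule Bochner_Integration.integrable_bound[where f = "\<lambda>x. B * (indicator K x * g x)"])
    show "AE x in lebesgue. norm ((indicator K x * g x) * \<phi> x) \<le> norm (B * (indicator K x * g x))"
    proof (rule AE_I2)
      fix x
      have "\<bar>indicator K x * g x\<bar> * \<bar>\<phi> x\<bar> \<le> \<bar>indicator K x * g x\<bar> * B" by (intro mult_left_mono B) auto
      then show "norm ((indicator K x * g x) * \<phi> x) \<le> norm (B * (indicator K x * g x))"
        using B(1) by (simp add: abs_mult mult_ac)
    qed
    show "(\<lambda>x. (indicator K x * g x) * \<phi> x) \<in> borel_measurable lebesgue"
      by (rule borel_measurable_times[OF borel_measurable_integrable[OF int] m\<phi>])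
  qed (use int in simp)
  moreover have "(\<lambda>x. (indicator K x * g x) * \<phi> x) = (\<lambda>x. indicator \<Omega> x *\<^sub>R (g x * \<phi> x))"
  proof
    fix x show "(indicator K x * g x) * \<phi> x = indicator \<Omega> x *\<^sub>R (g x * \<phi> x)"
      using K(2) K(3)[of x] by (cases "x \<in> K") (auto simp: indicator_def)
  qed
  ultimately show ?thesis using \<Omega> by (simp add: integrable_restrict_space)
qed

text \<open>Allowing u and u' to differ on a null set covers two uses: comparing the chosen
  derivative with a square-integrable one, and independence of the representative of u.\<close>

lemma weak_derivative_unique:
  assumes \<Omega>: "open \<Omega>" and g: "weak_derivative \<Omega> \<alpha> u g" and g': "weak_derivative \<Omega> \<alpha> u' g'"
    and ae: "AE x in lebesgue_on \<Omega>. u x = u' x"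
  shows "AE x in lebesgue_on \<Omega>. g x = g' x"
proof -
  obtain js where js: "count_list js = \<alpha>" using exists_list_with_counts by blast
  have loc: "locally_integrable \<Omega> g" "locally_integrable \<Omega> g'" "locally_integrable \<Omega> u" "locally_integrable \<Omega> u'"
    using g g' by (auto simp: weak_derivative_def)
  have "AE x in lebesgue_on \<Omega>. g x - g' x = 0"
  proof (rule AE_zero_if_test_integrals_zero[OF \<Omega>])
    show "locally_integrable \<Omega> (\<lambda>x. g x - g' x)"
      using loc by (simp add: locally_integrable_def)
    fix \<phi> assume \<phi>: "\<phi> \<in> smooth_compact \<Omega>"
    then have \<phi>t: "\<phi> \<in> test_functions \<Omega>" using smooth_compact_subset_test_functions by blast
    note d = smooth_compact_pderivatives[OF \<phi>, of js]
    have "(\<integral>x. u x * pderivatives js \<phi> x \<partial>lebesgue_on \<Omega>) = (\<integral>x. u' x * pderivatives js \<phi> x \<partial>lebesgue_on \<Omega>)"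
    proof (rule integral_cong_AE)
      show "AE x in lebesgue_on \<Omega>. u x * pderivatives js \<phi> x = u' x * pderivatives js \<phi> x"
        using ae by eventually_elim simp
    qed (intro borel_measurable_integrable integrable_locally_integrable_mult \<Omega> loc d)+
    then have "(- 1) ^ mindex_order \<alpha> * (\<integral>x. g x * \<phi> x \<partial>lebesgue_on \<Omega>)
      = (- 1) ^ mindex_order \<alpha> * (\<integral>x. g' x * \<phi> x \<partial>lebesgue_on \<Omega>)"
      using g g' \<phi>t js by (simp add: weak_derivative_def)
    then have "(\<integral>x. g x * \<phi> x \<partial>lebesgue_on \<Omega>) = (\<integral>x. g' x * \<phi> x \<partial>lebesgue_on \<Omega>)" by simp
    then show "(\<integral>x. (g x - g' x) * \<phi> x \<partial>lebesgue_on \<Omega>) = 0"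
      using integrable_locally_integrable_mult[OF \<Omega> loc(1) \<phi>] integrable_locally_integrable_mult[OF \<Omega> loc(2) \<phi>]
      by (simp add: left_diff_distrib)
  qed
  then show ?thesis by eventually_elim simp
qed

lemma L2_AE_cong:
  assumes \<Omega>: "open \<Omega>" and g: "g \<in> L2 \<Omega>" and ae: "AE x in lebesgue_on \<Omega>. f x = g x"
  shows "f \<in> L2 \<Omega>" "L2_norm \<Omega> f = L2_norm \<Omega> g"
proof -
  have gm: "g \<in> borel_measurable (lebesgue_on \<Omega>)" using g by (simp add: L2_def)
  have fm: "f \<in> borel_measurable (lebesgue_on \<Omega>)"
    by (rule borel_measurable_lebesgue_on_AE[OF gm _ ae]) (use \<Omega> in simp)
  have ae2: "AE x in lebesgue_on \<Omega>. (f x)\<^sup>2 = (g x)\<^sup>2" using ae by eventually_elim simp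
  have m2: "(\<lambda>x. (f x)\<^sup>2) \<in> borel_measurable (lebesgue_on \<Omega>)" "(\<lambda>x. (g x)\<^sup>2) \<in> borel_measurable (lebesgue_on \<Omega>)"
    using fm gm by simp_all
  show "f \<in> L2 \<Omega>"
    using g fm integrable_cong_AE[OF m2 ae2] by (simp add: L2_def)
  show "L2_norm \<Omega> f = L2_norm \<Omega> g"
    unfolding L2_norm_def using integral_cong_AE[OF m2 ae2] by simp
qed

text \<open>The choice in \<open>wderiv\<close> may pick a different function from the
  square-integrable one that \<open>Sobolev\<close> provides; uniqueness carries square
  integrability over.\<close>

lemma Sobolev_wderiv:
  assumes \<Omega>: "open \<Omega>" and u: "u \<in> Sobolev \<Omega> s" and \<alpha>: "mindex_order \<alpha> \<le> s"
  shows "weak_derivative \<Omega> \<alpha> u (wderiv \<Omega> \<alpha> u)" "wderiv \<Omega> \<alpha> u \<in> L2 \<Omega>"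
proof -
  obtain g where g: "g \<in> L2 \<Omega>" "weak_derivative \<Omega> \<alpha> u g" using u \<alpha> by (auto simp: Sobolev_def)
  show w: "weak_derivative \<Omega> \<alpha> u (wderiv \<Omega> \<alpha> u)"
    unfolding wderiv_def by (rule someI[of "weak_derivative \<Omega> \<alpha> u", OF g(2)])
  show "wderiv \<Omega> \<alpha> u \<in> L2 \<Omega>"
    by (rule L2_AE_cong(1)[OF \<Omega> g(1) weak_derivative_unique[OF \<Omega> w g(2)]]) simp
qed

lemma L2_norm_nonneg: "0 \<le> L2_norm \<Omega> u"
  by (simp add: L2_norm_def)

lemma Sobolev_norm_nonneg: "0 \<le> Sobolev_norm \<Omega> s u"
  by (simp add: Sobolev_norm_def sum_nonneg)

lemma L2_norm_wderiv_le:
  assumes "mindex_order \<alpha> \<le> s" shows "L2_norm \<Omega> (wderiv \<Omega> \<alpha> u) \<le> Sobolev_norm \<Omega> s u"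
proof -
  have "(L2_norm \<Omega> (wderiv \<Omega> \<alpha> u))\<^sup>2 \<le> (\<Sum>\<alpha> | mindex_order \<alpha> \<le> s. (L2_norm \<Omega> (wderiv \<Omega> \<alpha> u))\<^sup>2)"
    by (rule member_le_sum) (use assms finite_mindex_order_le in auto)
  then show ?thesis unfolding Sobolev_norm_def by (rule real_le_rsqrt)
qed

text \<open>Leads from Lebesgue-measurable classes on the domain to Borel functions on the whole
  space, where product measures and substitutions are used.\<close>

lemma L2_borel_representative:
  assumes \<Omega>: "open \<Omega>" "bounded \<Omega>" and g: "g \<in> L2 \<Omega>"
  shows "\<exists>g'. g' \<in> borel_measurable borel \<and> (\<forall>x. x \<notin> \<Omega> \<longrightarrow> g' x = 0)
    \<and> (AE x in lebesgue_on \<Omega>. g x = g' x) \<and> integrable lborel g'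
    \<and> (\<integral>\<^sup>+x. ennreal ((g' x)\<^sup>2) \<partial>lborel) = ennreal ((L2_norm \<Omega> g)\<^sup>2)"
proof -
  have \<Omega>s[measurable]: "\<Omega> \<in> sets borel" "\<Omega> \<in> sets lebesgue" using \<Omega> by simp_all
  have gm: "g \<in> borel_measurable (lebesgue_on \<Omega>)" and gi: "integrable (lebesgue_on \<Omega>) (\<lambda>x. (g x)\<^sup>2)"
    using g by (auto simp: L2_def)
  have "(\<lambda>x. indicator \<Omega> x *\<^sub>R g x) \<in> borel_measurable lebesgue"
    using gm \<Omega>s by (simp add: borel_measurable_restrict_space_iff)
  from completion_ex_borel_measurable_real[OF this]
  obtain h where h[measurable]: "h \<in> borel_measurable lborel" and hae: "AE x in lborel. indicator \<Omega> x *\<^sub>R g x = h x" by blast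
  define g' where "g' x = indicator \<Omega> x * h x" for x
  have [measurable]: "g' \<in> borel_measurable borel" unfolding g'_def[abs_def] using h by measurable
  have ae: "AE x in lborel. x \<in> \<Omega> \<longrightarrow> g x = g' x"
    using hae
  proof eventually_elim
    case (elim x)
    then show ?case by (cases "x \<in> \<Omega>") (auto simp: g'_def)
  qed
  have ae_on: "AE x in lebesgue_on \<Omega>. g x = g' x"
    using ae \<Omega>s by (simp add: AE_restrict_space_iff AE_completion_iff)
  have "ennreal ((L2_norm \<Omega> g)\<^sup>2) = ennreal (\<integral>x. (g x)\<^sup>2 \<partial>lebesgue_on \<Omega>)"
    by (simp add: L2_norm_def)
  also have "\<dots> = (\<integral>\<^sup>+x. ennreal ((g x)\<^sup>2) \<partial>lebesgue_on \<Omega>)"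
    by (rule nn_integral_eq_integral[symmetric, OF gi]) simp
  also have "\<dots> = (\<integral>\<^sup>+x. ennreal ((g' x)\<^sup>2) \<partial>lebesgue_on \<Omega>)"
    by (rule nn_integral_cong_AE) (use ae_on in \<open>eventually_elim, simp\<close>)
  also have "\<dots> = (\<integral>\<^sup>+x. ennreal ((g' x)\<^sup>2) * indicator \<Omega> x \<partial>lebesgue)"
    using \<Omega>s by (simp add: nn_integral_restrict_space)
  also have "\<dots> = (\<integral>\<^sup>+x. ennreal ((g' x)\<^sup>2) \<partial>lborel)"
    unfolding nn_integral_completion by (intro nn_integral_cong) (auto simp: g'_def indicator_def)
  finally have sq: "(\<integral>\<^sup>+x. ennreal ((g' x)\<^sup>2) \<partial>lborel) = ennreal ((L2_norm \<Omega> g)\<^sup>2)" by simp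
  have "integrable lborel g'"
  proof (rule Bochner_Integration.integrable_bound[where f = "\<lambda>x. indicator \<Omega> x + (g' x)\<^sup>2"])
    have "integrable lborel (indicator \<Omega> :: _ \<Rightarrow> real)"
      using emeasure_bounded_finite[OF \<Omega>(2)] by (simp add: integrable_indicator_iff less_top)
    moreover have "integrable lborel (\<lambda>x. (g' x)\<^sup>2)"
      by (rule integrableI_nonneg) (simp_all add: sq)
    ultimately show "integrable lborel (\<lambda>x. indicator \<Omega> x + (g' x)\<^sup>2)" by simp
    \<comment> \<open>On a bounded set this makes square-integrable functions integrable.\<close>
    have "\<bar>a\<bar> \<le> 1 + a\<^sup>2" for a :: real
      using sum_squares_ge_zero[of "\<bar>a\<bar> - 1/2" 0] by (simp add: power2_eq_square algebra_simps)
    then show "AE x in lborel. norm (g' x) \<le> norm (indicator \<Omega> x + (g' x)\<^sup>2)"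
      by (auto simp: g'_def indicator_def intro!: AE_I2)
  qed simp
  with sq ae_on show ?thesis by (intro exI[of _ g']) (auto simp: g'_def)
qed

lemma integral_lebesgue_on_eq_lborel:
  fixes h h' :: "'a::euclidean_space \<Rightarrow> real"
  assumes \<Omega>: "open \<Omega>" and h: "h \<in> borel_measurable (lebesgue_on \<Omega>)"
    and h': "h' \<in> borel_measurable borel" "\<And>x. x \<notin> \<Omega> \<Longrightarrow> h' x = 0"
    and ae: "AE x in lebesgue_on \<Omega>. h x = h' x"
  shows "integral\<^sup>L (lebesgue_on \<Omega>) h = integral\<^sup>L lborel h'"
proof -
  have h'm: "h' \<in> borel_measurable lebesgue" by (rule measurable_completion) (simp add: h')
  have "integral\<^sup>L (lebesgue_on \<Omega>) h = integral\<^sup>L (lebesgue_on \<Omega>) h'"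
    by (rule integral_cong_AE[OF h measurable_restrict_space1[OF h'm] ae])
  also have "\<dots> = (\<integral>x. indicator \<Omega> x *\<^sub>R h' x \<partial>lebesgue)"
    using \<Omega> by (simp add: integral_restrict_space)
  also have "\<dots> = (\<integral>x. h' x \<partial>lebesgue)"
    by (intro Bochner_Integration.integral_cong) (auto simp: indicator_def h')
  also have "\<dots> = integral\<^sup>L lborel h'"
    by (rule integral_completion) (simp add: h')
  finally show ?thesis .
qed

text \<open>Both derivatives are tested so that the same derivative of \<phi> falls on u: the lower
  one with the partial derivative of \<phi>, the higher one with \<phi> itself. Comparing signs
  gives integration by parts between the two.\<close>

lemma wderiv_weak_partial:
  assumes \<Omega>: "open \<Omega>" and u: "u \<in> Sobolev \<Omega> s" and \<alpha>: "mindex_order \<alpha> < s"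
    and D: "D \<in> borel_measurable borel" "\<And>x. x \<notin> \<Omega> \<Longrightarrow> D x = 0" "AE x in lebesgue_on \<Omega>. wderiv \<Omega> \<alpha> u x = D x"
    and D': "D' \<in> borel_measurable borel" "\<And>x. x \<notin> \<Omega> \<Longrightarrow> D' x = 0"
      "AE x in lebesgue_on \<Omega>. wderiv \<Omega> (\<alpha>(i := Suc (\<alpha> i))) u x = D' x"
  shows "weak_partial \<Omega> i D D'"
  unfolding weak_partial_def
proof
  fix \<phi> assume \<phi>: "\<phi> \<in> smooth_compact \<Omega>"
  let ?\<alpha>' = "\<alpha>(i := Suc (\<alpha> i))"
  have d\<phi>: "pderivative i \<phi> \<in> smooth_compact \<Omega>" by (rule smooth_compact_pderivative[OF \<phi>])
  have test: "\<phi> \<in> test_functions \<Omega>" "pderivative i \<phi> \<in> test_functions \<Omega>"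
    using \<phi> d\<phi> smooth_compact_subset_test_functions by blast+
  have [measurable]: "\<phi> \<in> borel_measurable borel" "pderivative i \<phi> \<in> borel_measurable borel"
    using \<phi> d\<phi> by (auto simp: smooth_compact_def intro: smooth_borel)
  note [measurable] = D(1) D'(1)
  have o: "mindex_order ?\<alpha>' = Suc (mindex_order \<alpha>)" by (rule mindex_order_Suc)
  have w: "weak_derivative \<Omega> \<alpha> u (wderiv \<Omega> \<alpha> u)"
    by (rule Sobolev_wderiv(1)[OF \<Omega> u]) (use \<alpha> in simp)
  have w': "weak_derivative \<Omega> ?\<alpha>' u (wderiv \<Omega> ?\<alpha>' u)"
    by (rule Sobolev_wderiv(1)[OF \<Omega> u]) (use \<alpha> in \<open>simp only: o\<close>)
  have loc: "locally_integrable \<Omega> (wderiv \<Omega> \<alpha> u)" "locally_integrable \<Omega> (wderiv \<Omega> ?\<alpha>' u)"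
    using w w' by (auto simp only: weak_derivative_def)
  obtain js where js: "count_list js = \<alpha>" using exists_list_with_counts by blast
  \<comment> \<open>The index i is appended at the end because \<open>pderivatives\<close> applies
    the last entry of the list first.\<close>
  have js': "count_list (js @ [i]) = ?\<alpha>'" by (rule ext) (simp add: js)
  have 1: "(\<integral>x. u x * pderivatives js (pderivative i \<phi>) x \<partial>lebesgue_on \<Omega>)
    = (- 1) ^ mindex_order \<alpha> * (\<integral>x. wderiv \<Omega> \<alpha> u x * pderivative i \<phi> x \<partial>lebesgue_on \<Omega>)"
    using w test(2) js unfolding weak_derivative_def by blast
  have 2: "(\<integral>x. u x * pderivatives (js @ [i]) \<phi> x \<partial>lebesgue_on \<Omega>)
    = (- 1) ^ mindex_order ?\<alpha>' * (\<integral>x. wderiv \<Omega> ?\<alpha>' u x * \<phi> x \<partial>lebesgue_on \<Omega>)"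
    using w' test(1) js' unfolding weak_derivative_def by blast
  have "pderivatives (js @ [i]) \<phi> = pderivatives js (pderivative i \<phi>)"
    by (simp add: pderivatives_append)
  with 1 2 have "(- 1) ^ mindex_order \<alpha> * (\<integral>x. wderiv \<Omega> \<alpha> u x * pderivative i \<phi> x \<partial>lebesgue_on \<Omega>)
    = (- 1) ^ mindex_order \<alpha> * (- (\<integral>x. wderiv \<Omega> ?\<alpha>' u x * \<phi> x \<partial>lebesgue_on \<Omega>))"
    unfolding o by simp
  then have "(\<integral>x. wderiv \<Omega> \<alpha> u x * pderivative i \<phi> x \<partial>lebesgue_on \<Omega>)
    = - (\<integral>x. wderiv \<Omega> ?\<alpha>' u x * \<phi> x \<partial>lebesgue_on \<Omega>)"
    unfolding mult_cancel_left by simp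
  moreover have "(\<integral>x. wderiv \<Omega> \<alpha> u x * pderivative i \<phi> x \<partial>lebesgue_on \<Omega>) = (\<integral>x. D x * pderivative i \<phi> x \<partial>lborel)"
  proof (rule integral_lebesgue_on_eq_lborel[OF \<Omega>])
    show "(\<lambda>x. wderiv \<Omega> \<alpha> u x * pderivative i \<phi> x) \<in> borel_measurable (lebesgue_on \<Omega>)"
      by (rule borel_measurable_integrable[OF integrable_locally_integrable_mult[OF \<Omega> loc(1) d\<phi>]])
    show "AE x in lebesgue_on \<Omega>. wderiv \<Omega> \<alpha> u x * pderivative i \<phi> x = D x * pderivative i \<phi> x"
      using D(3) by eventually_elim simp
  qed (simp_all add: D(2))
  moreover have "(\<integral>x. wderiv \<Omega> ?\<alpha>' u x * \<phi> x \<partial>lebesgue_on \<Omega>) = (\<integral>x. D' x * \<phi> x \<partial>lborel)"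
  proof (rule integral_lebesgue_on_eq_lborel[OF \<Omega>])
    show "(\<lambda>x. wderiv \<Omega> ?\<alpha>' u x * \<phi> x) \<in> borel_measurable (lebesgue_on \<Omega>)"
      by (rule borel_measurable_integrable[OF integrable_locally_integrable_mult[OF \<Omega> loc(2) \<phi>]])
    show "AE x in lebesgue_on \<Omega>. wderiv \<Omega> ?\<alpha>' u x * \<phi> x = D' x * \<phi> x"
      using D'(3) by eventually_elim simp
  qed (simp_all add: D'(2))
  ultimately show "(\<integral>x. D x * pderivative i \<phi> x \<partial>lborel) = - (\<integral>x. D' x * \<phi> x \<partial>lborel)" by simp
qed

lemma weak_partial_scale:
  "weak_partial \<Omega> i v w \<Longrightarrow> weak_partial \<Omega> i (\<lambda>x. c * v x) (\<lambda>x. c * w x)"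
  unfolding weak_partial_def mult.assoc integral_mult_right_zero by simp

section \<open>Embeddings into bounded functions and into Lp spaces\<close>

definition mindex_card :: "'n::finite itself \<Rightarrow> nat \<Rightarrow> nat" where
  "mindex_card _ s = card {\<alpha> :: 'n mindex. mindex_order \<alpha> \<le> s}"

lemma mindex_card_pos: "0 < mindex_card TYPE('n::finite) s"
proof -
  have "(\<lambda>i. 0) \<in> {\<alpha> :: 'n mindex. mindex_order \<alpha> \<le> s}" by (simp add: mindex_order_def)
  then show ?thesis unfolding mindex_card_def using finite_mindex_order_le card_gt_0_iff by blast
qed

text \<open>P is the sum of all derivatives up to order s in absolute value, divided by c.
  Cauchy-Schwarz over the m summands bounds its squared L2 norm by m times the squared Sobolev norm
  over c^2, whence the factor sqrt m. An arbitrary positive bound c is used because the norm itself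
  may be 0.\<close>

lemma Sobolev_normalized_representative:
  fixes \<Omega> :: "(real^'n::finite) set" and lo hi :: "real^'n"
  assumes \<Omega>: "open \<Omega>" "bounded \<Omega>" and patch: "cone_patch \<Omega> N lo hi T"
    and \<alpha>: "mindex_order \<alpha> + Suc n = s"
  shows "\<exists>C\<ge>0. \<forall>u\<in>Sobolev \<Omega> s. \<forall>c>0. sqrt (mindex_card TYPE('n) s) * Sobolev_norm \<Omega> s u \<le> c \<longrightarrow>
    (\<exists>P v. P \<in> borel_measurable borel \<and> (\<forall>y. 0 \<le> P y) \<and> (\<integral>\<^sup>+y. ennreal ((P y)\<^sup>2) \<partial>lborel) \<le> 1
      \<and> v \<in> borel_measurable borel \<and> (AE x in lebesgue_on \<Omega>. wderiv \<Omega> \<alpha> u x = c * v x)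
      \<and> (AE x in lborel. x \<in> N \<inter> \<Omega> \<longrightarrow> ennreal \<bar>v x\<bar> \<le> ennreal C * taylor_bound (cbox lo hi) P T n x 0))"
proof -
  have N: "open N" "box lo hi \<noteq> {}" "0 < T" "T \<le> 1"
    "\<And>x t z. x \<in> N \<Longrightarrow> x \<in> \<Omega> \<Longrightarrow> 0 < t \<Longrightarrow> t \<le> T \<Longrightarrow> z \<in> cbox lo hi \<Longrightarrow> x + t *\<^sub>R z \<in> \<Omega>"
    using patch by (auto simp: cone_patch_def)
  let ?M = "{\<alpha> :: 'n mindex. mindex_order \<alpha> \<le> s}" and ?m = "real (mindex_card TYPE('n) s)"
  have "\<exists>C\<ge>0. \<forall>s' (D :: 'n mindex \<Rightarrow> real^'n \<Rightarrow> real) P \<alpha> n. mindex_order \<alpha> + Suc n = s' \<longrightarrow> s' \<le> s \<longrightarrow> integrable lborel P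
      \<longrightarrow> (\<forall>\<alpha>. mindex_order \<alpha> \<le> s' \<longrightarrow> integrable lborel (D \<alpha>) \<and> (\<forall>y. \<bar>D \<alpha> y\<bar> \<le> P y))
      \<longrightarrow> (\<forall>\<alpha> i. mindex_order \<alpha> < s' \<longrightarrow> weak_partial \<Omega> i (D \<alpha>) (D (\<alpha>(i := Suc (\<alpha> i)))))
      \<longrightarrow> (AE x in lborel. x \<in> N \<inter> \<Omega> \<longrightarrow> ennreal \<bar>D \<alpha> x\<bar> \<le> ennreal C * taylor_bound (cbox lo hi) P T n x 0)"
    by (rule AE_le_taylor_bound[OF N(2,1,3,4) _ \<Omega>(1)]) (rule N(5))
  then obtain C where C: "C \<ge> 0" "\<forall>s' (D :: 'n mindex \<Rightarrow> real^'n \<Rightarrow> real) P \<alpha> n. mindex_order \<alpha> + Suc n = s' \<longrightarrow> s' \<le> s \<longrightarrow> integrable lborel P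
      \<longrightarrow> (\<forall>\<alpha>. mindex_order \<alpha> \<le> s' \<longrightarrow> integrable lborel (D \<alpha>) \<and> (\<forall>y. \<bar>D \<alpha> y\<bar> \<le> P y))
      \<longrightarrow> (\<forall>\<alpha> i. mindex_order \<alpha> < s' \<longrightarrow> weak_partial \<Omega> i (D \<alpha>) (D (\<alpha>(i := Suc (\<alpha> i)))))
      \<longrightarrow> (AE x in lborel. x \<in> N \<inter> \<Omega> \<longrightarrow> ennreal \<bar>D \<alpha> x\<bar> \<le> ennreal C * taylor_bound (cbox lo hi) P T n x 0)"
    by (elim exE conjE)
  show ?thesis
  proof (intro exI[of _ C] conjI ballI allI impI)
    show "0 \<le> C" by (rule C(1))
    fix u c assume u: "u \<in> Sobolev \<Omega> s" and c: "0 < c" and le: "sqrt ?m * Sobolev_norm \<Omega> s u \<le> c"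
    have "\<exists>g'. g' \<in> borel_measurable borel \<and> (\<forall>x. x \<notin> \<Omega> \<longrightarrow> g' x = 0)
      \<and> (AE x in lebesgue_on \<Omega>. wderiv \<Omega> \<beta> u x = g' x) \<and> integrable lborel g'
      \<and> (\<integral>\<^sup>+x. ennreal ((g' x)\<^sup>2) \<partial>lborel) = ennreal ((L2_norm \<Omega> (wderiv \<Omega> \<beta> u))\<^sup>2)"
      if "\<beta> \<in> ?M" for \<beta>
      using that by (intro L2_borel_representative \<Omega> Sobolev_wderiv(2)[OF \<Omega>(1) u]) simp
    then have "\<exists>D. \<forall>\<beta>\<in>?M. D \<beta> \<in> borel_measurable borel \<and> (\<forall>x. x \<notin> \<Omega> \<longrightarrow> D \<beta> x = 0)
      \<and> (AE x in lebesgue_on \<Omega>. wderiv \<Omega> \<beta> u x = D \<beta> x) \<and> integrable lborel (D \<beta>)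
      \<and> (\<integral>\<^sup>+x. ennreal ((D \<beta> x)\<^sup>2) \<partial>lborel) = ennreal ((L2_norm \<Omega> (wderiv \<Omega> \<beta> u))\<^sup>2)"
      by (intro bchoice ballI)
    then obtain D where D: "\<forall>\<beta>\<in>?M. D \<beta> \<in> borel_measurable borel \<and> (\<forall>x. x \<notin> \<Omega> \<longrightarrow> D \<beta> x = 0)
      \<and> (AE x in lebesgue_on \<Omega>. wderiv \<Omega> \<beta> u x = D \<beta> x) \<and> integrable lborel (D \<beta>)
      \<and> (\<integral>\<^sup>+x. ennreal ((D \<beta> x)\<^sup>2) \<partial>lborel) = ennreal ((L2_norm \<Omega> (wderiv \<Omega> \<beta> u))\<^sup>2)" by blast
    have Dm: "D \<beta> \<in> borel_measurable borel" and D0: "x \<notin> \<Omega> \<Longrightarrow> D \<beta> x = 0"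
      and Dae: "AE x in lebesgue_on \<Omega>. wderiv \<Omega> \<beta> u x = D \<beta> x" and Dint: "integrable lborel (D \<beta>)"
      and Dsq: "(\<integral>\<^sup>+x. ennreal ((D \<beta> x)\<^sup>2) \<partial>lborel) = ennreal ((L2_norm \<Omega> (wderiv \<Omega> \<beta> u))\<^sup>2)"
      if "mindex_order \<beta> \<le> s" for \<beta> x
      using D that by auto
    define E where "E \<beta> x = 1 / c * D \<beta> x" for \<beta> x
    define P where "P y = (\<Sum>\<beta>\<in>?M. \<bar>E \<beta> y\<bar>)" for y
    have Em: "E \<beta> \<in> borel_measurable borel" if "mindex_order \<beta> \<le> s" for \<beta>
      using Dm[OF that] unfolding E_def[abs_def] by simp
    have Pm: "P \<in> borel_measurable borel"
      unfolding P_def[abs_def] using Em by (intro borel_measurable_sum borel_measurable_abs) auto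
    have P0: "0 \<le> P y" for y by (simp add: P_def sum_nonneg)
    have Eint: "integrable lborel (E \<beta>)" if "mindex_order \<beta> \<le> s" for \<beta>
      using Dint[OF that] unfolding E_def[abs_def] by simp
    have Pint: "integrable lborel P"
      unfolding P_def[abs_def] using Eint by (intro Bochner_Integration.integrable_sum integrable_abs) auto
    have EP: "\<bar>E \<beta> y\<bar> \<le> P y" if "mindex_order \<beta> \<le> s" for \<beta> y
      unfolding P_def using that finite_mindex_order_le[of s] by (intro member_le_sum) auto
    have wp: "weak_partial \<Omega> i (E \<beta>) (E (\<beta>(i := Suc (\<beta> i))))" if \<beta>: "mindex_order \<beta> < s" for \<beta> i
    proof -
      have o: "mindex_order (\<beta>(i := Suc (\<beta> i))) \<le> s" using \<beta> by (simp only: mindex_order_Suc)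
      have \<beta>': "mindex_order \<beta> \<le> s" using \<beta> by simp
      show ?thesis
        unfolding E_def[abs_def]
        by (intro weak_partial_scale wderiv_weak_partial[OF \<Omega>(1) u \<beta>] Dm[OF o] Dm[OF \<beta>'] D0[OF o] D0[OF \<beta>'] Dae[OF o] Dae[OF \<beta>'])
    qed
    have P2: "(\<integral>\<^sup>+y. ennreal ((P y)\<^sup>2) \<partial>lborel) \<le> 1"
    proof -
      have "(P y)\<^sup>2 \<le> ?m * (\<Sum>\<beta>\<in>?M. (E \<beta> y)\<^sup>2)" for y
        using Cauchy_Schwarz_ineq_sum[of "\<lambda>_. 1" "\<lambda>\<beta>. \<bar>E \<beta> y\<bar>" ?M]
        by (simp add: P_def mindex_card_def)
      then have "(\<integral>\<^sup>+y. ennreal ((P y)\<^sup>2) \<partial>lborel) \<le> (\<integral>\<^sup>+y. ennreal ?m * (\<Sum>\<beta>\<in>?M. ennreal ((E \<beta> y)\<^sup>2)) \<partial>lborel)"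
        by (intro nn_integral_mono) (simp add: sum_ennreal ennreal_leI sum_nonneg flip: ennreal_mult')
      also have "\<dots> = ennreal ?m * (\<Sum>\<beta>\<in>?M. \<integral>\<^sup>+y. ennreal ((E \<beta> y)\<^sup>2) \<partial>lborel)"
        using Em by (subst nn_integral_cmult, simp, subst nn_integral_sum) auto
      also have "(\<Sum>\<beta>\<in>?M. \<integral>\<^sup>+y. ennreal ((E \<beta> y)\<^sup>2) \<partial>lborel) = (\<Sum>\<beta>\<in>?M. ennreal (1 / c\<^sup>2 * (L2_norm \<Omega> (wderiv \<Omega> \<beta> u))\<^sup>2))"
      proof (rule sum.cong[OF refl])
        fix \<beta> assume "\<beta> \<in> ?M"
        then have \<beta>: "mindex_order \<beta> \<le> s" by simp
        have "(\<integral>\<^sup>+y. ennreal ((E \<beta> y)\<^sup>2) \<partial>lborel) = (\<integral>\<^sup>+y. ennreal (1 / c\<^sup>2) * ennreal ((D \<beta> y)\<^sup>2) \<partial>lborel)"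
          by (intro nn_integral_cong) (simp add: E_def power_mult_distrib power_divide flip: ennreal_mult')
        also have "\<dots> = ennreal (1 / c\<^sup>2) * ennreal ((L2_norm \<Omega> (wderiv \<Omega> \<beta> u))\<^sup>2)"
          using Dm[OF \<beta>] by (subst nn_integral_cmult) (simp_all add: Dsq[OF \<beta>])
        also have "\<dots> = ennreal (1 / c\<^sup>2 * (L2_norm \<Omega> (wderiv \<Omega> \<beta> u))\<^sup>2)"
          by (rule ennreal_mult'[symmetric]) simp
        finally show "(\<integral>\<^sup>+y. ennreal ((E \<beta> y)\<^sup>2) \<partial>lborel) = ennreal (1 / c\<^sup>2 * (L2_norm \<Omega> (wderiv \<Omega> \<beta> u))\<^sup>2)" .
      qed
      also have "\<dots> = ennreal (\<Sum>\<beta>\<in>?M. 1 / c\<^sup>2 * (L2_norm \<Omega> (wderiv \<Omega> \<beta> u))\<^sup>2)"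
        by (rule sum_ennreal) simp
      also have "(\<Sum>\<beta>\<in>?M. 1 / c\<^sup>2 * (L2_norm \<Omega> (wderiv \<Omega> \<beta> u))\<^sup>2) = 1 / c\<^sup>2 * (Sobolev_norm \<Omega> s u)\<^sup>2"
        by (simp only: sum_distrib_left[symmetric] Sobolev_norm_def) (simp add: sum_nonneg)
      also have "ennreal ?m * ennreal (1 / c\<^sup>2 * (Sobolev_norm \<Omega> s u)\<^sup>2) = ennreal (?m * (1 / c\<^sup>2 * (Sobolev_norm \<Omega> s u)\<^sup>2))"
        by (rule ennreal_mult'[symmetric]) simp
      also have "\<dots> \<le> ennreal 1"
      proof (rule ennreal_leI)
        have "(sqrt ?m * Sobolev_norm \<Omega> s u)\<^sup>2 \<le> c\<^sup>2"
          by (rule power_mono[OF le]) (simp add: Sobolev_norm_nonneg)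
        then have "?m * (Sobolev_norm \<Omega> s u)\<^sup>2 \<le> c\<^sup>2" by (simp add: power_mult_distrib)
        then show "?m * (1 / c\<^sup>2 * (Sobolev_norm \<Omega> s u)\<^sup>2) \<le> 1" using c by (simp add: divide_le_eq)
      qed
      finally show ?thesis by simp
    qed
    have int_le: "\<forall>\<beta>. mindex_order \<beta> \<le> s \<longrightarrow> integrable lborel (E \<beta>) \<and> (\<forall>y. \<bar>E \<beta> y\<bar> \<le> P y)"
      using Eint EP by blast
    have wp': "\<forall>\<beta> i. mindex_order \<beta> < s \<longrightarrow> weak_partial \<Omega> i (E \<beta>) (E (\<beta>(i := Suc (\<beta> i))))"
      using wp by blast
    have "AE x in lborel. x \<in> N \<inter> \<Omega> \<longrightarrow> ennreal \<bar>E \<alpha> x\<bar> \<le> ennreal C * taylor_bound (cbox lo hi) P T n x 0"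
      by (rule C(2)[THEN spec[of _ s], THEN spec[of _ E], THEN spec[of _ P], THEN spec[of _ \<alpha>], THEN spec[of _ n],
          THEN mp, OF \<alpha>, THEN mp, OF order_refl, THEN mp, OF Pint, THEN mp, OF int_le, THEN mp, OF wp'])
    moreover have "AE x in lebesgue_on \<Omega>. wderiv \<Omega> \<alpha> u x = c * E \<alpha> x"
      using Dae[of \<alpha>] \<alpha> c by (auto simp: E_def)
    moreover have "E \<alpha> \<in> borel_measurable borel" using Em[of \<alpha>] \<alpha> by simp
    ultimately show "\<exists>P v. P \<in> borel_measurable borel \<and> (\<forall>y. 0 \<le> P y) \<and> (\<integral>\<^sup>+y. ennreal ((P y)\<^sup>2) \<partial>lborel) \<le> 1
      \<and> v \<in> borel_measurable borel \<and> (AE x in lebesgue_on \<Omega>. wderiv \<Omega> \<alpha> u x = c * v x)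
      \<and> (AE x in lborel. x \<in> N \<inter> \<Omega> \<longrightarrow> ennreal \<bar>v x\<bar> \<le> ennreal C * taylor_bound (cbox lo hi) P T n x 0)"
      using Pm P0 P2 by (intro exI[of _ P] exI[of _ "E \<alpha>"] conjI allI)
  qed
qed

lemma AE_lebesgue_on_cover:
  assumes "finite I" "\<Omega> \<subseteq> (\<Union>i\<in>I. N i)" "\<Omega> \<in> sets lebesgue"
    and "\<And>i. i \<in> I \<Longrightarrow> AE x in lebesgue_on \<Omega>. x \<in> N i \<longrightarrow> Q x"
  shows "AE x in lebesgue_on \<Omega>. Q x"
proof -
  have "AE x in lebesgue_on \<Omega>. \<forall>i\<in>I. x \<in> N i \<longrightarrow> Q x"
    unfolding AE_ball_countable[OF countable_finite[OF assms(1)]] using assms(4) by blast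
  moreover have "AE x in lebesgue_on \<Omega>. x \<in> \<Omega>"
    using AE_space[of "lebesgue_on \<Omega>"] by simp
  ultimately show ?thesis by eventually_elim (use assms(2) in blast)
qed

lemma AE_lebesgue_on_if_AE_lborel:
  assumes "AE x in lborel. x \<in> \<Omega> \<longrightarrow> Q x" "\<Omega> \<in> sets lebesgue"
  shows "AE x in lebesgue_on \<Omega>. Q x"
  using assms by (simp add: AE_restrict_space_iff AE_completion_iff)

lemma wderiv_zero_if_Sobolev_norm_zero:
  assumes \<Omega>: "open \<Omega>" and u: "u \<in> Sobolev \<Omega> s" and \<alpha>: "mindex_order \<alpha> \<le> s" and 0: "Sobolev_norm \<Omega> s u = 0"
  shows "AE x in lebesgue_on \<Omega>. wderiv \<Omega> \<alpha> u x = 0"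
proof -
  have i: "integrable (lebesgue_on \<Omega>) (\<lambda>x. (wderiv \<Omega> \<alpha> u x)\<^sup>2)"
    using Sobolev_wderiv(2)[OF \<Omega> u \<alpha>] by (simp add: L2_def)
  have "L2_norm \<Omega> (wderiv \<Omega> \<alpha> u) = 0"
    using L2_norm_wderiv_le[OF \<alpha>, of \<Omega> u] L2_norm_nonneg[of \<Omega> "wderiv \<Omega> \<alpha> u"] 0 by simp
  then have "(\<integral>x. (wderiv \<Omega> \<alpha> u x)\<^sup>2 \<partial>lebesgue_on \<Omega>) = 0" by (simp add: L2_norm_def)
  then show ?thesis using integral_nonneg_eq_0_iff_AE[OF i] by simp
qed

text \<open>With n + 1 = s - |\<alpha>| the hypothesis is the integrability condition of
  \<open>taylor_bound_bounded\<close>; the finitely many patches are then put together.\<close>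

lemma Sobolev_embedding_Linf:
  fixes \<Omega> :: "(real^'n::finite) set"
  assumes dom: "C1_domain \<Omega>" and \<alpha>: "mindex_order \<alpha> \<le> s" "real CARD('n) / 2 < real s - real (mindex_order \<alpha>)"
  shows "\<exists>K\<ge>0. \<forall>u\<in>Sobolev \<Omega> s. AE x in lebesgue_on \<Omega>. \<bar>wderiv \<Omega> \<alpha> u x\<bar> \<le> K * Sobolev_norm \<Omega> s u"
proof -
  have \<Omega>: "open \<Omega>" "bounded \<Omega>" "\<Omega> \<in> sets lebesgue" using dom by (auto simp: C1_domain_def)
  obtain I where I: "finite I" "\<Omega> \<subseteq> (\<Union>(N, lo, hi, T)\<in>I. N)" "\<forall>(N, lo, hi, T)\<in>I. cone_patch \<Omega> N lo hi T"
    using C1_domain_cone_patches[OF dom] by blast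
  have "mindex_order \<alpha> < s" using \<alpha> by (cases "mindex_order \<alpha> = s") auto
  then obtain n where n: "mindex_order \<alpha> + Suc n = s" using less_imp_add_positive[of "mindex_order \<alpha>" s] by (metis Suc_pred)
  have n2: "real CARD('n) / 2 < real n + 1" using \<alpha>(2) n by auto
  let ?c = "\<lambda>u. sqrt (mindex_card TYPE('n) s) * Sobolev_norm \<Omega> s u"
  have "\<exists>K\<ge>0. \<forall>u\<in>Sobolev \<Omega> s. 0 < ?c u \<longrightarrow> (AE x in lebesgue_on \<Omega>. x \<in> fst p \<longrightarrow> \<bar>wderiv \<Omega> \<alpha> u x\<bar> \<le> K * ?c u)"
    if "p \<in> I" for p
  proof -
    obtain N lo hi T where p: "p = (N, lo, hi, T)" by (cases p)
    with I(3) that have patch: "cone_patch \<Omega> N lo hi T" by auto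
    then have T: "0 < T" by (simp add: cone_patch_def)
    obtain C where C: "C \<ge> 0" "\<forall>u\<in>Sobolev \<Omega> s. \<forall>c>0. ?c u \<le> c \<longrightarrow>
      (\<exists>P v. P \<in> borel_measurable borel \<and> (\<forall>y. 0 \<le> P y) \<and> (\<integral>\<^sup>+y. ennreal ((P y)\<^sup>2) \<partial>lborel) \<le> 1
      \<and> v \<in> borel_measurable borel \<and> (AE x in lebesgue_on \<Omega>. wderiv \<Omega> \<alpha> u x = c * v x)
      \<and> (AE x in lborel. x \<in> N \<inter> \<Omega> \<longrightarrow> ennreal \<bar>v x\<bar> \<le> ennreal C * taylor_bound (cbox lo hi) P T n x 0))"
      using Sobolev_normalized_representative[OF \<Omega>(1,2) patch n] by (elim exE conjE)
    obtain K where K: "K \<ge> 0" "\<forall>P x. P \<in> borel_measurable borel \<longrightarrow> (\<forall>y. 0 \<le> P y) \<longrightarrow> (\<integral>\<^sup>+y. ennreal ((P y)\<^sup>2) \<partial>lborel) \<le> 1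
      \<longrightarrow> taylor_bound (cbox lo hi) P T n x 0 \<le> ennreal K"
      using taylor_bound_bounded[OF _ emeasure_lborel_cbox_finite T n2, of lo hi] by (auto elim!: exE)
    show ?thesis
    proof (intro exI[of _ "C * K"] conjI ballI impI)
      show "0 \<le> C * K" using C(1) K(1) by simp
      fix u assume u: "u \<in> Sobolev \<Omega> s" and pos: "0 < ?c u"
      obtain P v where Pv: "P \<in> borel_measurable borel" "\<forall>y. 0 \<le> P y" "(\<integral>\<^sup>+y. ennreal ((P y)\<^sup>2) \<partial>lborel) \<le> 1"
        and v: "AE x in lebesgue_on \<Omega>. wderiv \<Omega> \<alpha> u x = ?c u * v x"
        and vb: "AE x in lborel. x \<in> N \<inter> \<Omega> \<longrightarrow> ennreal \<bar>v x\<bar> \<le> ennreal C * taylor_bound (cbox lo hi) P T n x 0"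
        using C(2)[rule_format, OF u pos order_refl] by blast
      have "AE x in lborel. x \<in> \<Omega> \<longrightarrow> x \<in> N \<longrightarrow> \<bar>v x\<bar> \<le> C * K"
        using vb
      proof eventually_elim
        case (elim x)
        show ?case
        proof (intro impI)
          assume "x \<in> \<Omega>" "x \<in> N"
          with elim have "ennreal \<bar>v x\<bar> \<le> ennreal C * taylor_bound (cbox lo hi) P T n x 0" by simp
          also have "\<dots> \<le> ennreal C * ennreal K"
            using K(2)[rule_format, OF Pv(1) _ Pv(3)] Pv(2) by (intro mult_left_mono) auto
          also have "\<dots> = ennreal (C * K)" using C(1) by (rule ennreal_mult'[symmetric])
          finally show "\<bar>v x\<bar> \<le> C * K" using C(1) K(1) by simp
        qed
      qed
      then have "AE x in lebesgue_on \<Omega>. x \<in> N \<longrightarrow> \<bar>v x\<bar> \<le> C * K"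
        by (rule AE_lebesgue_on_if_AE_lborel[OF _ \<Omega>(3)])
      with v show "AE x in lebesgue_on \<Omega>. x \<in> fst p \<longrightarrow> \<bar>wderiv \<Omega> \<alpha> u x\<bar> \<le> C * K * ?c u"
      proof eventually_elim
        case (elim x)
        show ?case
        proof
          assume "x \<in> fst p"
          then have "\<bar>v x\<bar> \<le> C * K" using elim p by simp
          then have "?c u * \<bar>v x\<bar> \<le> ?c u * (C * K)" using pos by (intro mult_left_mono) auto
          moreover have "\<bar>wderiv \<Omega> \<alpha> u x\<bar> = ?c u * \<bar>v x\<bar>" by (simp only: elim(1) abs_mult[of "?c u"] abs_of_pos[OF pos])
          ultimately show "\<bar>wderiv \<Omega> \<alpha> u x\<bar> \<le> C * K * ?c u" by (simp only: mult.commute)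
        qed
      qed
    qed
  qed
  then have "\<exists>K. \<forall>p\<in>I. 0 \<le> K p \<and> (\<forall>u\<in>Sobolev \<Omega> s. 0 < ?c u \<longrightarrow>
      (AE x in lebesgue_on \<Omega>. x \<in> fst p \<longrightarrow> \<bar>wderiv \<Omega> \<alpha> u x\<bar> \<le> K p * ?c u))"
    by (intro bchoice ballI)
  then obtain K where "\<forall>p\<in>I. 0 \<le> K p \<and> (\<forall>u\<in>Sobolev \<Omega> s. 0 < ?c u \<longrightarrow>
      (AE x in lebesgue_on \<Omega>. x \<in> fst p \<longrightarrow> \<bar>wderiv \<Omega> \<alpha> u x\<bar> \<le> K p * ?c u))" ..
  then have K: "\<And>p. p \<in> I \<Longrightarrow> K p \<ge> 0" "\<And>p u. p \<in> I \<Longrightarrow> u \<in> Sobolev \<Omega> s \<Longrightarrow> 0 < ?c u \<Longrightarrow>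
      AE x in lebesgue_on \<Omega>. x \<in> fst p \<longrightarrow> \<bar>wderiv \<Omega> \<alpha> u x\<bar> \<le> K p * ?c u" by blast+
  \<comment> \<open>The sum serves as a common upper bound for the constants of all patches.\<close>
  let ?K = "(\<Sum>p\<in>I. K p) * sqrt (mindex_card TYPE('n) s)"
  show ?thesis
  proof (intro exI[of _ ?K] conjI ballI)
    show "0 \<le> ?K" using K(1) by (simp add: sum_nonneg)
    fix u assume u: "u \<in> Sobolev \<Omega> s"
    show "AE x in lebesgue_on \<Omega>. \<bar>wderiv \<Omega> \<alpha> u x\<bar> \<le> ?K * Sobolev_norm \<Omega> s u"
    \<comment> \<open>Normalising by the norm excludes norm 0, where the derivative vanishes almost
      everywhere anyway.\<close>
    proof (cases "Sobolev_norm \<Omega> s u = 0")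
      case True
      with wderiv_zero_if_Sobolev_norm_zero[OF \<Omega>(1) u \<alpha>(1)] show ?thesis by simp
    next
      case False
      then have "0 < Sobolev_norm \<Omega> s u" using Sobolev_norm_nonneg[of \<Omega> s u] by linarith
      moreover have "0 < sqrt (mindex_card TYPE('n) s)" using mindex_card_pos[where 'n = 'n, of s] by simp
      ultimately have pos: "0 < ?c u" by (rule mult_pos_pos[rotated])
      show ?thesis
      proof (rule AE_lebesgue_on_cover[OF I(1) _ \<Omega>(3), of fst])
        show "\<Omega> \<subseteq> (\<Union>p\<in>I. fst p)" using I(2) by (simp add: case_prod_beta)
        fix p assume p: "p \<in> I"
        have "K p * ?c u \<le> (\<Sum>p\<in>I. K p) * ?c u"
          using member_le_sum[OF p, of K] I(1) K(1) by (intro mult_right_mono less_imp_le[OF pos]) auto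
        also have "\<dots> = ?K * Sobolev_norm \<Omega> s u" by (rule mult.assoc[symmetric])
        finally have le: "K p * ?c u \<le> ?K * Sobolev_norm \<Omega> s u" .
        from K(2)[OF p u pos] show "AE x in lebesgue_on \<Omega>. x \<in> fst p \<longrightarrow> \<bar>wderiv \<Omega> \<alpha> u x\<bar> \<le> ?K * Sobolev_norm \<Omega> s u"
          by (rule eventually_mono) (use le in linarith)
      qed
    qed
  qed
qed

lemma nn_integral_lebesgue_on_le_cover:
  assumes "finite I" "\<Omega> \<subseteq> (\<Union>i\<in>I. N i)" "f \<in> borel_measurable (lebesgue_on \<Omega>)"
    and "\<And>i. i \<in> I \<Longrightarrow> N i \<in> sets borel"
  shows "(\<integral>\<^sup>+x. f x \<partial>lebesgue_on \<Omega>) \<le> (\<Sum>i\<in>I. \<integral>\<^sup>+x. f x * indicator (N i) x \<partial>lebesgue_on \<Omega>)"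
proof -
  have N: "indicator (N i) \<in> borel_measurable (lebesgue_on \<Omega>)" if "i \<in> I" for i
    by (rule measurable_restrict_space1, rule measurable_completion) (use assms(4)[OF that] in simp)
  have "(\<integral>\<^sup>+x. f x \<partial>lebesgue_on \<Omega>) \<le> (\<integral>\<^sup>+x. (\<Sum>i\<in>I. f x * indicator (N i) x) \<partial>lebesgue_on \<Omega>)"
  proof (rule nn_integral_mono)
    fix x assume "x \<in> space (lebesgue_on \<Omega>)"
    then obtain i where i: "i \<in> I" "x \<in> N i" using assms(2) by auto
    have "f x = f x * indicator (N i) x" using i by simp
    also have "\<dots> \<le> (\<Sum>i\<in>I. f x * indicator (N i) x)"
      by (rule member_le_sum[OF i(1)]) (use assms(1) in auto)
    finally show "f x \<le> (\<Sum>i\<in>I. f x * indicator (N i) x)" .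
  qed
  also have "\<dots> = (\<Sum>i\<in>I. \<integral>\<^sup>+x. f x * indicator (N i) x \<partial>lebesgue_on \<Omega>)"
    using assms(3) N by (intro nn_integral_sum borel_measurable_times_ennreal)
  finally show ?thesis .
qed

text \<open>Here 1/p = 1/2 - \<sigma>/d, the Sobolev exponent for \<sigma> derivatives in L2. The
  factor c powr p comes from writing the derivative as c times a normalised function, and the
  patches contribute additively to the integral.\<close>

lemma Sobolev_embedding_Lp:
  fixes \<Omega> :: "(real^'n::finite) set"
  assumes dom: "C1_domain \<Omega>" and \<alpha>: "mindex_order \<alpha> \<le> s"
    and \<sigma>: "0 < \<sigma>" "\<sigma> < real CARD('n) / 2" "\<sigma> \<le> real s - real (mindex_order \<alpha>)"
    and p: "p = real CARD('n) / (real CARD('n) / 2 - \<sigma>)"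
  shows "\<exists>K\<ge>0. \<forall>u\<in>Sobolev \<Omega> s. \<forall>c>0. Sobolev_norm \<Omega> s u \<le> c \<longrightarrow>
    (\<integral>\<^sup>+x. ennreal (\<bar>wderiv \<Omega> \<alpha> u x\<bar> powr p) \<partial>lebesgue_on \<Omega>) \<le> ennreal (K * c powr p)"
proof -
  have \<Omega>: "open \<Omega>" "bounded \<Omega>" "\<Omega> \<in> sets lebesgue" using dom by (auto simp: C1_domain_def)
  obtain I where I: "finite I" "\<Omega> \<subseteq> (\<Union>(N, lo, hi, T)\<in>I. N)" "\<forall>(N, lo, hi, T)\<in>I. cone_patch \<Omega> N lo hi T"
    using C1_domain_cone_patches[OF dom] by blast
  have "mindex_order \<alpha> < s" using \<alpha> \<sigma> by (cases "mindex_order \<alpha> = s") auto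
  then obtain n where n: "mindex_order \<alpha> + Suc n = s" using less_imp_add_positive[of "mindex_order \<alpha>" s] by (metis Suc_pred)
  have n2: "\<sigma> \<le> real n + 1" using \<sigma>(3) n by auto
  define \<mu> where "\<mu> = sqrt (mindex_card TYPE('n) s)"
  have \<mu>: "\<mu> > 0" using mindex_card_pos[where 'n = 'n, of s] by (simp add: \<mu>_def)
  have Nb: "fst p \<in> sets borel" if "p \<in> I" for p using that I(3) by (cases p) (auto simp: cone_patch_def)
  have "\<exists>K\<ge>0. \<forall>u\<in>Sobolev \<Omega> s. \<forall>c>0. \<mu> * Sobolev_norm \<Omega> s u \<le> c \<longrightarrow>
      (\<integral>\<^sup>+x. ennreal (\<bar>wderiv \<Omega> \<alpha> u x\<bar> powr p) * indicator (fst P) x \<partial>lebesgue_on \<Omega>) \<le> ennreal (K * c powr p)"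
    if "P \<in> I" for P
  proof -
    obtain N lo hi T where P: "P = (N, lo, hi, T)" by (cases P)
    with I(3) that have patch: "cone_patch \<Omega> N lo hi T" by auto
    then have T: "0 < T" "T \<le> 1" and box: "box lo hi \<noteq> {}" and N: "open N" by (auto simp: cone_patch_def)
    obtain C where C: "C \<ge> 0" "\<forall>u\<in>Sobolev \<Omega> s. \<forall>c>0. \<mu> * Sobolev_norm \<Omega> s u \<le> c \<longrightarrow>
      (\<exists>P v. P \<in> borel_measurable borel \<and> (\<forall>y. 0 \<le> P y) \<and> (\<integral>\<^sup>+y. ennreal ((P y)\<^sup>2) \<partial>lborel) \<le> 1
      \<and> v \<in> borel_measurable borel \<and> (AE x in lebesgue_on \<Omega>. wderiv \<Omega> \<alpha> u x = c * v x)
      \<and> (AE x in lborel. x \<in> N \<inter> \<Omega> \<longrightarrow> ennreal \<bar>v x\<bar> \<le> ennreal C * taylor_bound (cbox lo hi) P T n x 0))"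
      using Sobolev_normalized_representative[OF \<Omega>(1,2) patch n] unfolding \<mu>_def by (elim exE conjE)
    define q where "q = measure lborel (cbox lo hi)"
    have q: "emeasure lborel (cbox lo hi) = ennreal q"
      unfolding q_def using emeasure_lborel_cbox_finite[of lo hi] by (simp add: emeasure_eq_ennreal_measure)
    have "0 < emeasure lborel (cbox lo hi)"
      using emeasure_box_pos[OF box] by (rule order.strict_trans2) (simp add: emeasure_mono box_subset_cbox)
    then have q0: "0 < q" unfolding q by simp
    have fin: "emeasure lborel (N \<inter> \<Omega>) < \<infinity>"
      using emeasure_bounded_finite[of "N \<inter> \<Omega>"] \<Omega>(2) by (simp add: bounded_Int)
    have sets: "cbox lo hi \<in> sets borel" "N \<inter> \<Omega> \<in> sets borel" using N \<Omega>(1) by auto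
    from taylor_bound_Lp[OF sets q q0 fin T C(1) \<sigma>(1,2) n2 p]
    obtain K where K: "K \<ge> 0" "\<forall>P v. P \<in> borel_measurable borel \<longrightarrow> (\<forall>y. 0 \<le> P y) \<longrightarrow> (\<integral>\<^sup>+y. ennreal ((P y)\<^sup>2) \<partial>lborel) \<le> 1
      \<longrightarrow> v \<in> borel_measurable borel
      \<longrightarrow> (AE x in lborel. x \<in> N \<inter> \<Omega> \<longrightarrow> ennreal \<bar>v x\<bar> \<le> ennreal C * taylor_bound (cbox lo hi) P T n x 0)
      \<longrightarrow> (\<integral>\<^sup>+x. ennreal (indicator (N \<inter> \<Omega>) x * \<bar>v x\<bar> powr p) \<partial>lborel) \<le> ennreal K"
      by (elim exE conjE)
    show ?thesis
    proof (intro exI[of _ K] conjI ballI allI impI)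
      show "0 \<le> K" by (rule K(1))
      fix u c assume u: "u \<in> Sobolev \<Omega> s" and c: "0 < c" and le: "\<mu> * Sobolev_norm \<Omega> s u \<le> c"
      obtain P' v where Pv: "P' \<in> borel_measurable borel" "\<forall>y. 0 \<le> P' y" "(\<integral>\<^sup>+y. ennreal ((P' y)\<^sup>2) \<partial>lborel) \<le> 1"
        and vm: "v \<in> borel_measurable borel" and v: "AE x in lebesgue_on \<Omega>. wderiv \<Omega> \<alpha> u x = c * v x"
        and vb: "AE x in lborel. x \<in> N \<inter> \<Omega> \<longrightarrow> ennreal \<bar>v x\<bar> \<le> ennreal C * taylor_bound (cbox lo hi) P' T n x 0"
        using C(2)[rule_format, OF u c le] by blast
      have vK: "(\<integral>\<^sup>+x. ennreal (indicator (N \<inter> \<Omega>) x * \<bar>v x\<bar> powr p) \<partial>lborel) \<le> ennreal K"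
        using K(2) Pv vm vb by blast
      have "(\<integral>\<^sup>+x. ennreal (\<bar>wderiv \<Omega> \<alpha> u x\<bar> powr p) * indicator N x \<partial>lebesgue_on \<Omega>)
        = (\<integral>\<^sup>+x. ennreal (c powr p) * ennreal (indicator (N \<inter> \<Omega>) x * \<bar>v x\<bar> powr p) \<partial>lebesgue_on \<Omega>)"
      proof (rule nn_integral_cong_AE)
        have "AE x in lebesgue_on \<Omega>. x \<in> \<Omega>" using AE_space[of "lebesgue_on \<Omega>"] by simp
        with v show "AE x in lebesgue_on \<Omega>. ennreal (\<bar>wderiv \<Omega> \<alpha> u x\<bar> powr p) * indicator N x
            = ennreal (c powr p) * ennreal (indicator (N \<inter> \<Omega>) x * \<bar>v x\<bar> powr p)"
        proof eventually_elim
          case (elim x)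
          have "\<bar>wderiv \<Omega> \<alpha> u x\<bar> powr p = c powr p * \<bar>v x\<bar> powr p"
            using elim c by (simp add: abs_mult powr_mult)
          then show ?case using elim by (cases "x \<in> N") (simp_all add: ennreal_mult')
        qed
      qed
      also have "\<dots> = (\<integral>\<^sup>+x. ennreal (c powr p) * ennreal (indicator (N \<inter> \<Omega>) x * \<bar>v x\<bar> powr p) * indicator \<Omega> x \<partial>lebesgue)"
        using \<Omega>(3) by (simp add: nn_integral_restrict_space)
      also have "\<dots> = (\<integral>\<^sup>+x. ennreal (c powr p) * ennreal (indicator (N \<inter> \<Omega>) x * \<bar>v x\<bar> powr p) \<partial>lborel)"
        unfolding nn_integral_completion by (intro nn_integral_cong) (auto simp: indicator_def)
      also have "\<dots> = ennreal (c powr p) * (\<integral>\<^sup>+x. ennreal (indicator (N \<inter> \<Omega>) x * \<bar>v x\<bar> powr p) \<partial>lborel)"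
      proof (rule nn_integral_cmult)
        have "(\<lambda>x. ennreal (indicator S x * \<bar>v x\<bar> powr p)) \<in> borel_measurable borel" if "S \<in> sets borel" for S
          using that vm by measurable
        from this[OF sets(2)] show "(\<lambda>x. ennreal (indicator (N \<inter> \<Omega>) x * \<bar>v x\<bar> powr p)) \<in> borel_measurable lborel"
          by simp
      qed
      also have "\<dots> \<le> ennreal (c powr p) * ennreal K" by (intro mult_left_mono vK) simp
      also have "\<dots> = ennreal (K * c powr p)"
        by (simp only: mult.commute[of K]) (rule ennreal_mult'[symmetric], simp)
      finally show "(\<integral>\<^sup>+x. ennreal (\<bar>wderiv \<Omega> \<alpha> u x\<bar> powr p) * indicator (fst P) x \<partial>lebesgue_on \<Omega>) \<le> ennreal (K * c powr p)"
        by (simp add: P)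
    qed
  qed
  then have "\<exists>K. \<forall>P\<in>I. 0 \<le> K P \<and> (\<forall>u\<in>Sobolev \<Omega> s. \<forall>c>0. \<mu> * Sobolev_norm \<Omega> s u \<le> c \<longrightarrow>
      (\<integral>\<^sup>+x. ennreal (\<bar>wderiv \<Omega> \<alpha> u x\<bar> powr p) * indicator (fst P) x \<partial>lebesgue_on \<Omega>) \<le> ennreal (K P * c powr p))"
    by (intro bchoice ballI)
  then obtain K where "\<forall>P\<in>I. 0 \<le> K P \<and> (\<forall>u\<in>Sobolev \<Omega> s. \<forall>c>0. \<mu> * Sobolev_norm \<Omega> s u \<le> c \<longrightarrow>
      (\<integral>\<^sup>+x. ennreal (\<bar>wderiv \<Omega> \<alpha> u x\<bar> powr p) * indicator (fst P) x \<partial>lebesgue_on \<Omega>) \<le> ennreal (K P * c powr p))" ..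
  then have K: "\<And>P. P \<in> I \<Longrightarrow> K P \<ge> 0" "\<And>P u c. P \<in> I \<Longrightarrow> u \<in> Sobolev \<Omega> s \<Longrightarrow> 0 < c \<Longrightarrow> \<mu> * Sobolev_norm \<Omega> s u \<le> c \<Longrightarrow>
      (\<integral>\<^sup>+x. ennreal (\<bar>wderiv \<Omega> \<alpha> u x\<bar> powr p) * indicator (fst P) x \<partial>lebesgue_on \<Omega>) \<le> ennreal (K P * c powr p)"
    by simp_all
  let ?K = "(\<Sum>P\<in>I. K P) * \<mu> powr p"
  show ?thesis
  proof (intro exI[of _ ?K] conjI ballI allI impI)
    show "0 \<le> ?K" using K(1) by (simp add: sum_nonneg)
    fix u c assume u: "u \<in> Sobolev \<Omega> s" and c: "0 < c" and le: "Sobolev_norm \<Omega> s u \<le> c"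
    have wm: "wderiv \<Omega> \<alpha> u \<in> borel_measurable (lebesgue_on \<Omega>)"
      using Sobolev_wderiv(2)[OF \<Omega>(1) u \<alpha>] by (simp add: L2_def)
    have "(\<integral>\<^sup>+x. ennreal (\<bar>wderiv \<Omega> \<alpha> u x\<bar> powr p) \<partial>lebesgue_on \<Omega>)
      \<le> (\<Sum>P\<in>I. \<integral>\<^sup>+x. ennreal (\<bar>wderiv \<Omega> \<alpha> u x\<bar> powr p) * indicator (fst P) x \<partial>lebesgue_on \<Omega>)"
      by (rule nn_integral_lebesgue_on_le_cover[OF I(1)]) (use I(2) wm Nb in \<open>auto simp: case_prod_beta\<close>)
    also have "\<dots> \<le> (\<Sum>P\<in>I. ennreal (K P * (\<mu> * c) powr p))"
      using \<mu> c le by (intro sum_mono K(2) u) auto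
    also have "\<dots> = ennreal (\<Sum>P\<in>I. K P * (\<mu> * c) powr p)"
      by (rule sum_ennreal) (simp add: K(1))
    also have "(\<Sum>P\<in>I. K P * (\<mu> * c) powr p) = ?K * c powr p"
      using \<mu> c by (simp add: powr_mult sum_distrib_right mult.assoc)
    finally show "(\<integral>\<^sup>+x. ennreal (\<bar>wderiv \<Omega> \<alpha> u x\<bar> powr p) \<partial>lebesgue_on \<Omega>) \<le> ennreal (?K * c powr p)" .
  qed
qed

text \<open>The exponent is 2 q because the q-th power of a derivative has to be square integrable.
  For q = 1 this is the L2 bound itself; for q > 1 it is the Lp embedding with a suitable fractional
  number \<sigma> of derivatives.\<close>

lemma Sobolev_embedding_admissible:
  fixes \<Omega> :: "(real^'n::finite) set"
  assumes dom: "C1_domain \<Omega>" and \<alpha>: "mindex_order \<alpha> \<le> s" "real s - real (mindex_order \<alpha>) \<le> real CARD('n) / 2"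
    and q: "admissible_exponent s \<alpha> q"
  shows "\<exists>K\<ge>0. \<forall>u\<in>Sobolev \<Omega> s. \<forall>c>0. Sobolev_norm \<Omega> s u \<le> c \<longrightarrow>
    (\<integral>\<^sup>+x. ennreal (\<bar>wderiv \<Omega> \<alpha> u x\<bar> powr (2 * q)) \<partial>lebesgue_on \<Omega>) \<le> ennreal (K * c powr (2 * q))"
proof (cases "q = 1")
  case True
  have \<Omega>: "open \<Omega>" using dom by (simp add: C1_domain_def)
  show ?thesis
  proof (intro exI[of _ 1] conjI ballI allI impI)
    fix u c assume u: "u \<in> Sobolev \<Omega> s" and c: "0 < c" and le: "Sobolev_norm \<Omega> s u \<le> c"
    let ?w = "wderiv \<Omega> \<alpha> u"
    have i: "integrable (lebesgue_on \<Omega>) (\<lambda>x. (?w x)\<^sup>2)"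
      using Sobolev_wderiv(2)[OF \<Omega> u \<alpha>(1)] by (simp add: L2_def)
    have sq: "\<bar>y\<bar> powr (2 * q) = y\<^sup>2" for y :: real
      using True by simp
    have "(\<integral>\<^sup>+x. ennreal (\<bar>?w x\<bar> powr (2 * q)) \<partial>lebesgue_on \<Omega>) = ennreal (\<integral>x. (?w x)\<^sup>2 \<partial>lebesgue_on \<Omega>)"
      unfolding sq by (rule nn_integral_eq_integral[OF i]) simp
    also have "\<dots> = ennreal ((L2_norm \<Omega> ?w)\<^sup>2)" by (simp add: L2_norm_def)
    also have "\<dots> \<le> ennreal (c\<^sup>2)"
      using L2_norm_wderiv_le[OF \<alpha>(1), of \<Omega> u] L2_norm_nonneg[of \<Omega> ?w] le by (intro ennreal_leI power_mono) auto
    also have "c\<^sup>2 = 1 * c powr (2 * q)" using sq[of c] c by simp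
    finally show "(\<integral>\<^sup>+x. ennreal (\<bar>?w x\<bar> powr (2 * q)) \<partial>lebesgue_on \<Omega>) \<le> ennreal (1 * c powr (2 * q))" .
  qed simp
next
  case False
  let ?d = "real CARD('n)" and ?r = "real s - real (mindex_order \<alpha>)"
  have q1: "q > 1" and qle: "0 < ?d - 2 * ?r \<Longrightarrow> q \<le> ?d / (?d - 2 * ?r)"
    using q False by (auto simp: admissible_exponent_def Let_def)
  \<comment> \<open>The solution of 2 q = d / (d/2 - \<sigma>). With r = s - |\<alpha>|, the bound q
    \<le> d / (d - 2 r) is then the same as \<sigma> \<le> r.\<close>
  define \<sigma> where "\<sigma> = ?d / 2 * (1 - 1 / q)"
  have d: "?d > 0" by simp
  have "0 < 1 - 1 / q" "1 - 1 / q < 1" using q1 by auto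
  then have \<sigma>: "0 < \<sigma>" "\<sigma> < ?d / 2" unfolding \<sigma>_def using d by auto
  have e: "?d / 2 - \<sigma> = ?d / (2 * q)" using q1 by (simp add: \<sigma>_def field_simps)
  have "\<sigma> \<le> ?r"
  proof (cases "0 < ?d - 2 * ?r")
    case True
    have "q * (?d - 2 * ?r) \<le> ?d" using qle[OF True] True by (simp add: pos_le_divide_eq)
    then have "(?d - 2 * ?r) \<le> ?d / q" using q1 by (simp add: pos_le_divide_eq mult.commute)
    moreover have "?d / q = 2 * (?d / 2 - \<sigma>)" unfolding e by simp
    ultimately show ?thesis by simp
  next
    case False
    \<comment> \<open>The borderline r = d/2, in which q is unbounded: \<sigma> < d/2 always
      holds.\<close>
    then show ?thesis using \<sigma>(2) \<alpha>(2) by simp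
  qed
  moreover have "2 * q = ?d / (?d / 2 - \<sigma>)" unfolding e using q1 d by simp
  ultimately show ?thesis using Sobolev_embedding_Lp[OF dom \<alpha>(1) \<sigma>] by blast
qed

subsection \<open>The Nemytskii operator\<close>

lemma tendsto_fun_if_componentwise:
  fixes f :: "'c \<Rightarrow> 'a \<Rightarrow> 'b::topological_space"
  assumes "\<And>i. ((\<lambda>n. f n i) \<longlongrightarrow> l i) F"
  shows "(f \<longlongrightarrow> l) F"
proof (rule topological_tendstoI)
  fix S :: "('a \<Rightarrow> 'b) set" assume S: "open S" "l \<in> S"
  then have "openin (product_topology (\<lambda>i. euclidean) UNIV) S" by (simp add: open_fun_def)
  from product_topology_open_contains_basis[OF this S(2)]
  obtain X where "\<forall>i. openin euclidean (X i)" "finite {i. X i \<noteq> topspace (euclidean :: 'b topology)}"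
    and X0: "l \<in> (\<Pi>\<^sub>E i\<in>UNIV. X i)" "(\<Pi>\<^sub>E i\<in>UNIV. X i) \<subseteq> S"
    by blast
  then have X: "l \<in> (\<Pi>\<^sub>E i\<in>UNIV. X i)" "\<And>i. open (X i)" "finite {i. X i \<noteq> UNIV}" "(\<Pi>\<^sub>E i\<in>UNIV. X i) \<subseteq> S"
    by simp_all
  have "\<forall>\<^sub>F n in F. \<forall>i\<in>{i. X i \<noteq> UNIV}. f n i \<in> X i"
    unfolding eventually_ball_finite_distrib[OF X(3)]
  proof
    fix i
    have "l i \<in> X i" using X(1) by (simp add: PiE_iff)
    then show "\<forall>\<^sub>F n in F. f n i \<in> X i" by (rule topological_tendstoD[OF assms X(2)])
  qed
  then show "\<forall>\<^sub>F n in F. f n \<in> S"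
  proof eventually_elim
    case (elim n)
    then have "f n \<in> (\<Pi>\<^sub>E i\<in>UNIV. X i)" by (auto simp: PiE_iff)
    with X(4) show ?case by blast
  qed
qed

text \<open>Jets are rounded down to a countable grid, so that a Caratheodory function evaluated at a
  measurable jet is a pointwise limit of countably-valued selections.\<close>

definition int_jets :: "nat \<Rightarrow> ('n::finite mindex \<Rightarrow> int) set" where
  "int_jets j = {g. \<forall>\<alpha>. j < mindex_order \<alpha> \<longrightarrow> g \<alpha> = 0}"

lemma countable_int_jets: "countable (int_jets j :: ('n::finite mindex \<Rightarrow> int) set)"
proof -
  let ?A = "{\<alpha> :: 'n mindex. mindex_order \<alpha> \<le> j}"
  have "inj_on (\<lambda>g. restrict g ?A) (int_jets j)"
  proof (rule inj_onI, rule ext)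
    fix g h :: "'n mindex \<Rightarrow> int" and \<alpha>
    assume gh: "g \<in> int_jets j" "h \<in> int_jets j" "restrict g ?A = restrict h ?A"
    show "g \<alpha> = h \<alpha>"
    proof (cases "mindex_order \<alpha> \<le> j")
      case True
      then show ?thesis using fun_cong[OF gh(3), of \<alpha>] by simp
    qed (use gh(1,2) in \<open>auto simp: int_jets_def\<close>)
  qed
  moreover have "countable ((\<lambda>g. restrict g ?A) ` int_jets j)"
    by (rule countable_subset[of _ "?A \<rightarrow>\<^sub>E UNIV"]) (auto intro!: countable_PiE finite_mindex_order_le split: if_splits)
  ultimately show ?thesis using countable_image_inj_on by blast
qed

definition grid_point :: "nat \<Rightarrow> ('n mindex \<Rightarrow> int) \<Rightarrow> 'n jet" where
  "grid_point n g = (\<lambda>\<alpha>. real_of_int (g \<alpha>) / real (Suc n))"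

definition grid_floor :: "nat \<Rightarrow> 'n jet \<Rightarrow> 'n mindex \<Rightarrow> int" where
  "grid_floor n \<xi> = (\<lambda>\<alpha>. \<lfloor>\<xi> \<alpha> * real (Suc n)\<rfloor>)"

lemma grid_point_jet_space: "g \<in> int_jets j \<Longrightarrow> grid_point n g \<in> jet_space j"
  by (auto simp: int_jets_def jet_space_def grid_point_def)

lemma grid_floor_int_jets: "\<xi> \<in> jet_space j \<Longrightarrow> grid_floor n \<xi> \<in> int_jets j"
  by (auto simp: int_jets_def jet_space_def grid_floor_def)

lemma grid_tendsto: "(\<lambda>n. grid_point n (grid_floor n \<xi>)) \<longlonglongrightarrow> \<xi>"
proof (rule tendsto_fun_if_componentwise)
  fix \<alpha>
  show "(\<lambda>n. grid_point n (grid_floor n \<xi>) \<alpha>) \<longlonglongrightarrow> \<xi> \<alpha>"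
  proof (rule LIMSEQ_I)
    fix e :: real assume "0 < e"
    then obtain N where N: "inverse (real (Suc N)) < e" using reals_Archimedean by blast
    have "norm (grid_point n (grid_floor n \<xi>) \<alpha> - \<xi> \<alpha>) < e" if "n \<ge> N" for n
    proof -
      let ?y = "\<xi> \<alpha> * real (Suc n)"
      have S: "real (Suc n) > 0" by simp
      have "\<xi> \<alpha> = ?y / real (Suc n)" using S by (intro nonzero_mult_div_cancel_right[symmetric]) linarith
      then have "grid_point n (grid_floor n \<xi>) \<alpha> - \<xi> \<alpha> = real_of_int \<lfloor>?y\<rfloor> / real (Suc n) - ?y / real (Suc n)"
        unfolding grid_point_def grid_floor_def by linarith
      also have "\<dots> = (real_of_int \<lfloor>?y\<rfloor> - ?y) / real (Suc n)" by (rule diff_divide_distrib[symmetric])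
      finally have "norm (grid_point n (grid_floor n \<xi>) \<alpha> - \<xi> \<alpha>) = \<bar>real_of_int \<lfloor>?y\<rfloor> - ?y\<bar> / real (Suc n)"
        using S by (simp only: real_norm_def abs_divide abs_of_pos)
      also have "\<dots> \<le> 1 / real (Suc n)" using S by (intro divide_right_mono) linarith+
      also have "\<dots> \<le> inverse (real (Suc N))"
        using that by (simp add: inverse_eq_divide frac_le)
      finally show ?thesis using N by linarith
    qed
    then show "\<exists>no. \<forall>n\<ge>no. norm (grid_point n (grid_floor n \<xi>) \<alpha> - \<xi> \<alpha>) < e" by blast
  qed
qed

lemma grid_floor_measurable:
  assumes \<xi>: "\<And>\<alpha>. (\<lambda>x. \<xi> x \<alpha>) \<in> borel_measurable M" "\<And>x. \<xi> x \<in> jet_space j"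
  shows "(\<lambda>x. grid_floor n (\<xi> x)) \<in> measurable M (count_space (int_jets j))"
  unfolding measurable_count_space_eq_countable[OF countable_int_jets]
proof (intro conjI ballI)
  show "(\<lambda>x. grid_floor n (\<xi> x)) \<in> space M \<rightarrow> int_jets j" using \<xi>(2) grid_floor_int_jets by blast
  fix g :: "'a mindex \<Rightarrow> int" assume g: "g \<in> int_jets j"
  let ?A = "{\<alpha> :: 'a mindex. mindex_order \<alpha> \<le> j}"
  \<comment> \<open>Beyond order j both sides are 0, so only finitely many coordinates have to be
    compared.\<close>
  have eq: "grid_floor n (\<xi> x) = g \<longleftrightarrow> (\<forall>\<alpha>\<in>?A. \<lfloor>\<xi> x \<alpha> * real (Suc n)\<rfloor> = g \<alpha>)" for x
  proof
    assume h: "\<forall>\<alpha>\<in>?A. \<lfloor>\<xi> x \<alpha> * real (Suc n)\<rfloor> = g \<alpha>"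
    show "grid_floor n (\<xi> x) = g"
    proof
      fix \<alpha> show "grid_floor n (\<xi> x) \<alpha> = g \<alpha>"
      proof (cases "mindex_order \<alpha> \<le> j")
        case True
        then show ?thesis using h unfolding grid_floor_def by blast
      next
        case False
        then show ?thesis using grid_floor_int_jets[OF \<xi>(2)[of x], of n] g by (simp add: int_jets_def)
      qed
    qed
  next
    assume "grid_floor n (\<xi> x) = g"
    then have "grid_floor n (\<xi> x) \<alpha> = g \<alpha>" for \<alpha> by (rule fun_cong)
    then show "\<forall>\<alpha>\<in>?A. \<lfloor>\<xi> x \<alpha> * real (Suc n)\<rfloor> = g \<alpha>" unfolding grid_floor_def by blast
  qed
  have "{x \<in> space M. \<forall>\<alpha>\<in>?A. \<lfloor>\<xi> x \<alpha> * real (Suc n)\<rfloor> = g \<alpha>} \<in> sets M"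
  proof (rule sets.sets_Collect_finite_All'[OF _ finite_mindex_order_le])
    fix \<alpha>
    note [measurable] = \<xi>(1)
    show "{x \<in> space M. \<lfloor>\<xi> x \<alpha> * real (Suc n)\<rfloor> = g \<alpha>} \<in> sets M" by measurable
    have "(\<lambda>_. 0) \<in> ?A" by (simp add: mindex_order_def)
    then show "?A \<noteq> {}" by blast
  qed
  moreover have "(\<lambda>x. grid_floor n (\<xi> x)) -` {g} \<inter> space M = {x \<in> space M. grid_floor n (\<xi> x) = g}"
    by blast
  ultimately show "(\<lambda>x. grid_floor n (\<xi> x)) -` {g} \<inter> space M \<in> sets M" by (simp only: eq)
qed

lemma caratheodory_measurable:
  fixes \<Omega> :: "(real^'n::finite) set"
  assumes c: "caratheodory \<Omega> k l c" and \<Omega>: "\<Omega> \<in> sets lebesgue"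
    and \<xi>: "\<And>\<alpha>. (\<lambda>x. \<xi> x \<alpha>) \<in> borel_measurable (lebesgue_on \<Omega>)" "\<And>x. \<xi> x \<in> jet_space k"
    and \<zeta>: "\<And>\<alpha>. (\<lambda>x. \<zeta> x \<alpha>) \<in> borel_measurable (lebesgue_on \<Omega>)" "\<And>x. \<zeta> x \<in> jet_space l"
  shows "(\<lambda>x. c x (\<xi> x) (\<zeta> x)) \<in> borel_measurable (lebesgue_on \<Omega>)"
proof -
  let ?M = "lebesgue_on \<Omega>"
  let ?\<xi> = "\<lambda>n x. grid_point n (grid_floor n (\<xi> x))" and ?\<zeta> = "\<lambda>n x. grid_point n (grid_floor n (\<zeta> x))"
  have cm: "(\<lambda>x. c x a b) \<in> borel_measurable ?M" if "a \<in> jet_space k" "b \<in> jet_space l" for a b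
    using c that by (simp add: caratheodory_def)
  \<comment> \<open>Grid jets take countably many values, so the selection is made in two nested
    stages: first in the second argument with the first one frozen at a grid point, then in the
    first.\<close>
  have step: "(\<lambda>x. c x (?\<xi> n x) (?\<zeta> n x)) \<in> borel_measurable ?M" for n
  proof -
    have inner: "(\<lambda>x. c x (grid_point n g) (?\<zeta> n x)) \<in> borel_measurable ?M" if g: "g \<in> int_jets k" for g
    proof (rule measurable_compose_countable'[where f = "\<lambda>h x. c x (grid_point n g) (grid_point n h)"
          and g = "\<lambda>x. grid_floor n (\<zeta> x)" and I = "int_jets l"])
      show "(\<lambda>x. c x (grid_point n g) (grid_point n h)) \<in> borel_measurable ?M" if "h \<in> int_jets l" for h
        by (rule cm[OF grid_point_jet_space[OF g] grid_point_jet_space[OF that]])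
      show "(\<lambda>x. grid_floor n (\<zeta> x)) \<in> measurable ?M (count_space (int_jets l))"
        by (rule grid_floor_measurable[OF \<zeta>])
    qed (rule countable_int_jets)
    show ?thesis
    proof (rule measurable_compose_countable'[where f = "\<lambda>g x. c x (grid_point n g) (?\<zeta> n x)"
          and g = "\<lambda>x. grid_floor n (\<xi> x)" and I = "int_jets k"])
      show "(\<lambda>x. grid_floor n (\<xi> x)) \<in> measurable ?M (count_space (int_jets k))"
        by (rule grid_floor_measurable[OF \<xi>])
      show "(\<lambda>x. c x (grid_point n g) (?\<zeta> n x)) \<in> borel_measurable ?M" if "g \<in> int_jets k" for g
        by (rule inner[OF that])
    qed (rule countable_int_jets)
  qed
  have "AE x in ?M. continuous_on (jet_space k \<times> jet_space l) (\<lambda>(\<xi>, \<zeta>). c x \<xi> \<zeta>)"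
    using c by (simp add: caratheodory_def)
  then obtain Z where Z: "Z \<in> null_sets ?M"
    and cont: "{x \<in> space ?M. \<not> continuous_on (jet_space k \<times> jet_space l) (\<lambda>(\<xi>, \<zeta>). c x \<xi> \<zeta>)} \<subseteq> Z"
    unfolding eventually_ae_filter by blast
  \<comment> \<open>Multiplying by the indicator of the complement of Z makes the convergence hold
    at every point, as a measurable limit requires; the null set is repaired by completeness
    afterwards.\<close>
  have lim: "(\<lambda>n. indicator (- Z) x * c x (?\<xi> n x) (?\<zeta> n x)) \<longlonglongrightarrow> indicator (- Z) x * c x (\<xi> x) (\<zeta> x)"
    if x: "x \<in> space ?M" for x
  proof (cases "x \<in> Z")
    case False
    with cont x have "continuous_on (jet_space k \<times> jet_space l) (\<lambda>(\<xi>, \<zeta>). c x \<xi> \<zeta>)" by blast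
    moreover have "(\<lambda>n. (?\<xi> n x, ?\<zeta> n x)) \<longlonglongrightarrow> (\<xi> x, \<zeta> x)" by (intro tendsto_Pair grid_tendsto)
    moreover have "(\<xi> x, \<zeta> x) \<in> jet_space k \<times> jet_space l" using \<xi>(2) \<zeta>(2) by simp
    moreover have "\<forall>\<^sub>F n in sequentially. (?\<xi> n x, ?\<zeta> n x) \<in> jet_space k \<times> jet_space l"
      by (intro always_eventually allI SigmaI grid_point_jet_space grid_floor_int_jets \<xi>(2) \<zeta>(2))
    ultimately have "(\<lambda>n. (\<lambda>(\<xi>, \<zeta>). c x \<xi> \<zeta>) (?\<xi> n x, ?\<zeta> n x)) \<longlonglongrightarrow> (\<lambda>(\<xi>, \<zeta>). c x \<xi> \<zeta>) (\<xi> x, \<zeta> x)"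
      by (rule continuous_on_tendsto_compose)
    then have "(\<lambda>n. c x (?\<xi> n x) (?\<zeta> n x)) \<longlonglongrightarrow> c x (\<xi> x) (\<zeta> x)" by (simp only: case_prod_conv)
    then show ?thesis by (rule tendsto_mult[OF tendsto_const])
  qed simp
  have Zs: "Z \<in> sets ?M" using Z by auto
  have m: "(\<lambda>x. indicator (- Z) x * c x (\<xi> x) (\<zeta> x)) \<in> borel_measurable ?M"
  proof (rule borel_measurable_LIMSEQ_real[OF lim])
    fix n
    have "(\<lambda>x. (1 - indicator Z x) * c x (?\<xi> n x) (?\<zeta> n x)) \<in> borel_measurable ?M"
      by (intro borel_measurable_times borel_measurable_diff borel_measurable_const borel_measurable_indicator Zs step)
    moreover have "indicator (- Z) x = (1 - indicator Z x :: real)" for x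
      by (simp add: indicator_def)
    ultimately show "(\<lambda>x. indicator (- Z) x * c x (?\<xi> n x) (?\<zeta> n x)) \<in> borel_measurable ?M"
      by (simp only:)
  qed
  have ae: "AE x in ?M. c x (\<xi> x) (\<zeta> x) = indicator (- Z) x * c x (\<xi> x) (\<zeta> x)"
    using AE_not_in[OF Z]
  proof eventually_elim
    case (elim x)
    then have "indicator (- Z) x = (1 :: real)" by simp
    then show ?case by (simp only: mult_1)
  qed
  show ?thesis by (rule borel_measurable_lebesgue_on_AE[OF m \<Omega> ae])
qed

section \<open>Jets of Sobolev functions\<close>

lemma jet_jet_space: "jet \<Omega> j u x \<in> jet_space j"
  by (simp add: jet_def jet_space_def)

lemma wderiv_measurable:
  "open \<Omega> \<Longrightarrow> u \<in> Sobolev \<Omega> s \<Longrightarrow> mindex_order \<alpha> \<le> s \<Longrightarrow> wderiv \<Omega> \<alpha> u \<in> borel_measurable (lebesgue_on \<Omega>)"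
  using Sobolev_wderiv(2)[of \<Omega> u s \<alpha>] by (simp add: L2_def)

lemma nemytskii_measurable:
  assumes \<Omega>: "open \<Omega>" and c: "caratheodory \<Omega> k l c" and u: "u \<in> Sobolev \<Omega> s" "k \<le> s" and f: "f \<in> Sobolev \<Omega> l"
  shows "nemytskii \<Omega> k l c u f \<in> borel_measurable (lebesgue_on \<Omega>)"
proof -
  have m: "(\<lambda>x. jet \<Omega> j v x \<alpha>) \<in> borel_measurable (lebesgue_on \<Omega>)" if "v \<in> Sobolev \<Omega> s'" "j \<le> s'" for v \<alpha> j s'
    using wderiv_measurable[OF \<Omega> that(1), of \<alpha>] that(2) by (cases "mindex_order \<alpha> \<le> j") (simp_all add: jet_def)
  have "(\<lambda>x. c x (jet \<Omega> k u x) (jet \<Omega> l f x)) \<in> borel_measurable (lebesgue_on \<Omega>)"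
  proof (rule caratheodory_measurable[where \<xi> = "jet \<Omega> k u" and \<zeta> = "jet \<Omega> l f", OF c])
    show "\<Omega> \<in> sets lebesgue" using \<Omega> by simp
    show "(\<lambda>x. jet \<Omega> k u x \<alpha>) \<in> borel_measurable (lebesgue_on \<Omega>)" for \<alpha> by (rule m[OF u])
    show "(\<lambda>x. jet \<Omega> l f x \<alpha>) \<in> borel_measurable (lebesgue_on \<Omega>)" for \<alpha> by (rule m[OF f order_refl])
  qed (rule jet_jet_space)+
  then show ?thesis by (simp add: nemytskii_def[abs_def])
qed

text \<open>Finitely many applications of uniqueness, one per multi-index. It makes the operator
  independent of the chosen representatives and derivatives.\<close>

lemma is_jet_AE_eq_jet:
  assumes \<Omega>: "open \<Omega>" and u: "u \<in> Sobolev \<Omega> s" "j \<le> s" and ae: "AE x in lebesgue_on \<Omega>. u' x = u x"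
    and \<xi>: "is_jet \<Omega> j u' \<xi>"
  shows "AE x in lebesgue_on \<Omega>. \<xi> x = jet \<Omega> j u x"
proof -
  have "AE x in lebesgue_on \<Omega>. \<xi> x \<alpha> = wderiv \<Omega> \<alpha> u x" if \<alpha>: "mindex_order \<alpha> \<le> j" for \<alpha>
    by (rule weak_derivative_unique[OF \<Omega> _ Sobolev_wderiv(1)[OF \<Omega> u(1)] ae]) (use \<alpha> u(2) \<xi> in \<open>auto simp: is_jet_def\<close>)
  then have "AE x in lebesgue_on \<Omega>. \<forall>\<alpha>\<in>{\<alpha>. mindex_order \<alpha> \<le> j}. \<xi> x \<alpha> = wderiv \<Omega> \<alpha> u x"
    unfolding AE_ball_countable[OF countable_finite[OF finite_mindex_order_le]] by blast
  then show ?thesis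
  proof eventually_elim
    case (elim x)
    have "\<xi> x \<in> jet_space j" using \<xi> by (simp add: is_jet_def)
    then show ?case using elim by (intro ext) (auto simp: jet_def jet_space_def)
  qed
qed

text \<open>The choice behind \<open>wderiv\<close> need not be linear; linearity is recovered
  almost everywhere from the linearity of the test integrals.\<close>

lemma wderiv_diff:
  assumes \<Omega>: "open \<Omega>" and u: "u \<in> Sobolev \<Omega> s" and v: "v \<in> Sobolev \<Omega> s" and uv: "(\<lambda>x. u x - v x) \<in> Sobolev \<Omega> s"
    and \<alpha>: "mindex_order \<alpha> \<le> s"
  shows "AE x in lebesgue_on \<Omega>. wderiv \<Omega> \<alpha> (\<lambda>x. u x - v x) x = wderiv \<Omega> \<alpha> u x - wderiv \<Omega> \<alpha> v x"
proof -
  let ?u = "wderiv \<Omega> \<alpha> u" and ?v = "wderiv \<Omega> \<alpha> v" and ?w = "wderiv \<Omega> \<alpha> (\<lambda>x. u x - v x)"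
  note wu = Sobolev_wderiv(1)[OF \<Omega> u \<alpha>] and wv = Sobolev_wderiv(1)[OF \<Omega> v \<alpha>] and ww = Sobolev_wderiv(1)[OF \<Omega> uv \<alpha>]
  have loc: "locally_integrable \<Omega> u" "locally_integrable \<Omega> v" "locally_integrable \<Omega> ?u" "locally_integrable \<Omega> ?v" "locally_integrable \<Omega> ?w"
    using wu wv ww by (simp_all add: weak_derivative_def)
  obtain js where js: "count_list js = \<alpha>" using exists_list_with_counts by blast
  have "AE x in lebesgue_on \<Omega>. ?w x - (?u x - ?v x) = 0"
  proof (rule AE_zero_if_test_integrals_zero[OF \<Omega>])
    show "locally_integrable \<Omega> (\<lambda>x. ?w x - (?u x - ?v x))"
      using loc by (simp add: locally_integrable_def)
    fix \<phi> assume \<phi>: "\<phi> \<in> smooth_compact \<Omega>"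
    then have \<phi>t: "\<phi> \<in> test_functions \<Omega>" using smooth_compact_subset_test_functions by blast
    note d = smooth_compact_pderivatives[OF \<phi>, of js]
    note int = integrable_locally_integrable_mult[OF \<Omega> _ \<phi>] and intd = integrable_locally_integrable_mult[OF \<Omega> _ d]
    let ?I = "\<lambda>g. \<integral>x. g x * \<phi> x \<partial>lebesgue_on \<Omega>" and ?J = "\<lambda>g. \<integral>x. g x * pderivatives js \<phi> x \<partial>lebesgue_on \<Omega>"
    have "?J (\<lambda>x. u x - v x) = ?J u - ?J v"
      using intd[OF loc(1)] intd[OF loc(2)] by (simp add: left_diff_distrib)
    moreover have "?J (\<lambda>x. u x - v x) = (- 1) ^ mindex_order \<alpha> * ?I ?w" "?J u = (- 1) ^ mindex_order \<alpha> * ?I ?u"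
      "?J v = (- 1) ^ mindex_order \<alpha> * ?I ?v"
      using ww wu wv \<phi>t js unfolding weak_derivative_def by blast+
    ultimately have "(- 1) ^ mindex_order \<alpha> * ?I ?w = (- 1) ^ mindex_order \<alpha> * (?I ?u - ?I ?v)"
      by (simp add: right_diff_distrib)
    then have "?I ?w = ?I ?u - ?I ?v" unfolding mult_cancel_left by simp
    then show "?I (\<lambda>x. ?w x - (?u x - ?v x)) = 0"
      using int[OF loc(3)] int[OF loc(4)] int[OF loc(5)] by (simp add: left_diff_distrib)
  qed
  then show ?thesis by eventually_elim simp
qed

text \<open>From (x + y)^2 \<le> 2 x^2 + 2 y^2 for each derivative. Only the radius of a ball around
  0 that contains a given ball is wanted, so the factor 2 is harmless.\<close>

lemma Sobolev_norm_le_diff: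
  assumes \<Omega>: "open \<Omega>" and u: "u \<in> Sobolev \<Omega> s" and v: "v \<in> Sobolev \<Omega> s" and uv: "(\<lambda>x. u x - v x) \<in> Sobolev \<Omega> s"
  shows "Sobolev_norm \<Omega> s u \<le> 2 * (Sobolev_norm \<Omega> s (\<lambda>x. u x - v x) + Sobolev_norm \<Omega> s v)"
proof -
  let ?M = "{\<alpha>. mindex_order \<alpha> \<le> s}"
  have sq: "(Sobolev_norm \<Omega> s w)\<^sup>2 = (\<Sum>\<alpha>\<in>?M. (L2_norm \<Omega> (wderiv \<Omega> \<alpha> w))\<^sup>2)" for w
    by (simp add: Sobolev_norm_def sum_nonneg)
  have "(L2_norm \<Omega> (wderiv \<Omega> \<alpha> u))\<^sup>2 \<le> 2 * (L2_norm \<Omega> (wderiv \<Omega> \<alpha> (\<lambda>x. u x - v x)))\<^sup>2 + 2 * (L2_norm \<Omega> (wderiv \<Omega> \<alpha> v))\<^sup>2"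
    if "\<alpha> \<in> ?M" for \<alpha>
  proof -
    have \<alpha>: "mindex_order \<alpha> \<le> s" using that by simp
    let ?u = "wderiv \<Omega> \<alpha> u" and ?v = "wderiv \<Omega> \<alpha> v" and ?w = "wderiv \<Omega> \<alpha> (\<lambda>x. u x - v x)"
    have i: "integrable (lebesgue_on \<Omega>) (\<lambda>x. (?u x)\<^sup>2)" "integrable (lebesgue_on \<Omega>) (\<lambda>x. (?v x)\<^sup>2)"
      "integrable (lebesgue_on \<Omega>) (\<lambda>x. (?w x)\<^sup>2)"
      using Sobolev_wderiv(2)[OF \<Omega> u \<alpha>] Sobolev_wderiv(2)[OF \<Omega> v \<alpha>] Sobolev_wderiv(2)[OF \<Omega> uv \<alpha>] by (simp_all add: L2_def)
    have "(\<integral>x. (?u x)\<^sup>2 \<partial>lebesgue_on \<Omega>) \<le> (\<integral>x. 2 * (?w x)\<^sup>2 + 2 * (?v x)\<^sup>2 \<partial>lebesgue_on \<Omega>)"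
    proof (rule integral_mono_AE)
      have sq2: "(a + b)\<^sup>2 \<le> 2 * a\<^sup>2 + 2 * b\<^sup>2" for a b :: real
        using zero_le_power2[of "a - b"] unfolding power2_sum power2_diff by linarith
      show "AE x in lebesgue_on \<Omega>. (?u x)\<^sup>2 \<le> 2 * (?w x)\<^sup>2 + 2 * (?v x)\<^sup>2"
        using wderiv_diff[OF \<Omega> u v uv \<alpha>]
      proof eventually_elim
        case (elim x)
        then have "?u x = ?w x + ?v x" by simp
        then show ?case using sq2[of "?w x" "?v x"] by (simp only:)
      qed
    qed (use i in auto)
    also have "\<dots> = 2 * (\<integral>x. (?w x)\<^sup>2 \<partial>lebesgue_on \<Omega>) + 2 * (\<integral>x. (?v x)\<^sup>2 \<partial>lebesgue_on \<Omega>)"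
      using i by simp
    finally show ?thesis by (simp add: L2_norm_def)
  qed
  then have "(Sobolev_norm \<Omega> s u)\<^sup>2 \<le> 2 * (Sobolev_norm \<Omega> s (\<lambda>x. u x - v x))\<^sup>2 + 2 * (Sobolev_norm \<Omega> s v)\<^sup>2"
    unfolding sq sum_distrib_left sum.distrib[symmetric] by (rule sum_mono)
  also have "\<dots> \<le> (2 * (Sobolev_norm \<Omega> s (\<lambda>x. u x - v x) + Sobolev_norm \<Omega> s v))\<^sup>2"
  proof -
    have "2 * a\<^sup>2 + 2 * b\<^sup>2 \<le> (2 * (a + b))\<^sup>2" if "a \<ge> 0" "b \<ge> 0" for a b :: real
      using mult_nonneg_nonneg[OF that] zero_le_power2[of a] zero_le_power2[of b]
      unfolding power_mult_distrib power2_sum by simp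
    then show ?thesis by (simp add: Sobolev_norm_nonneg)
  qed
  finally show ?thesis by (rule power2_le_imp_le) (simp add: Sobolev_norm_nonneg)
qed

lemma closed_Sobolev_subspace_diff:
  assumes "closed_Sobolev_subspace \<Omega> s W" "u \<in> W" "v \<in> W"
  shows "(\<lambda>x. u x - v x) \<in> W"
proof -
  note W = assms(1)[unfolded closed_Sobolev_subspace_def]
  note add = W[THEN conjunct2, THEN conjunct2, THEN conjunct1]
    and scale = W[THEN conjunct2, THEN conjunct2, THEN conjunct2, THEN conjunct1]
  have "(\<lambda>x. - 1 * v x) \<in> W" by (rule scale[THEN spec, THEN bspec, OF assms(3)])
  from add[THEN bspec, OF assms(2), THEN bspec, OF this] show ?thesis by simp
qed

lemma jet_loc_bounded:
  fixes \<Omega> :: "(real^'n::finite) set"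
  assumes dom: "C1_domain \<Omega>" and j: "j \<le> s"
  shows "\<exists>K>0. \<forall>u\<in>Sobolev \<Omega> s. AE x in lebesgue_on \<Omega>. L2_set (jet \<Omega> j u x) (A_loc j s) \<le> K * Sobolev_norm \<Omega> s u"
proof -
  have "\<exists>K\<ge>0. \<forall>u\<in>Sobolev \<Omega> s. AE x in lebesgue_on \<Omega>. \<bar>wderiv \<Omega> \<alpha> u x\<bar> \<le> K * Sobolev_norm \<Omega> s u"
    if "\<alpha> \<in> A_loc j s" for \<alpha> :: "'n mindex"
    by (rule Sobolev_embedding_Linf[OF dom]) (use that j in \<open>auto simp: A_loc_def\<close>)
  then have "\<exists>K. \<forall>\<alpha>\<in>A_loc j s. 0 \<le> K \<alpha> \<and> (\<forall>u\<in>Sobolev \<Omega> s. AE x in lebesgue_on \<Omega>. \<bar>wderiv \<Omega> \<alpha> u x\<bar> \<le> K \<alpha> * Sobolev_norm \<Omega> s u)"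
    by (intro bchoice ballI)
  then obtain K where K: "\<forall>\<alpha>\<in>A_loc j s. 0 \<le> K \<alpha> \<and> (\<forall>u\<in>Sobolev \<Omega> s. AE x in lebesgue_on \<Omega>. \<bar>wderiv \<Omega> \<alpha> u x\<bar> \<le> K \<alpha> * Sobolev_norm \<Omega> s u)" ..
  \<comment> \<open>The summand 1 makes the constant positive even if no local index exists, since
    it determines the radii R and Rf, which must be positive.\<close>
  let ?K = "1 + (\<Sum>\<alpha>\<in>A_loc j s. K \<alpha>)"
  show ?thesis
  proof (intro exI[of _ ?K] conjI ballI)
    show "0 < ?K" using K by (intro add_pos_nonneg sum_nonneg) auto
    fix u assume u: "u \<in> Sobolev \<Omega> s"
    have "AE x in lebesgue_on \<Omega>. \<forall>\<alpha>\<in>A_loc j s. \<bar>wderiv \<Omega> \<alpha> u x\<bar> \<le> K \<alpha> * Sobolev_norm \<Omega> s u"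
      unfolding AE_ball_countable[OF countable_finite[OF finite_A_loc]] using K u by blast
    then show "AE x in lebesgue_on \<Omega>. L2_set (jet \<Omega> j u x) (A_loc j s) \<le> ?K * Sobolev_norm \<Omega> s u"
    proof eventually_elim
      case (elim x)
      have "L2_set (jet \<Omega> j u x) (A_loc j s) \<le> (\<Sum>\<alpha>\<in>A_loc j s. \<bar>jet \<Omega> j u x \<alpha>\<bar>)"
        by (rule L2_set_le_sum_abs)
      also have "\<dots> = (\<Sum>\<alpha>\<in>A_loc j s. \<bar>wderiv \<Omega> \<alpha> u x\<bar>)"
        by (rule sum.cong) (auto simp: jet_def A_loc_def)
      also have "\<dots> \<le> (\<Sum>\<alpha>\<in>A_loc j s. K \<alpha> * Sobolev_norm \<Omega> s u)"
        by (rule sum_mono) (use elim in blast)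
      also have "\<dots> \<le> ?K * Sobolev_norm \<Omega> s u"
        using Sobolev_norm_nonneg[of \<Omega> s u] by (simp add: distrib_right flip: sum_distrib_right)
      finally show ?case .
    qed
  qed
qed

lemma jet_glob_bounded:
  fixes \<Omega> :: "(real^'n::finite) set"
  assumes dom: "C1_domain \<Omega>" and j: "j \<le> s" and q: "\<forall>\<alpha>\<in>A_glob j s. admissible_exponent s \<alpha> (q \<alpha>)"
  shows "\<exists>K. \<forall>\<alpha>\<in>A_glob j s. 0 \<le> K \<alpha> \<and> (\<forall>u\<in>Sobolev \<Omega> s. \<forall>c>0. Sobolev_norm \<Omega> s u \<le> c \<longrightarrow>
    (\<integral>\<^sup>+x. ennreal (\<bar>wderiv \<Omega> \<alpha> u x\<bar> powr (2 * q \<alpha>)) \<partial>lebesgue_on \<Omega>) \<le> ennreal (K \<alpha> * c powr (2 * q \<alpha>)))"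
proof (intro bchoice ballI)
  fix \<alpha> :: "'n mindex" assume \<alpha>: "\<alpha> \<in> A_glob j s"
  show "\<exists>K\<ge>0. \<forall>u\<in>Sobolev \<Omega> s. \<forall>c>0. Sobolev_norm \<Omega> s u \<le> c \<longrightarrow>
    (\<integral>\<^sup>+x. ennreal (\<bar>wderiv \<Omega> \<alpha> u x\<bar> powr (2 * q \<alpha>)) \<partial>lebesgue_on \<Omega>) \<le> ennreal (K * c powr (2 * q \<alpha>))"
    by (rule Sobolev_embedding_admissible[OF dom _ _ q[THEN bspec, OF \<alpha>]]) (use \<alpha> j in \<open>auto simp: A_glob_def\<close>)
qed

section \<open>L2 estimates and boundedness of the operator\<close>

lemma L2_if_nn_integral_le:
  assumes "g \<in> borel_measurable (lebesgue_on \<Omega>)" "(\<integral>\<^sup>+x. ennreal ((g x)\<^sup>2) \<partial>lebesgue_on \<Omega>) \<le> ennreal (K\<^sup>2)" "0 \<le> K"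
  shows "g \<in> L2 \<Omega>" "L2_norm \<Omega> g \<le> K"
proof -
  have i: "integrable (lebesgue_on \<Omega>) (\<lambda>x. (g x)\<^sup>2)"
    by (rule integrableI_nonneg) (use assms in \<open>auto intro: le_less_trans\<close>)
  with assms(1) show "g \<in> L2 \<Omega>" by (simp add: L2_def)
  have "ennreal (\<integral>x. (g x)\<^sup>2 \<partial>lebesgue_on \<Omega>) \<le> ennreal (K\<^sup>2)"
    using assms(2) nn_integral_eq_integral[OF i] by simp
  then have "(\<integral>x. (g x)\<^sup>2 \<partial>lebesgue_on \<Omega>) \<le> K\<^sup>2" by simp
  then show "L2_norm \<Omega> g \<le> K" unfolding L2_norm_def using assms(3) by (rule real_le_lsqrt[rotated -1, simplified])
qed

lemma sum_power2_le: "(\<Sum>i\<in>I. y i)\<^sup>2 \<le> real (card I) * (\<Sum>i\<in>I. (y i)\<^sup>2)" for y :: "'a \<Rightarrow> real"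
  using Cauchy_Schwarz_ineq_sum[of "\<lambda>_. 1" y I] by simp

lemma nn_integral_weighted_sum_le:
  fixes f :: "'i \<Rightarrow> 'a \<Rightarrow> real"
  assumes I: "finite I" and f: "\<And>i. i \<in> I \<Longrightarrow> f i \<in> borel_measurable M" "\<And>i x. i \<in> I \<Longrightarrow> 0 \<le> f i x"
    and k: "\<And>i. i \<in> I \<Longrightarrow> 0 \<le> k i" and K: "\<And>i. i \<in> I \<Longrightarrow> 0 \<le> K i"
    and le: "\<And>i. i \<in> I \<Longrightarrow> (\<integral>\<^sup>+x. ennreal (f i x) \<partial>M) \<le> ennreal (K i)"
  shows "(\<integral>\<^sup>+x. ennreal (\<Sum>i\<in>I. k i * f i x) \<partial>M) \<le> ennreal (\<Sum>i\<in>I. k i * K i)"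
proof -
  have "(\<integral>\<^sup>+x. ennreal (\<Sum>i\<in>I. k i * f i x) \<partial>M) = (\<integral>\<^sup>+x. (\<Sum>i\<in>I. ennreal (k i * f i x)) \<partial>M)"
    using f k by (intro nn_integral_cong) (simp add: sum_ennreal)
  also have "\<dots> = (\<Sum>i\<in>I. \<integral>\<^sup>+x. ennreal (k i * f i x) \<partial>M)"
    using f by (intro nn_integral_sum) simp
  also have "\<dots> \<le> (\<Sum>i\<in>I. ennreal (k i * K i))"
  proof (rule sum_mono)
    fix i assume i: "i \<in> I"
    have "(\<integral>\<^sup>+x. ennreal (k i * f i x) \<partial>M) = ennreal (k i) * (\<integral>\<^sup>+x. ennreal (f i x) \<partial>M)"
      using f(1)[OF i] k[OF i] by (simp add: ennreal_mult' nn_integral_cmult)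
    also have "\<dots> \<le> ennreal (k i) * ennreal (K i)" by (intro mult_left_mono le i) simp
    also have "\<dots> = ennreal (k i * K i)" using k[OF i] by (rule ennreal_mult'[symmetric])
    finally show "(\<integral>\<^sup>+x. ennreal (k i * f i x) \<partial>M) \<le> ennreal (k i * K i)" .
  qed
  also have "\<dots> = ennreal (\<Sum>i\<in>I. k i * K i)" using k K by (intro sum_ennreal) simp
  finally show ?thesis .
qed

text \<open>Both factors are bounded by powers of max a b, whose q-th power is one of the two
  summands on the right. For q = \<gamma> the first factor is 1, also at a = 0.\<close>

lemma rpow_mult_powr_le:
  assumes "0 \<le> a" "0 \<le> b" "0 < \<gamma>" "\<gamma> \<le> q"
  shows "rpow a (q - \<gamma>) * b powr \<gamma> \<le> a powr q + b powr q"
proof (cases "q = \<gamma>")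
  case False
  let ?M = "max a b"
  have "a powr (q - \<gamma>) * b powr \<gamma> \<le> ?M powr (q - \<gamma>) * ?M powr \<gamma>"
    using assms False by (intro mult_mono powr_mono2) auto
  also have "\<dots> = ?M powr q" by (simp only: powr_add[symmetric] diff_add_cancel)
  also have "\<dots> \<le> a powr q + b powr q" by (simp add: max_def)
  finally show ?thesis using False by (simp add: rpow_def)
qed (simp add: rpow_def)

lemma powr_power2: "((x :: real) powr q)\<^sup>2 = x powr (2 * q)"
  by (simp only: power2_eq_square powr_add[symmetric] mult_2)

lemma three_squares_le: "(a + b + c)\<^sup>2 \<le> 3 * a\<^sup>2 + 3 * b\<^sup>2 + 3 * c\<^sup>2" for a b c :: real
proof -
  have "3 * a\<^sup>2 + 3 * b\<^sup>2 + 3 * c\<^sup>2 - (a + b + c)\<^sup>2 = (a - b)\<^sup>2 + (a - c)\<^sup>2 + (b - c)\<^sup>2"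
    by (simp add: power2_eq_square algebra_simps)
  moreover have "0 \<le> (a - b)\<^sup>2 + (a - c)\<^sup>2 + (b - c)\<^sup>2" by simp
  ultimately show ?thesis by linarith
qed

lemma powr_wderiv_measurable:
  assumes "open \<Omega>" "u \<in> Sobolev \<Omega> s" "mindex_order \<alpha> \<le> s"
  shows "(\<lambda>x. \<bar>wderiv \<Omega> \<alpha> u x\<bar> powr e) \<in> borel_measurable (lebesgue_on \<Omega>)"
proof -
  note [measurable] = wderiv_measurable[OF assms]
  show ?thesis by measurable
qed

text \<open>On a ball of radius \<rho> the embedding into bounded functions limits the local jet
  components uniformly, so a single pair R, Rf of the growth condition covers all u and f. The
  global components enter through powers that are square integrable with bounds depending on \<rho>
  only.\<close>

lemma nemytskii_bounded:
  fixes \<Omega> :: "(real^'n::finite) set"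
  assumes dom: "C1_domain \<Omega>" and k: "k < 2 * m" and car: "caratheodory \<Omega> k l c"
    and growth: "growth_condition \<Omega> m k l c a b q p" and \<rho>: "0 < \<rho>"
  shows "\<exists>K. \<forall>u\<in>Sobolev \<Omega> (2 * m). \<forall>f\<in>Sobolev \<Omega> l. Sobolev_norm \<Omega> (2 * m) u \<le> \<rho> \<longrightarrow> Sobolev_norm \<Omega> l f \<le> \<rho> \<longrightarrow>
    nemytskii \<Omega> k l c u f \<in> L2 \<Omega> \<and> L2_norm \<Omega> (nemytskii \<Omega> k l c u f) \<le> K"
proof -
  have \<Omega>: "open \<Omega>" using dom by (simp add: C1_domain_def)
  have k': "k \<le> 2 * m" using k by simp
  obtain K1 where K1: "K1 > 0" "\<forall>u\<in>Sobolev \<Omega> (2 * m). AE x in lebesgue_on \<Omega>.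
      L2_set (jet \<Omega> k u x) (A_loc k (2 * m)) \<le> K1 * Sobolev_norm \<Omega> (2 * m) u"
    using jet_loc_bounded[OF dom k'] by (elim exE conjE)
  obtain K2 where K2: "K2 > 0" "\<forall>f\<in>Sobolev \<Omega> l. AE x in lebesgue_on \<Omega>.
      L2_set (jet \<Omega> l f x) (A_loc l l) \<le> K2 * Sobolev_norm \<Omega> l f"
    using jet_loc_bounded[OF dom order_refl, of l] by (elim exE conjE)
  define R where "R = K1 * \<rho>"
  define Rf where "Rf = K2 * \<rho>"
  have R: "R > 0" "Rf > 0" using K1 K2 \<rho> by (auto simp: R_def Rf_def)
  define a' where "a' = a R Rf"
  define b' where "b' = b R Rf"
  define q' where "q' = q R Rf"
  define p' where "p' = p R Rf"
  let ?G1 = "A_glob k (2 * m) :: 'n mindex set" and ?G2 = "A_glob l l :: 'n mindex set"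
  have a: "a' \<in> L2 \<Omega>" and b: "0 \<le> b'"
    and q: "\<forall>\<alpha>\<in>?G1. admissible_exponent (2 * m) \<alpha> (q' \<alpha>)"
    and p: "\<forall>\<alpha>\<in>?G2. admissible_exponent l \<alpha> (p' \<alpha>)"
    and bound: "AE x in lebesgue_on \<Omega>. \<forall>\<xi>\<in>jet_space k. \<forall>\<zeta>\<in>jet_space l.
          L2_set \<xi> (A_loc k (2 * m)) \<le> R \<and> L2_set \<zeta> (A_loc l l) \<le> Rf \<longrightarrow>
          \<bar>c x \<xi> \<zeta>\<bar> \<le> a' x + b' * ((\<Sum>\<alpha>\<in>?G1. \<bar>\<xi> \<alpha>\<bar> powr q' \<alpha>) + (\<Sum>\<alpha>\<in>?G2. \<bar>\<zeta> \<alpha>\<bar> powr p' \<alpha>))"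
    using growth R unfolding growth_condition_def a'_def b'_def q'_def p'_def by simp_all
  obtain H1 where H1: "\<forall>\<alpha>\<in>?G1. 0 \<le> H1 \<alpha> \<and> (\<forall>u\<in>Sobolev \<Omega> (2 * m). \<forall>c>0. Sobolev_norm \<Omega> (2 * m) u \<le> c \<longrightarrow>
    (\<integral>\<^sup>+x. ennreal (\<bar>wderiv \<Omega> \<alpha> u x\<bar> powr (2 * q' \<alpha>)) \<partial>lebesgue_on \<Omega>) \<le> ennreal (H1 \<alpha> * c powr (2 * q' \<alpha>)))"
    using jet_glob_bounded[OF dom k' q] by (elim exE)
  obtain H2 where H2: "\<forall>\<alpha>\<in>?G2. 0 \<le> H2 \<alpha> \<and> (\<forall>u\<in>Sobolev \<Omega> l. \<forall>c>0. Sobolev_norm \<Omega> l u \<le> c \<longrightarrow>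
    (\<integral>\<^sup>+x. ennreal (\<bar>wderiv \<Omega> \<alpha> u x\<bar> powr (2 * p' \<alpha>)) \<partial>lebesgue_on \<Omega>) \<le> ennreal (H2 \<alpha> * c powr (2 * p' \<alpha>)))"
    using jet_glob_bounded[OF dom order_refl p] by (elim exE)
  \<comment> \<open>The 3 comes from squaring a sum of three terms, the cardinality from
    Cauchy-Schwarz over the global indices.\<close>
  let ?k1 = "3 * b'\<^sup>2 * real (card ?G1)" and ?k2 = "3 * b'\<^sup>2 * real (card ?G2)"
  define A where "A = 3 * (\<integral>x. (a' x)\<^sup>2 \<partial>lebesgue_on \<Omega>)"
  define B1 where "B1 = (\<Sum>\<alpha>\<in>?G1. ?k1 * (H1 \<alpha> * \<rho> powr (2 * q' \<alpha>)))"
  define B2 where "B2 = (\<Sum>\<alpha>\<in>?G2. ?k2 * (H2 \<alpha> * \<rho> powr (2 * p' \<alpha>)))"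
  have nonneg: "0 \<le> A" "0 \<le> B1" "0 \<le> B2"
    using H1 H2 by (auto simp: A_def B1_def B2_def intro!: sum_nonneg mult_nonneg_nonneg)
  have ai: "integrable (lebesgue_on \<Omega>) (\<lambda>x. (a' x)\<^sup>2)" using a by (simp add: L2_def)
  show ?thesis
  proof (rule exI[of _ "sqrt (A + B1 + B2)"], intro ballI impI)
    fix u f assume u: "u \<in> Sobolev \<Omega> (2 * m)" and f: "f \<in> Sobolev \<Omega> l"
      and un: "Sobolev_norm \<Omega> (2 * m) u \<le> \<rho>" and fn: "Sobolev_norm \<Omega> l f \<le> \<rho>"
    let ?h = "nemytskii \<Omega> k l c u f"
    let ?U = "\<lambda>\<alpha> x. \<bar>wderiv \<Omega> \<alpha> u x\<bar> powr (2 * q' \<alpha>)" and ?F = "\<lambda>\<alpha> x. \<bar>wderiv \<Omega> \<alpha> f x\<bar> powr (2 * p' \<alpha>)"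
    have Um: "?U \<alpha> \<in> borel_measurable (lebesgue_on \<Omega>)" if "\<alpha> \<in> ?G1" for \<alpha>
      by (rule powr_wderiv_measurable[OF \<Omega> u]) (use that k in \<open>auto simp: A_glob_def\<close>)
    have Fm: "?F \<alpha> \<in> borel_measurable (lebesgue_on \<Omega>)" if "\<alpha> \<in> ?G2" for \<alpha>
      by (rule powr_wderiv_measurable[OF \<Omega> f]) (use that in \<open>auto simp: A_glob_def\<close>)
    have "AE x in lebesgue_on \<Omega>. (?h x)\<^sup>2 \<le> 3 * (a' x)\<^sup>2 + (\<Sum>\<alpha>\<in>?G1. ?k1 * ?U \<alpha> x) + (\<Sum>\<alpha>\<in>?G2. ?k2 * ?F \<alpha> x)"
      using bound K1(2)[rule_format, OF u] K2(2)[rule_format, OF f]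
    proof eventually_elim
      case (elim x)
      let ?S1 = "\<Sum>\<alpha>\<in>?G1. \<bar>wderiv \<Omega> \<alpha> u x\<bar> powr q' \<alpha>" and ?S2 = "\<Sum>\<alpha>\<in>?G2. \<bar>wderiv \<Omega> \<alpha> f x\<bar> powr p' \<alpha>"
      have "L2_set (jet \<Omega> k u x) (A_loc k (2 * m)) \<le> R"
        unfolding R_def by (rule order_trans[OF elim(2) mult_left_mono[OF un less_imp_le[OF K1(1)]]])
      moreover have "L2_set (jet \<Omega> l f x) (A_loc l l) \<le> Rf"
        unfolding Rf_def by (rule order_trans[OF elim(3) mult_left_mono[OF fn less_imp_le[OF K2(1)]]])
      ultimately have "\<bar>?h x\<bar> \<le> a' x + b' * ((\<Sum>\<alpha>\<in>?G1. \<bar>jet \<Omega> k u x \<alpha>\<bar> powr q' \<alpha>) + (\<Sum>\<alpha>\<in>?G2. \<bar>jet \<Omega> l f x \<alpha>\<bar> powr p' \<alpha>))"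
        unfolding nemytskii_def
        using elim(1)[THEN bspec, OF jet_jet_space, THEN bspec, OF jet_jet_space] by blast
      also have "(\<Sum>\<alpha>\<in>?G1. \<bar>jet \<Omega> k u x \<alpha>\<bar> powr q' \<alpha>) = ?S1"
        by (rule sum.cong) (auto simp: jet_def A_glob_def)
      also have "(\<Sum>\<alpha>\<in>?G2. \<bar>jet \<Omega> l f x \<alpha>\<bar> powr p' \<alpha>) = ?S2"
        by (rule sum.cong) (auto simp: jet_def A_glob_def)
      finally have "\<bar>?h x\<bar> \<le> a' x + b' * ?S1 + b' * ?S2" by (simp only: distrib_left add.assoc)
      then have "\<bar>?h x\<bar>\<^sup>2 \<le> (a' x + b' * ?S1 + b' * ?S2)\<^sup>2" by (rule power_mono) simp
      also have "\<dots> \<le> 3 * (a' x)\<^sup>2 + 3 * (b' * ?S1)\<^sup>2 + 3 * (b' * ?S2)\<^sup>2" by (rule three_squares_le)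
      also have "\<dots> \<le> 3 * (a' x)\<^sup>2 + (\<Sum>\<alpha>\<in>?G1. ?k1 * ?U \<alpha> x) + (\<Sum>\<alpha>\<in>?G2. ?k2 * ?F \<alpha> x)"
      proof -
        have sq: "3 * (b' * (\<Sum>\<alpha>\<in>I. z \<alpha> powr e \<alpha>))\<^sup>2 \<le> (\<Sum>\<alpha>\<in>I. 3 * b'\<^sup>2 * real (card I) * z \<alpha> powr (2 * e \<alpha>))"
          for I :: "'n mindex set" and z e
        proof -
          have "3 * (b' * (\<Sum>\<alpha>\<in>I. z \<alpha> powr e \<alpha>))\<^sup>2 = 3 * b'\<^sup>2 * (\<Sum>\<alpha>\<in>I. z \<alpha> powr e \<alpha>)\<^sup>2"
            by (simp add: power_mult_distrib)
          also have "\<dots> \<le> 3 * b'\<^sup>2 * (real (card I) * (\<Sum>\<alpha>\<in>I. (z \<alpha> powr e \<alpha>)\<^sup>2))"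
            by (intro mult_left_mono sum_power2_le) simp
          finally show ?thesis by (simp only: powr_power2 sum_distrib_left mult.assoc)
        qed
        show ?thesis by (intro add_mono order_refl sq)
      qed
      finally show ?case by simp
    qed
    then have "(\<integral>\<^sup>+x. ennreal ((?h x)\<^sup>2) \<partial>lebesgue_on \<Omega>)
      \<le> (\<integral>\<^sup>+x. ennreal (3 * (a' x)\<^sup>2) + ennreal (\<Sum>\<alpha>\<in>?G1. ?k1 * ?U \<alpha> x) + ennreal (\<Sum>\<alpha>\<in>?G2. ?k2 * ?F \<alpha> x) \<partial>lebesgue_on \<Omega>)"
    proof (intro nn_integral_mono_AE, eventually_elim)
      case (elim x)
      have "0 \<le> (\<Sum>\<alpha>\<in>?G1. ?k1 * ?U \<alpha> x)" "0 \<le> (\<Sum>\<alpha>\<in>?G2. ?k2 * ?F \<alpha> x)" by (auto intro!: sum_nonneg)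
      then show ?case using elim by (simp only: ennreal_plus[symmetric] ennreal_leI add_nonneg_nonneg zero_le_power2 mult_nonneg_nonneg zero_le_numeral)
    qed
    also have "\<dots> = (\<integral>\<^sup>+x. ennreal (3 * (a' x)\<^sup>2) \<partial>lebesgue_on \<Omega>) + (\<integral>\<^sup>+x. ennreal (\<Sum>\<alpha>\<in>?G1. ?k1 * ?U \<alpha> x) \<partial>lebesgue_on \<Omega>)
        + (\<integral>\<^sup>+x. ennreal (\<Sum>\<alpha>\<in>?G2. ?k2 * ?F \<alpha> x) \<partial>lebesgue_on \<Omega>)"
    proof -
      have 1: "(\<lambda>x. ennreal (3 * (a' x)\<^sup>2)) \<in> borel_measurable (lebesgue_on \<Omega>)"
        using ai by (intro measurable_compose[OF _ measurable_ennreal] borel_measurable_times) auto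
      have 2: "(\<lambda>x. ennreal (\<Sum>\<alpha>\<in>?G1. ?k1 * ?U \<alpha> x)) \<in> borel_measurable (lebesgue_on \<Omega>)"
        by (intro measurable_compose[OF _ measurable_ennreal] borel_measurable_sum borel_measurable_times borel_measurable_const Um)
      have 3: "(\<lambda>x. ennreal (\<Sum>\<alpha>\<in>?G2. ?k2 * ?F \<alpha> x)) \<in> borel_measurable (lebesgue_on \<Omega>)"
        by (intro measurable_compose[OF _ measurable_ennreal] borel_measurable_sum borel_measurable_times borel_measurable_const Fm)
      show ?thesis by (simp only: nn_integral_add[OF borel_measurable_add[OF 1 2] 3] nn_integral_add[OF 1 2])
    qed
    also have "\<dots> \<le> ennreal A + ennreal B1 + ennreal B2"
    proof (intro add_mono)
      have "(\<integral>\<^sup>+x. ennreal (3 * (a' x)\<^sup>2) \<partial>lebesgue_on \<Omega>) = ennreal (\<integral>x. 3 * (a' x)\<^sup>2 \<partial>lebesgue_on \<Omega>)"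
        by (rule nn_integral_eq_integral) (use ai in auto)
      then show "(\<integral>\<^sup>+x. ennreal (3 * (a' x)\<^sup>2) \<partial>lebesgue_on \<Omega>) \<le> ennreal A" by (simp add: A_def)
      show "(\<integral>\<^sup>+x. ennreal (\<Sum>\<alpha>\<in>?G1. ?k1 * ?U \<alpha> x) \<partial>lebesgue_on \<Omega>) \<le> ennreal B1"
        unfolding B1_def by (rule nn_integral_weighted_sum_le) (use finite_A_glob Um H1 u un \<rho> in auto)
      show "(\<integral>\<^sup>+x. ennreal (\<Sum>\<alpha>\<in>?G2. ?k2 * ?F \<alpha> x) \<partial>lebesgue_on \<Omega>) \<le> ennreal B2"
        unfolding B2_def by (rule nn_integral_weighted_sum_le) (use finite_A_glob Fm H2 f fn \<rho> in auto)
    qed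
    also have "\<dots> = ennreal ((sqrt (A + B1 + B2))\<^sup>2)" using nonneg by (simp add: ennreal_plus)
    finally have le: "(\<integral>\<^sup>+x. ennreal ((?h x)\<^sup>2) \<partial>lebesgue_on \<Omega>) \<le> ennreal ((sqrt (A + B1 + B2))\<^sup>2)" .
    have hm: "?h \<in> borel_measurable (lebesgue_on \<Omega>)" by (rule nemytskii_measurable[OF \<Omega> car u k' f])
    have s0: "0 \<le> sqrt (A + B1 + B2)" using nonneg by simp
    show "?h \<in> L2 \<Omega> \<and> L2_norm \<Omega> ?h \<le> sqrt (A + B1 + B2)"
      using L2_if_nn_integral_le[OF hm le s0] by blast
  qed
qed

section \<open>The modulus of continuity in the first argument\<close>

text \<open>Each global term contributes t powr \<gamma> times a function whose L2 norm is bounded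
  independently of t, since u and v lie in a fixed ball and (u - v)/t has norm 1. The local term is
  constant in x once its argument is replaced by K1 t, and the domain has finite measure.\<close>

lemma nemytskii_modulus:
  fixes \<Omega> :: "(real^'n::finite) set"
  assumes dom: "C1_domain \<Omega>" and k: "k < 2 * m" and car: "caratheodory \<Omega> k l c"
    and growth: "growth_condition \<Omega> m k l c a b q p"
    and conti: "continuity_condition \<Omega> m k l c q p \<omega> L \<gamma> \<delta>" and \<rho>: "0 < \<rho>"
  shows "\<exists>w0>0. \<exists>w1>0. \<exists>R>0. \<exists>Rf>0. \<forall>u\<in>Sobolev \<Omega> (2 * m). \<forall>v\<in>Sobolev \<Omega> (2 * m). \<forall>f\<in>Sobolev \<Omega> l.
    (\<lambda>x. u x - v x) \<in> Sobolev \<Omega> (2 * m) \<longrightarrow> Sobolev_norm \<Omega> (2 * m) u \<le> \<rho> \<longrightarrow> Sobolev_norm \<Omega> (2 * m) v \<le> \<rho>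
    \<longrightarrow> Sobolev_norm \<Omega> l f \<le> \<rho> \<longrightarrow>
    L2_norm \<Omega> (\<lambda>x. nemytskii \<Omega> k l c u f x - nemytskii \<Omega> k l c v f x)
      \<le> w0 * (\<omega> R Rf (w1 * Sobolev_norm \<Omega> (2 * m) (\<lambda>x. u x - v x))
          + (\<Sum>\<alpha>\<in>A_glob k (2 * m). Sobolev_norm \<Omega> (2 * m) (\<lambda>x. u x - v x) powr \<gamma> R Rf \<alpha>))"
proof -
  have \<Omega>: "open \<Omega>" "bounded \<Omega>" using dom by (simp_all add: C1_domain_def)
  have k': "k \<le> 2 * m" using k by simp
  obtain K1 where K1: "K1 > 0" "\<forall>u\<in>Sobolev \<Omega> (2 * m). AE x in lebesgue_on \<Omega>.
      L2_set (jet \<Omega> k u x) (A_loc k (2 * m)) \<le> K1 * Sobolev_norm \<Omega> (2 * m) u"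
    using jet_loc_bounded[OF dom k'] by (elim exE conjE)
  obtain K2 where K2: "K2 > 0" "\<forall>f\<in>Sobolev \<Omega> l. AE x in lebesgue_on \<Omega>.
      L2_set (jet \<Omega> l f x) (A_loc l l) \<le> K2 * Sobolev_norm \<Omega> l f"
    using jet_loc_bounded[OF dom order_refl, of l] by (elim exE conjE)
  define R where "R = K1 * \<rho>"
  define Rf where "Rf = K2 * \<rho>"
  have R: "R > 0" "Rf > 0" using K1 K2 \<rho> by (auto simp: R_def Rf_def)
  define L' where "L' = L R Rf"
  define q' where "q' = q R Rf"
  define g where "g = \<gamma> R Rf"
  define p' where "p' = p R Rf"
  define d where "d = \<delta> R Rf"
  define o' where "o' = \<omega> R Rf"
  let ?G = "A_glob k (2 * m) :: 'n mindex set" and ?G2 = "A_glob l l :: 'n mindex set"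
  have q: "\<forall>\<alpha>\<in>?G. admissible_exponent (2 * m) \<alpha> (q' \<alpha>)"
    using growth R unfolding growth_condition_def q'_def by simp
  have q1: "1 \<le> q' \<alpha>" if "\<alpha> \<in> ?G" for \<alpha> using q[THEN bspec, OF that] by (simp add: admissible_exponent_def)
  have mod: "modulus_of_continuity o'" and mono: "mono_on {0..} o'"
    and g: "\<And>\<alpha>. \<alpha> \<in> ?G \<Longrightarrow> 0 < g \<alpha> \<and> g \<alpha> \<le> 1" and d: "\<And>\<alpha>. \<alpha> \<in> ?G2 \<Longrightarrow> 0 < d \<alpha>"
    and bound: "AE x in lebesgue_on \<Omega>. \<forall>\<xi>1\<in>jet_space k. \<forall>\<xi>2\<in>jet_space k. \<forall>\<zeta>1\<in>jet_space l. \<forall>\<zeta>2\<in>jet_space l.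
          L2_set \<xi>1 (A_loc k (2 * m)) \<le> R \<and> L2_set \<xi>2 (A_loc k (2 * m)) \<le> R
          \<and> L2_set \<zeta>1 (A_loc l l) \<le> Rf \<and> L2_set \<zeta>2 (A_loc l l) \<le> Rf \<longrightarrow>
          \<bar>c x \<xi>1 \<zeta>1 - c x \<xi>2 \<zeta>2\<bar> \<le>
            L' * o' (L2_set (\<lambda>\<alpha>. \<xi>1 \<alpha> - \<xi>2 \<alpha>) (A_loc k (2 * m)) + L2_set (\<lambda>\<alpha>. \<zeta>1 \<alpha> - \<zeta>2 \<alpha>) (A_loc l l))
            + L' * (\<Sum>\<alpha>\<in>?G. (rpow \<bar>\<xi>1 \<alpha>\<bar> (q' \<alpha> - g \<alpha>) + rpow \<bar>\<xi>2 \<alpha>\<bar> (q' \<alpha> - g \<alpha>)) * \<bar>\<xi>1 \<alpha> - \<xi>2 \<alpha>\<bar> powr g \<alpha>)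
            + L' * (\<Sum>\<alpha>\<in>?G2. (rpow \<bar>\<zeta>1 \<alpha>\<bar> (p' \<alpha> - d \<alpha>) + rpow \<bar>\<zeta>2 \<alpha>\<bar> (p' \<alpha> - d \<alpha>)) * \<bar>\<zeta>1 \<alpha> - \<zeta>2 \<alpha>\<bar> powr d \<alpha>)"
    using conti R unfolding continuity_condition_def L'_def q'_def g_def p'_def d_def o'_def by simp_all
  obtain H where H: "\<forall>\<alpha>\<in>?G. 0 \<le> H \<alpha> \<and> (\<forall>u\<in>Sobolev \<Omega> (2 * m). \<forall>c>0. Sobolev_norm \<Omega> (2 * m) u \<le> c \<longrightarrow>
    (\<integral>\<^sup>+x. ennreal (\<bar>wderiv \<Omega> \<alpha> u x\<bar> powr (2 * q' \<alpha>)) \<partial>lebesgue_on \<Omega>) \<le> ennreal (H \<alpha> * c powr (2 * q' \<alpha>)))"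
    using jet_glob_bounded[OF dom k' q] by (elim exE)
  define \<mu> where "\<mu> = measure lebesgue \<Omega>"
  have \<mu>: "emeasure (lebesgue_on \<Omega>) (space (lebesgue_on \<Omega>)) = ennreal \<mu>"
  proof -
    have "emeasure lborel \<Omega> < \<infinity>" using emeasure_bounded_finite[OF \<Omega>(2)] .
    then have "emeasure lebesgue \<Omega> < \<infinity>" using \<Omega>(1) by simp
    then have "emeasure lebesgue \<Omega> = ennreal \<mu>" unfolding \<mu>_def by (intro emeasure_eq_ennreal_measure) simp
    then show ?thesis using \<Omega>(1) by (simp add: emeasure_restrict_space)
  qed
  \<comment> \<open>Bounds the integral of \<open>F\<close> below: u and v contribute through the
    ball of radius \<rho>, while u - v is divided by its own norm t and leaves 4 H, free of
    t.\<close>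
  define B where "B \<alpha> = 2 * (H \<alpha> * \<rho> powr (2 * q' \<alpha>)) + 4 * H \<alpha>" for \<alpha>
  have B: "0 \<le> B \<alpha>" if "\<alpha> \<in> ?G" for \<alpha> using H that by (simp add: B_def)
  \<comment> \<open>6 = 2 times 3: squares of a sum of two and of a sum of three terms; the
    cardinality is Cauchy-Schwarz over the global indices.\<close>
  let ?k = "6 * L'\<^sup>2 * real (card ?G)"
  define W where "W = 2 * L'\<^sup>2 * \<mu> + (\<Sum>\<alpha>\<in>?G. ?k * B \<alpha>)"
  have W: "0 \<le> W" unfolding W_def \<mu>_def using B by (intro add_nonneg_nonneg sum_nonneg mult_nonneg_nonneg) auto
  \<comment> \<open>The square root of the total coefficient of the squared modulus, plus 1 to be
    positive.\<close>
  define w0 where "w0 = 1 + sqrt W"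
  have w0: "w0 > 0" "W \<le> w0\<^sup>2"
  proof -
    have s: "0 \<le> sqrt W" using W by simp
    then show "w0 > 0" unfolding w0_def by linarith
    have "W = (sqrt W)\<^sup>2" using W by simp
    also have "\<dots> \<le> w0\<^sup>2" unfolding w0_def using s by (intro power_mono) auto
    finally show "W \<le> w0\<^sup>2" .
  qed
  show ?thesis
  \<comment> \<open>w1 is K1, the embedding constant that bounds the local jet distance by K1
    t.\<close>
  proof (rule exI[of _ w0], rule conjI[OF w0(1)], rule exI[of _ K1], rule conjI[OF K1(1)],
      rule exI[of _ R], rule conjI[OF R(1)], rule exI[of _ Rf], rule conjI[OF R(2)], intro ballI impI)
    fix u v f assume u: "u \<in> Sobolev \<Omega> (2 * m)" and v: "v \<in> Sobolev \<Omega> (2 * m)" and f: "f \<in> Sobolev \<Omega> l"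
      and uv: "(\<lambda>x. u x - v x) \<in> Sobolev \<Omega> (2 * m)"
      and un: "Sobolev_norm \<Omega> (2 * m) u \<le> \<rho>" and vn: "Sobolev_norm \<Omega> (2 * m) v \<le> \<rho>" and fn: "Sobolev_norm \<Omega> l f \<le> \<rho>"
    define w where "w = (\<lambda>x. u x - v x)"
    define t where "t = Sobolev_norm \<Omega> (2 * m) w"
    have ws: "w \<in> Sobolev \<Omega> (2 * m)" using uv by (simp add: w_def)
    have t0: "0 \<le> t" by (simp add: t_def Sobolev_norm_nonneg)
    let ?h = "\<lambda>x. nemytskii \<Omega> k l c u f x - nemytskii \<Omega> k l c v f x"
    define S where "S = o' (K1 * t) + (\<Sum>\<alpha>\<in>?G. t powr g \<alpha>)"
    have o0: "0 \<le> o' (K1 * t)" using mod K1(1) t0 by (simp add: modulus_of_continuity_def)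
    have S0: "0 \<le> S" unfolding S_def using o0 by (intro add_nonneg_nonneg sum_nonneg) auto
    have "AE x in lebesgue_on \<Omega>. \<forall>\<alpha>\<in>{\<alpha>. mindex_order \<alpha> \<le> 2 * m}. wderiv \<Omega> \<alpha> w x = wderiv \<Omega> \<alpha> u x - wderiv \<Omega> \<alpha> v x"
      unfolding AE_ball_countable[OF countable_finite[OF finite_mindex_order_le]] w_def
      using wderiv_diff[OF \<Omega>(1) u v uv] by simp
    then have jet_diff: "AE x in lebesgue_on \<Omega>. \<forall>\<alpha>. jet \<Omega> k w x \<alpha> = jet \<Omega> k u x \<alpha> - jet \<Omega> k v x \<alpha>"
    proof eventually_elim
      case (elim x)
      then show ?case using k' by (auto simp: jet_def)
    qed
    have "L2_norm \<Omega> ?h \<le> w0 * S"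
    \<comment> \<open>The argument divides by t. For t = 0 the jets of u and v agree almost
      everywhere and the difference vanishes.\<close>
    proof (cases "t = 0")
      case True
      have "AE x in lebesgue_on \<Omega>. \<forall>\<alpha>\<in>{\<alpha>. mindex_order \<alpha> \<le> 2 * m}. wderiv \<Omega> \<alpha> w x = 0"
        unfolding AE_ball_countable[OF countable_finite[OF finite_mindex_order_le]]
        using wderiv_zero_if_Sobolev_norm_zero[OF \<Omega>(1) ws] True by (simp add: t_def)
      with jet_diff have "AE x in lebesgue_on \<Omega>. (?h x)\<^sup>2 = 0"
      proof eventually_elim
        case (elim x)
        have "jet \<Omega> k u x = jet \<Omega> k v x"
        proof
          fix \<alpha>
          have "jet \<Omega> k w x \<alpha> = 0" using elim(2) k' by (simp add: jet_def)
          then show "jet \<Omega> k u x \<alpha> = jet \<Omega> k v x \<alpha>" using elim(1) by simp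
        qed
        then show ?case by (simp add: nemytskii_def)
      qed
      then have "(\<integral>x. (?h x)\<^sup>2 \<partial>lebesgue_on \<Omega>) = 0" by (rule integral_eq_zero_AE)
      then have "L2_norm \<Omega> ?h = 0" by (simp add: L2_norm_def)
      then show ?thesis using w0(1) S0 by simp
    next
      case False
      with t0 have t: "t > 0" by simp
      let ?U = "\<lambda>u \<alpha> x. \<bar>wderiv \<Omega> \<alpha> u x\<bar> powr (2 * q' \<alpha>)"
      define F where "F \<alpha> x = ?U u \<alpha> x + ?U v \<alpha> x + 4 * (?U w \<alpha> x / t powr (2 * q' \<alpha>))" for \<alpha> x
      have F0: "0 \<le> F \<alpha> x" for \<alpha> x by (simp add: F_def)
      have Um: "?U z \<alpha> \<in> borel_measurable (lebesgue_on \<Omega>)" if "\<alpha> \<in> ?G" "z \<in> Sobolev \<Omega> (2 * m)" for \<alpha> z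
        by (rule powr_wderiv_measurable[OF \<Omega>(1) that(2)]) (use that(1) k in \<open>auto simp: A_glob_def\<close>)
      have Fm: "F \<alpha> \<in> borel_measurable (lebesgue_on \<Omega>)" if "\<alpha> \<in> ?G" for \<alpha>
        unfolding F_def[abs_def]
        by (intro borel_measurable_add borel_measurable_times borel_measurable_divide borel_measurable_const Um that u v ws)
      have FB: "(\<integral>\<^sup>+x. ennreal (F \<alpha> x) \<partial>lebesgue_on \<Omega>) \<le> ennreal (B \<alpha>)" if \<alpha>: "\<alpha> \<in> ?G" for \<alpha>
      proof -
        let ?I = "\<lambda>z. \<integral>\<^sup>+x. ennreal (?U z \<alpha> x) \<partial>lebesgue_on \<Omega>"
        let ?c = "4 / t powr (2 * q' \<alpha>)"
        have m: "(\<lambda>x. ennreal (?U z \<alpha> x)) \<in> borel_measurable (lebesgue_on \<Omega>)" if "z \<in> Sobolev \<Omega> (2 * m)" for z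
          by (rule measurable_compose[OF Um[OF \<alpha> that] measurable_ennreal])
        have "(\<integral>\<^sup>+x. ennreal (F \<alpha> x) \<partial>lebesgue_on \<Omega>)
          = (\<integral>\<^sup>+x. ennreal (?U u \<alpha> x) + ennreal (?U v \<alpha> x) + ennreal ?c * ennreal (?U w \<alpha> x) \<partial>lebesgue_on \<Omega>)"
        proof (rule nn_integral_cong)
          fix x
          have "F \<alpha> x = ?U u \<alpha> x + ?U v \<alpha> x + ?c * ?U w \<alpha> x" by (simp add: F_def)
          then have "ennreal (F \<alpha> x) = ennreal (?U u \<alpha> x + ?U v \<alpha> x) + ennreal (?c * ?U w \<alpha> x)"
            by (simp only:) (rule ennreal_plus, simp_all)
          also have "ennreal (?U u \<alpha> x + ?U v \<alpha> x) = ennreal (?U u \<alpha> x) + ennreal (?U v \<alpha> x)"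
            by (rule ennreal_plus) simp_all
          also have "ennreal (?c * ?U w \<alpha> x) = ennreal ?c * ennreal (?U w \<alpha> x)"
            by (rule ennreal_mult') simp
          finally show "ennreal (F \<alpha> x) = ennreal (?U u \<alpha> x) + ennreal (?U v \<alpha> x) + ennreal ?c * ennreal (?U w \<alpha> x)" .
        qed
        also have "\<dots> = ?I u + ?I v + ennreal ?c * ?I w"
          by (simp only: nn_integral_add[OF borel_measurable_add[OF m[OF u] m[OF v]] borel_measurable_times_ennreal[OF borel_measurable_const m[OF ws]]]
              nn_integral_add[OF m[OF u] m[OF v]] nn_integral_cmult[OF m[OF ws]])
        also have "\<dots> \<le> ennreal (H \<alpha> * \<rho> powr (2 * q' \<alpha>)) + ennreal (H \<alpha> * \<rho> powr (2 * q' \<alpha>))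
            + ennreal ?c * ennreal (H \<alpha> * t powr (2 * q' \<alpha>))"
          using H \<alpha> u v ws un vn \<rho> t by (intro add_mono mult_left_mono) (auto simp: t_def)
        also have "\<dots> = ennreal (B \<alpha>)"
        proof -
          have "ennreal ?c * ennreal (H \<alpha> * t powr (2 * q' \<alpha>)) = ennreal (?c * (H \<alpha> * t powr (2 * q' \<alpha>)))"
            by (rule ennreal_mult'[symmetric]) simp
          also have "?c * (H \<alpha> * t powr (2 * q' \<alpha>)) = 4 * H \<alpha>" using t by simp
          finally have e: "ennreal ?c * ennreal (H \<alpha> * t powr (2 * q' \<alpha>)) = ennreal (4 * H \<alpha>)" .
          have h: "0 \<le> H \<alpha>" "0 \<le> H \<alpha> * \<rho> powr (2 * q' \<alpha>)" using H \<alpha> by auto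
          have "B \<alpha> = H \<alpha> * \<rho> powr (2 * q' \<alpha>) + H \<alpha> * \<rho> powr (2 * q' \<alpha>) + 4 * H \<alpha>" by (simp add: B_def)
          then show ?thesis using h by (simp only: e) (simp only: ennreal_plus add_nonneg_nonneg mult_nonneg_nonneg zero_le_numeral)
        qed
        finally show ?thesis .
      qed
      have "AE x in lebesgue_on \<Omega>. (?h x)\<^sup>2 \<le> 2 * L'\<^sup>2 * (o' (K1 * t))\<^sup>2 + (\<Sum>\<alpha>\<in>?G. ?k * (t powr g \<alpha>)\<^sup>2 * F \<alpha> x)"
        using bound jet_diff K1(2)[rule_format, OF u] K1(2)[rule_format, OF v] K1(2)[rule_format, OF ws] K2(2)[rule_format, OF f]
      proof eventually_elim
        case (elim x)
        let ?ju = "jet \<Omega> k u x" and ?jv = "jet \<Omega> k v x" and ?jw = "jet \<Omega> k w x" and ?jf = "jet \<Omega> l f x"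
        have Ru: "L2_set ?ju (A_loc k (2 * m)) \<le> R"
          unfolding R_def by (rule order_trans[OF elim(3) mult_left_mono[OF un less_imp_le[OF K1(1)]]])
        have Rv: "L2_set ?jv (A_loc k (2 * m)) \<le> R"
          unfolding R_def by (rule order_trans[OF elim(4) mult_left_mono[OF vn less_imp_le[OF K1(1)]]])
        have Rff: "L2_set ?jf (A_loc l l) \<le> Rf"
          unfolding Rf_def by (rule order_trans[OF elim(6) mult_left_mono[OF fn less_imp_le[OF K2(1)]]])
        let ?w = "L2_set (\<lambda>\<alpha>. ?ju \<alpha> - ?jv \<alpha>) (A_loc k (2 * m))"
        let ?Q = "\<lambda>\<alpha>. (rpow \<bar>?ju \<alpha>\<bar> (q' \<alpha> - g \<alpha>) + rpow \<bar>?jv \<alpha>\<bar> (q' \<alpha> - g \<alpha>)) * \<bar>?ju \<alpha> - ?jv \<alpha>\<bar> powr g \<alpha>"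
        let ?E = "\<lambda>\<alpha>. t powr g \<alpha> * (\<bar>?ju \<alpha>\<bar> powr q' \<alpha> + \<bar>?jv \<alpha>\<bar> powr q' \<alpha> + 2 * (\<bar>?jw \<alpha>\<bar> / t) powr q' \<alpha>)"
        have "(\<lambda>\<alpha>. ?ju \<alpha> - ?jv \<alpha>) = ?jw" using elim(2) by auto
        then have wle: "?w \<le> K1 * t" using elim(5) by (simp add: t_def)
        have "\<bar>?h x\<bar> \<le> L' * o' (?w + L2_set (\<lambda>\<alpha>. ?jf \<alpha> - ?jf \<alpha>) (A_loc l l)) + L' * (\<Sum>\<alpha>\<in>?G. ?Q \<alpha>)
            + L' * (\<Sum>\<alpha>\<in>?G2. (rpow \<bar>?jf \<alpha>\<bar> (p' \<alpha> - d \<alpha>) + rpow \<bar>?jf \<alpha>\<bar> (p' \<alpha> - d \<alpha>)) * \<bar>?jf \<alpha> - ?jf \<alpha>\<bar> powr d \<alpha>)"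
          unfolding nemytskii_def
          using elim(1)[THEN bspec, OF jet_jet_space, THEN bspec, OF jet_jet_space, THEN bspec, OF jet_jet_space, THEN bspec, OF jet_jet_space]
            Ru Rv Rff by blast
        \<comment> \<open>Both values share the same f, so the distances in the second argument are
          0 and the sum over its global indices disappears.\<close>
        also have "\<dots> = L' * o' ?w + L' * (\<Sum>\<alpha>\<in>?G. ?Q \<alpha>)"
          by (simp add: L2_set_def)
        \<comment> \<open>The absolute value is taken because the sign of L' is left open by the
          continuity condition.\<close>
        also have "\<dots> \<le> \<bar>L'\<bar> * o' (K1 * t) + \<bar>L'\<bar> * (\<Sum>\<alpha>\<in>?G. ?E \<alpha>)"
        proof (rule add_mono)
          have "o' ?w \<le> o' (K1 * t)"
            by (rule mono_onD[OF mono]) (use wle in \<open>auto intro: order_trans[OF L2_set_nonneg]\<close>)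
          moreover have "0 \<le> o' ?w" using mod by (simp add: modulus_of_continuity_def)
          ultimately show "L' * o' ?w \<le> \<bar>L'\<bar> * o' (K1 * t)" by (intro mult_mono) auto
          have QE: "0 \<le> ?Q \<alpha> \<and> ?Q \<alpha> \<le> ?E \<alpha>" if \<alpha>: "\<alpha> \<in> ?G" for \<alpha>
          proof
            show "0 \<le> ?Q \<alpha>" by (intro mult_nonneg_nonneg add_nonneg_nonneg) (auto simp: rpow_def)
            let ?y = "\<bar>?jw \<alpha>\<bar> / t"
            \<comment> \<open>Splitting off t before taking the power isolates t powr \<gamma>; the
              normalised quotient is then paired with the factors in u and v.\<close>
            have "\<bar>?ju \<alpha> - ?jv \<alpha>\<bar> = t * ?y" using elim(2) t by simp
            then have e: "\<bar>?ju \<alpha> - ?jv \<alpha>\<bar> powr g \<alpha> = t powr g \<alpha> * ?y powr g \<alpha>"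
              using powr_mult by (simp only:)
            have y: "rpow z (q' \<alpha> - g \<alpha>) * ?y powr g \<alpha> \<le> z powr q' \<alpha> + ?y powr q' \<alpha>" if "0 \<le> z" for z
              by (rule rpow_mult_powr_le) (use that t g[OF \<alpha>] q1[OF \<alpha>] in auto)
            have "?Q \<alpha> = t powr g \<alpha> * (rpow \<bar>?ju \<alpha>\<bar> (q' \<alpha> - g \<alpha>) * ?y powr g \<alpha> + rpow \<bar>?jv \<alpha>\<bar> (q' \<alpha> - g \<alpha>) * ?y powr g \<alpha>)"
              unfolding e by (simp only: distrib_left distrib_right mult_ac)
            also have "\<dots> \<le> t powr g \<alpha> * ((\<bar>?ju \<alpha>\<bar> powr q' \<alpha> + ?y powr q' \<alpha>) + (\<bar>?jv \<alpha>\<bar> powr q' \<alpha> + ?y powr q' \<alpha>))"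
              by (intro mult_left_mono add_mono y) auto
            also have "\<dots> = ?E \<alpha>" by (simp only: mult_2 add_ac)
            finally show "?Q \<alpha> \<le> ?E \<alpha>" .
          qed
          have "(\<Sum>\<alpha>\<in>?G. ?Q \<alpha>) \<le> (\<Sum>\<alpha>\<in>?G. ?E \<alpha>)" by (rule sum_mono) (use QE in blast)
          moreover have "0 \<le> (\<Sum>\<alpha>\<in>?G. ?Q \<alpha>)" by (rule sum_nonneg) (use QE in blast)
          ultimately show "L' * (\<Sum>\<alpha>\<in>?G. ?Q \<alpha>) \<le> \<bar>L'\<bar> * (\<Sum>\<alpha>\<in>?G. ?E \<alpha>)" by (intro mult_mono) auto
        qed
        finally have "\<bar>?h x\<bar>\<^sup>2 \<le> (\<bar>L'\<bar> * o' (K1 * t) + \<bar>L'\<bar> * (\<Sum>\<alpha>\<in>?G. ?E \<alpha>))\<^sup>2"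
          by (rule power_mono) simp
        also have "\<dots> \<le> 2 * (\<bar>L'\<bar> * o' (K1 * t))\<^sup>2 + 2 * (\<bar>L'\<bar> * (\<Sum>\<alpha>\<in>?G. ?E \<alpha>))\<^sup>2"
        proof -
          have "(y + z)\<^sup>2 \<le> 2 * y\<^sup>2 + 2 * z\<^sup>2" for y z :: real
            using zero_le_power2[of "y - z"] unfolding power2_sum power2_diff by linarith
          then show ?thesis .
        qed
        also have "\<dots> \<le> 2 * L'\<^sup>2 * (o' (K1 * t))\<^sup>2 + (\<Sum>\<alpha>\<in>?G. ?k * (t powr g \<alpha>)\<^sup>2 * F \<alpha> x)"
        proof (rule add_mono)
          show "2 * (\<bar>L'\<bar> * o' (K1 * t))\<^sup>2 \<le> 2 * L'\<^sup>2 * (o' (K1 * t))\<^sup>2" by (simp add: power_mult_distrib)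
          have E2: "(?E \<alpha>)\<^sup>2 \<le> (t powr g \<alpha>)\<^sup>2 * (3 * F \<alpha> x)" if \<alpha>: "\<alpha> \<in> ?G" for \<alpha>
          proof -
            have j: "jet \<Omega> k z x \<alpha> = wderiv \<Omega> \<alpha> z x" for z using \<alpha> by (simp add: jet_def A_glob_def)
            have "(\<bar>?ju \<alpha>\<bar> powr q' \<alpha> + \<bar>?jv \<alpha>\<bar> powr q' \<alpha> + 2 * (\<bar>?jw \<alpha>\<bar> / t) powr q' \<alpha>)\<^sup>2
              \<le> 3 * (\<bar>?ju \<alpha>\<bar> powr q' \<alpha>)\<^sup>2 + 3 * (\<bar>?jv \<alpha>\<bar> powr q' \<alpha>)\<^sup>2 + 3 * (2 * (\<bar>?jw \<alpha>\<bar> / t) powr q' \<alpha>)\<^sup>2"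
              by (rule three_squares_le)
            also have "\<dots> = 3 * F \<alpha> x"
              unfolding power_mult_distrib powr_divide power_divide powr_power2 j F_def by simp
            finally show ?thesis unfolding power_mult_distrib by (rule mult_left_mono) simp
          qed
          have "2 * (\<bar>L'\<bar> * (\<Sum>\<alpha>\<in>?G. ?E \<alpha>))\<^sup>2 = 2 * L'\<^sup>2 * (\<Sum>\<alpha>\<in>?G. ?E \<alpha>)\<^sup>2"
            by (simp add: power_mult_distrib)
          also have "\<dots> \<le> 2 * L'\<^sup>2 * (real (card ?G) * (\<Sum>\<alpha>\<in>?G. (?E \<alpha>)\<^sup>2))"
            by (intro mult_left_mono sum_power2_le) simp
          also have "\<dots> \<le> 2 * L'\<^sup>2 * (real (card ?G) * (\<Sum>\<alpha>\<in>?G. (t powr g \<alpha>)\<^sup>2 * (3 * F \<alpha> x)))"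
            by (intro mult_left_mono sum_mono E2) simp_all
          also have "\<dots> = (\<Sum>\<alpha>\<in>?G. ?k * (t powr g \<alpha>)\<^sup>2 * F \<alpha> x)"
            by (simp add: sum_distrib_left mult_ac)
          finally show "2 * (\<bar>L'\<bar> * (\<Sum>\<alpha>\<in>?G. ?E \<alpha>))\<^sup>2 \<le> (\<Sum>\<alpha>\<in>?G. ?k * (t powr g \<alpha>)\<^sup>2 * F \<alpha> x)" .
        qed
        finally show ?case by simp
      qed
      then have "(\<integral>\<^sup>+x. ennreal ((?h x)\<^sup>2) \<partial>lebesgue_on \<Omega>)
        \<le> (\<integral>\<^sup>+x. ennreal (2 * L'\<^sup>2 * (o' (K1 * t))\<^sup>2) + ennreal (\<Sum>\<alpha>\<in>?G. ?k * (t powr g \<alpha>)\<^sup>2 * F \<alpha> x) \<partial>lebesgue_on \<Omega>)"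
      proof (intro nn_integral_mono_AE, eventually_elim)
        case (elim x)
        have "0 \<le> (\<Sum>\<alpha>\<in>?G. ?k * (t powr g \<alpha>)\<^sup>2 * F \<alpha> x)" using F0 by (auto intro!: sum_nonneg)
        moreover have "0 \<le> 2 * L'\<^sup>2 * (o' (K1 * t))\<^sup>2" by simp
        ultimately show ?case using elim by (simp only: ennreal_plus[symmetric] ennreal_leI)
      qed
      also have "\<dots> = ennreal (2 * L'\<^sup>2 * (o' (K1 * t))\<^sup>2) * ennreal \<mu>
          + (\<integral>\<^sup>+x. ennreal (\<Sum>\<alpha>\<in>?G. ?k * (t powr g \<alpha>)\<^sup>2 * F \<alpha> x) \<partial>lebesgue_on \<Omega>)"
      proof -
        have "(\<lambda>x. ennreal (\<Sum>\<alpha>\<in>?G. ?k * (t powr g \<alpha>)\<^sup>2 * F \<alpha> x)) \<in> borel_measurable (lebesgue_on \<Omega>)"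
          by (intro measurable_compose[OF _ measurable_ennreal] borel_measurable_sum borel_measurable_times borel_measurable_const Fm)
        then show ?thesis by (simp only: nn_integral_add[OF borel_measurable_const] nn_integral_const \<mu>)
      qed
      also have "\<dots> \<le> ennreal (2 * L'\<^sup>2 * (o' (K1 * t))\<^sup>2 * \<mu>) + ennreal (\<Sum>\<alpha>\<in>?G. ?k * (t powr g \<alpha>)\<^sup>2 * B \<alpha>)"
      proof (rule add_mono)
        show "ennreal (2 * L'\<^sup>2 * (o' (K1 * t))\<^sup>2) * ennreal \<mu> \<le> ennreal (2 * L'\<^sup>2 * (o' (K1 * t))\<^sup>2 * \<mu>)"
          by (rule eq_refl, rule ennreal_mult'[symmetric]) simp
        show "(\<integral>\<^sup>+x. ennreal (\<Sum>\<alpha>\<in>?G. ?k * (t powr g \<alpha>)\<^sup>2 * F \<alpha> x) \<partial>lebesgue_on \<Omega>)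
          \<le> ennreal (\<Sum>\<alpha>\<in>?G. ?k * (t powr g \<alpha>)\<^sup>2 * B \<alpha>)"
          by (rule nn_integral_weighted_sum_le[OF finite_A_glob Fm F0 _ B FB]) simp_all
      qed
      also have "\<dots> = ennreal (2 * L'\<^sup>2 * (o' (K1 * t))\<^sup>2 * \<mu> + (\<Sum>\<alpha>\<in>?G. ?k * (t powr g \<alpha>)\<^sup>2 * B \<alpha>))"
        by (rule ennreal_plus[symmetric]) (use B in \<open>auto simp: \<mu>_def intro!: sum_nonneg\<close>)
      also have "\<dots> \<le> ennreal ((w0 * S)\<^sup>2)"
      proof (rule ennreal_leI)
        \<comment> \<open>All summands of S are nonnegative, so each of them is at most S and the
          weighted squares are bounded by W S^2.\<close>
        have oS: "(o' (K1 * t))\<^sup>2 \<le> S\<^sup>2"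
          by (rule power_mono[OF _ o0]) (simp add: S_def sum_nonneg)
        have tS: "(t powr g \<alpha>)\<^sup>2 \<le> S\<^sup>2" if "\<alpha> \<in> ?G" for \<alpha>
        proof (rule power_mono)
          have "t powr g \<alpha> \<le> (\<Sum>\<alpha>\<in>?G. t powr g \<alpha>)"
            by (rule member_le_sum[OF that]) (auto simp: finite_A_glob)
          then show "t powr g \<alpha> \<le> S" unfolding S_def using o0 by linarith
        qed simp
        have "2 * L'\<^sup>2 * (o' (K1 * t))\<^sup>2 * \<mu> + (\<Sum>\<alpha>\<in>?G. ?k * (t powr g \<alpha>)\<^sup>2 * B \<alpha>)
          \<le> 2 * L'\<^sup>2 * S\<^sup>2 * \<mu> + (\<Sum>\<alpha>\<in>?G. ?k * S\<^sup>2 * B \<alpha>)"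
          by (intro add_mono sum_mono mult_right_mono mult_left_mono oS tS B) (auto simp: \<mu>_def)
        also have "\<dots> = W * S\<^sup>2"
          unfolding W_def distrib_right sum_distrib_right by (simp only: mult_ac)
        also have "\<dots> \<le> w0\<^sup>2 * S\<^sup>2" by (rule mult_right_mono[OF w0(2)]) simp
        also have "\<dots> = (w0 * S)\<^sup>2" by (simp only: power_mult_distrib)
        finally show "2 * L'\<^sup>2 * (o' (K1 * t))\<^sup>2 * \<mu> + (\<Sum>\<alpha>\<in>?G. ?k * (t powr g \<alpha>)\<^sup>2 * B \<alpha>) \<le> (w0 * S)\<^sup>2" .
      qed
      finally have le: "(\<integral>\<^sup>+x. ennreal ((?h x)\<^sup>2) \<partial>lebesgue_on \<Omega>) \<le> ennreal ((w0 * S)\<^sup>2)" .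
      have hm: "?h \<in> borel_measurable (lebesgue_on \<Omega>)"
        by (intro borel_measurable_diff nemytskii_measurable[OF \<Omega>(1) car _ k' f] u v)
      show ?thesis by (rule L2_if_nn_integral_le(2)[OF hm le]) (use w0(1) S0 in simp)
    qed
    then show "L2_norm \<Omega> ?h \<le> w0 * (\<omega> R Rf (K1 * Sobolev_norm \<Omega> (2 * m) (\<lambda>x. u x - v x))
          + (\<Sum>\<alpha>\<in>?G. Sobolev_norm \<Omega> (2 * m) (\<lambda>x. u x - v x) powr \<gamma> R Rf \<alpha>))"
      by (simp only: S_def t_def w_def o'_def g_def)
  qed
qed

theorem proposition2p1:
  fixes \<Omega> :: "(real^'n::finite) set"
    and m k l :: nat
    and U F :: "(real^'n \<Rightarrow> real) set"
    and c :: "real^'n \<Rightarrow> 'n jet \<Rightarrow> 'n jet \<Rightarrow> real"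
    and a :: "real \<Rightarrow> real \<Rightarrow> real^'n \<Rightarrow> real"
    and b L :: "real \<Rightarrow> real \<Rightarrow> real"
    and q p \<gamma> \<delta> :: "real \<Rightarrow> real \<Rightarrow> 'n mindex \<Rightarrow> real"
    and \<omega> :: "real \<Rightarrow> real \<Rightarrow> real \<Rightarrow> real"
    and u0 f0 :: "real^'n \<Rightarrow> real"
  assumes "C1_domain \<Omega>"
    and "k < 2 * m"
    and "closed_Sobolev_subspace \<Omega> (2 * m) U"
    and "closed_Sobolev_subspace \<Omega> l F"
    and "caratheodory \<Omega> k l c"
    and "growth_condition \<Omega> m k l c a b q p"
    and "continuity_condition \<Omega> m k l c q p \<omega> L \<gamma> \<delta>"
    and "f0 \<in> F" and "u0 \<in> U"
    and "linearization_condition \<Omega> m k l c U F u0 f0"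
  shows
    "(\<forall>u\<in>U. \<forall>f\<in>F. nemytskii \<Omega> k l c u f \<in> L2 \<Omega>
        \<and> (\<forall>u'\<in>U. \<forall>f'\<in>F. \<forall>\<xi> \<zeta>.
             (AE x in lebesgue_on \<Omega>. u' x = u x) \<and> (AE x in lebesgue_on \<Omega>. f' x = f x)
             \<and> is_jet \<Omega> k u' \<xi> \<and> is_jet \<Omega> l f' \<zeta> \<longrightarrow>
             (AE x in lebesgue_on \<Omega>. c x (\<xi> x) (\<zeta> x) = nemytskii \<Omega> k l c u f x)))
     \<and> (\<forall>B \<subseteq> U \<times> F.
          (\<exists>K. \<forall>(u, f)\<in>B. Sobolev_norm \<Omega> (2 * m) u + Sobolev_norm \<Omega> l f \<le> K)
          \<longrightarrow> (\<exists>K. \<forall>(u, f)\<in>B. L2_norm \<Omega> (nemytskii \<Omega> k l c u f) \<le> K))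
     \<and> (\<exists>r>0. \<exists>s>0. \<exists>\<omega>C. modulus_of_continuity \<omega>C
          \<and> (\<forall>u\<in>U. \<forall>v\<in>U. \<forall>f\<in>F.
               Sobolev_norm \<Omega> (2 * m) (\<lambda>x. u x - u0 x) < r
               \<and> Sobolev_norm \<Omega> (2 * m) (\<lambda>x. v x - u0 x) < r
               \<and> Sobolev_norm \<Omega> l (\<lambda>x. f x - f0 x) < s \<longrightarrow>
               L2_norm \<Omega> (\<lambda>x. nemytskii \<Omega> k l c u f x - nemytskii \<Omega> k l c v f x)
                 \<le> \<omega>C (Sobolev_norm \<Omega> (2 * m) (\<lambda>x. u x - v x)))
          \<and> (\<exists>w0>0. \<exists>w1>0. \<exists>R>0. \<exists>Rf>0. \<forall>t\<ge>0.
               \<omega>C t = w0 * (\<omega> R Rf (w1 * t)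
                            + (\<Sum>\<alpha>\<in>A_glob k (2 * m). t powr \<gamma> R Rf \<alpha>))))"
proof (intro conjI)
  have \<Omega>: "open \<Omega>" using assms(1) by (simp add: C1_domain_def)
  have U: "U \<subseteq> Sobolev \<Omega> (2 * m)" by (rule assms(3)[unfolded closed_Sobolev_subspace_def, THEN conjunct1])
  have F: "F \<subseteq> Sobolev \<Omega> l" by (rule assms(4)[unfolded closed_Sobolev_subspace_def, THEN conjunct1])
  note bounded = nemytskii_bounded[OF assms(1,2,5,6)]
  show "\<forall>u\<in>U. \<forall>f\<in>F. nemytskii \<Omega> k l c u f \<in> L2 \<Omega>
        \<and> (\<forall>u'\<in>U. \<forall>f'\<in>F. \<forall>\<xi> \<zeta>.
             (AE x in lebesgue_on \<Omega>. u' x = u x) \<and> (AE x in lebesgue_on \<Omega>. f' x = f x)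
             \<and> is_jet \<Omega> k u' \<xi> \<and> is_jet \<Omega> l f' \<zeta> \<longrightarrow>
             (AE x in lebesgue_on \<Omega>. c x (\<xi> x) (\<zeta> x) = nemytskii \<Omega> k l c u f x))"
  proof (intro ballI conjI allI impI)
    fix u f assume "u \<in> U" "f \<in> F"
    then have u: "u \<in> Sobolev \<Omega> (2 * m)" and f: "f \<in> Sobolev \<Omega> l" using U F by auto
    let ?\<rho> = "1 + Sobolev_norm \<Omega> (2 * m) u + Sobolev_norm \<Omega> l f"
    have \<rho>: "0 < ?\<rho>" "Sobolev_norm \<Omega> (2 * m) u \<le> ?\<rho>" "Sobolev_norm \<Omega> l f \<le> ?\<rho>"
      using Sobolev_norm_nonneg[of \<Omega> "2 * m" u] Sobolev_norm_nonneg[of \<Omega> l f] by linarith+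
    from bounded[OF \<rho>(1)] show "nemytskii \<Omega> k l c u f \<in> L2 \<Omega>" using u f \<rho>(2,3) by blast
    fix u' f' \<xi> \<zeta>
    assume *: "(AE x in lebesgue_on \<Omega>. u' x = u x) \<and> (AE x in lebesgue_on \<Omega>. f' x = f x)
             \<and> is_jet \<Omega> k u' \<xi> \<and> is_jet \<Omega> l f' \<zeta>"
    \<comment> \<open>Any jets of any representatives agree almost everywhere with those in
      \<open>nemytskii\<close>, so C is an operator on equivalence classes.\<close>
    have "AE x in lebesgue_on \<Omega>. \<xi> x = jet \<Omega> k u x"
      by (rule is_jet_AE_eq_jet[OF \<Omega> u]) (use * assms(2) in auto)
    moreover have "AE x in lebesgue_on \<Omega>. \<zeta> x = jet \<Omega> l f x"
      by (rule is_jet_AE_eq_jet[OF \<Omega> f]) (use * in auto)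
    ultimately show "AE x in lebesgue_on \<Omega>. c x (\<xi> x) (\<zeta> x) = nemytskii \<Omega> k l c u f x"
      by eventually_elim (simp add: nemytskii_def)
  qed
  show "\<forall>B \<subseteq> U \<times> F.
          (\<exists>K. \<forall>(u, f)\<in>B. Sobolev_norm \<Omega> (2 * m) u + Sobolev_norm \<Omega> l f \<le> K)
          \<longrightarrow> (\<exists>K. \<forall>(u, f)\<in>B. L2_norm \<Omega> (nemytskii \<Omega> k l c u f) \<le> K)"
  proof (intro allI impI)
    fix B assume B: "B \<subseteq> U \<times> F" and "\<exists>K. \<forall>(u, f)\<in>B. Sobolev_norm \<Omega> (2 * m) u + Sobolev_norm \<Omega> l f \<le> K"
    then obtain K where K: "\<forall>(u, f)\<in>B. Sobolev_norm \<Omega> (2 * m) u + Sobolev_norm \<Omega> l f \<le> K" by blast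
    \<comment> \<open>The given bound K may be 0 or negative, whereas the radius of the ball has to
      be positive.\<close>
    have "0 < max K 1" by simp
    from bounded[OF this] obtain K' where K': "\<forall>u\<in>Sobolev \<Omega> (2 * m). \<forall>f\<in>Sobolev \<Omega> l. Sobolev_norm \<Omega> (2 * m) u \<le> max K 1 \<longrightarrow> Sobolev_norm \<Omega> l f \<le> max K 1 \<longrightarrow>
      nemytskii \<Omega> k l c u f \<in> L2 \<Omega> \<and> L2_norm \<Omega> (nemytskii \<Omega> k l c u f) \<le> K'"
      by (elim exE)
    have "L2_norm \<Omega> (nemytskii \<Omega> k l c u f) \<le> K'" if uf: "(u, f) \<in> B" for u f
    proof -
      have u: "u \<in> Sobolev \<Omega> (2 * m)" and f: "f \<in> Sobolev \<Omega> l" using uf B U F by auto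
      have "Sobolev_norm \<Omega> (2 * m) u + Sobolev_norm \<Omega> l f \<le> K" using K uf by auto
      then have "Sobolev_norm \<Omega> (2 * m) u \<le> max K 1" "Sobolev_norm \<Omega> l f \<le> max K 1"
        using Sobolev_norm_nonneg[of \<Omega> "2 * m" u] Sobolev_norm_nonneg[of \<Omega> l f] by linarith+
      then show ?thesis using K' u f by blast
    qed
    then show "\<exists>K. \<forall>(u, f)\<in>B. L2_norm \<Omega> (nemytskii \<Omega> k l c u f) \<le> K" by (intro exI[of _ K']) auto
  qed
  let ?n = "Sobolev_norm \<Omega> (2 * m)" and ?nf = "Sobolev_norm \<Omega> l"
  \<comment> \<open>With r = s = 1, \<open>Sobolev_norm_le_diff\<close> places both unit balls
    around u0 and f0 inside balls of this radius around 0, where the uniform estimate holds.\<close>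
  define \<rho> where "\<rho> = 2 * (1 + ?n u0 + ?nf f0)"
  have \<rho>: "0 < \<rho>" using Sobolev_norm_nonneg[of \<Omega> "2 * m" u0] Sobolev_norm_nonneg[of \<Omega> l f0] by (simp add: \<rho>_def)
  from nemytskii_modulus[OF assms(1,2,5,6,7) \<rho>]
  obtain w0 w1 R Rf where w: "w0 > 0" "w1 > 0" "R > 0" "Rf > 0"
    and est: "\<forall>u\<in>Sobolev \<Omega> (2 * m). \<forall>v\<in>Sobolev \<Omega> (2 * m). \<forall>f\<in>Sobolev \<Omega> l.
    (\<lambda>x. u x - v x) \<in> Sobolev \<Omega> (2 * m) \<longrightarrow> ?n u \<le> \<rho> \<longrightarrow> ?n v \<le> \<rho> \<longrightarrow> ?nf f \<le> \<rho> \<longrightarrow>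
    L2_norm \<Omega> (\<lambda>x. nemytskii \<Omega> k l c u f x - nemytskii \<Omega> k l c v f x)
      \<le> w0 * (\<omega> R Rf (w1 * ?n (\<lambda>x. u x - v x)) + (\<Sum>\<alpha>\<in>A_glob k (2 * m). ?n (\<lambda>x. u x - v x) powr \<gamma> R Rf \<alpha>))"
    by (elim exE conjE)
  define \<omega>C where "\<omega>C t = w0 * (\<omega> R Rf (w1 * t) + (\<Sum>\<alpha>\<in>A_glob k (2 * m). t powr \<gamma> R Rf \<alpha>))" for t
  have mod: "modulus_of_continuity (\<omega> R Rf)"
    using assms(7) w(3,4) unfolding continuity_condition_def by blast
  have form: "\<exists>w0>0. \<exists>w1>0. \<exists>R>0. \<exists>Rf>0. \<forall>t\<ge>0.
      \<omega>C t = w0 * (\<omega> R Rf (w1 * t) + (\<Sum>\<alpha>\<in>A_glob k (2 * m). t powr \<gamma> R Rf \<alpha>))"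
    using w \<omega>C_def by blast
  have "modulus_of_continuity \<omega>C"
    unfolding modulus_of_continuity_def
  proof (intro conjI allI impI)
    show "0 \<le> \<omega>C t" if "0 \<le> t" for t
      unfolding \<omega>C_def using mod w(1,2) that
      by (intro mult_nonneg_nonneg add_nonneg_nonneg sum_nonneg) (auto simp: modulus_of_continuity_def)
    show "\<omega>C 0 = 0" using mod by (simp add: \<omega>C_def modulus_of_continuity_def)
  qed
  moreover have "L2_norm \<Omega> (\<lambda>x. nemytskii \<Omega> k l c u f x - nemytskii \<Omega> k l c v f x) \<le> \<omega>C (?n (\<lambda>x. u x - v x))"
    if u: "u \<in> U" and v: "v \<in> U" and f: "f \<in> F" and ur: "?n (\<lambda>x. u x - u0 x) < 1" and vr: "?n (\<lambda>x. v x - u0 x) < 1"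
      and fr: "?nf (\<lambda>x. f x - f0 x) < 1" for u v f
  proof -
    note dU = closed_Sobolev_subspace_diff[OF assms(3), THEN subsetD[OF U]]
      and dF = closed_Sobolev_subspace_diff[OF assms(4), THEN subsetD[OF F]]
    have u': "u \<in> Sobolev \<Omega> (2 * m)" and v': "v \<in> Sobolev \<Omega> (2 * m)" and f': "f \<in> Sobolev \<Omega> l"
      and u0': "u0 \<in> Sobolev \<Omega> (2 * m)" and f0': "f0 \<in> Sobolev \<Omega> l"
      using u v f assms(8,9) U F by auto
    have aux: "x \<le> 2 * (1 + y + z)" if "x \<le> 2 * (e + y)" "e < 1" "0 \<le> z" for x y z e :: real
      using that by argo
    have "?n u \<le> \<rho>" unfolding \<rho>_def
      by (rule aux[OF Sobolev_norm_le_diff[OF \<Omega> u' u0' dU[OF u assms(9)]] ur Sobolev_norm_nonneg])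
    moreover have "?n v \<le> \<rho>" unfolding \<rho>_def
      by (rule aux[OF Sobolev_norm_le_diff[OF \<Omega> v' u0' dU[OF v assms(9)]] vr Sobolev_norm_nonneg])
    moreover have "?nf f \<le> \<rho>"
      using aux[OF Sobolev_norm_le_diff[OF \<Omega> f' f0' dF[OF f assms(8)]] fr Sobolev_norm_nonneg[of \<Omega> "2 * m" u0]]
      by (simp only: \<rho>_def add_ac)
    ultimately show ?thesis
      unfolding \<omega>C_def using est u' v' f' dU[OF u v] by blast
  qed
  ultimately show "\<exists>r>0. \<exists>s>0. \<exists>\<omega>C. modulus_of_continuity \<omega>C
          \<and> (\<forall>u\<in>U. \<forall>v\<in>U. \<forall>f\<in>F. ?n (\<lambda>x. u x - u0 x) < r \<and> ?n (\<lambda>x. v x - u0 x) < r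
               \<and> ?nf (\<lambda>x. f x - f0 x) < s \<longrightarrow>
               L2_norm \<Omega> (\<lambda>x. nemytskii \<Omega> k l c u f x - nemytskii \<Omega> k l c v f x) \<le> \<omega>C (?n (\<lambda>x. u x - v x)))
          \<and> (\<exists>w0>0. \<exists>w1>0. \<exists>R>0. \<exists>Rf>0. \<forall>t\<ge>0.
               \<omega>C t = w0 * (\<omega> R Rf (w1 * t) + (\<Sum>\<alpha>\<in>A_glob k (2 * m). t powr \<gamma> R Rf \<alpha>)))"
    by (intro exI[of _ "1 :: real"] conjI[OF zero_less_one] exI[of _ \<omega>C], intro conjI form) blast+
qed

end
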